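(* If (MBFH) is NP-hard and $\mathrm{NP}\neq\mathrm{P}$, then there exists no polynomial and no pseudo-polynomial algorithm for (TR-IP), and there exists no polynomial and no pseudo-polynomial algorithm for the two-dimensional weighted problem (wTR-IP-2D).
   Context: (MBFH): given a finite subgraph $G=(V,E)$ of the infinite grid graph $\mathbb{Z}\times\mathbb{Z}$ (nodes are integer points, edges join points at Euclidean distance one) with an arbitrary number of holes, find a partition of $V$ into $S$ and $V\setminus S$ with $|S|,|V\setminus S|\le\lceil|V|/2\rceil$ minimizing the number of edges with one endpoint in $S$ and one in $V\setminus S$. (TR-IP): given $N,M\in\mathbb{N}$, a finite contiguous set of integers $\Xi\subset\mathbb{Z}$, $x\in\Xi^{N\times M}$, a cost matrix $c\in\mathbb{R}^{N\times M}$, $\alpha>0$ and $\Delta\in\mathbb{N}$, solve $$\min_{d\in\mathbb{Z}^{N\times M}}\ \sum_{i=1}^N\sum_{j=1}^M c_{i,j}d_{i,j}+\alpha\sum_{j=1}^M\sum_{i=1}^{N-1}|x_{i+1,j}+d_{i+1,j}-x_{i,j}-d_{i,j}|+\alpha\sum_{i=1}^N\sum_{j=1}^{M-1}|x_{i,j+1}+d_{i,j+1}-x_{i,j}-d_{i,j}|$$ subject to $x_{i,j}+d_{i,j}\in\Xi$ for all $i,j$ and $\sum_{i=1}^N\sum_{j=1}^M|d_{i,j}|\le\Delta$. (wTR-IP-2D): the same problem where the constant $\alpha$ is replaced by individual weights in $\mathbb{R}_{\ge0}$, one for each of the absolute-value (jump) terms in the objective, and the constraint $\sum_{i,j}|d_{i,j}|\le\Delta$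 is replaced by $\sum_{i,j}h_{i,j}|d_{i,j}|\le\Delta$ with weights $h_{i,j}\in\mathbb{R}_{\ge0}$. For complexity statements the input data are rational; an algorithm is pseudo-polynomial if its running time is polynomial in the size of the instance and in the absolute values of the numerical data (after scaling the data to integers). *)

theory Defs
  imports Complex_Main "HOL-Library.Log_Nat" "HOL-Computational_Algebra.Polynomial"
begin

section \<open>Machine model\<close>

text \<open>
  Programs for a deterministic random access machine: integer registers, growable integer arrays,
  addition and subtraction as the only arithmetic, unit cost per instruction and per test.
  One step lengthens the binary representation of a number by at most one bit and an array by at
  most one cell, so unit cost is polynomially related to the time of a Turing machine, as usual for
  random access machines without multiplication.  Registers and arrays are numbered by
  \<open>nat\<close>; a program mentions only finitely many of them.
\<close>

datatype cmd =
    Const nat int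
  | Add nat nat nat
  | Sub nat nat nat
  | Len nat nat
  | Get nat nat nat
  | Put nat nat nat
  | Push nat nat
  | Seq cmd cmd
  | Cond nat cmd cmd
  | While nat cmd

type_synonym state = "(nat \<Rightarrow> int) \<times> (nat \<Rightarrow> int list)"

text \<open>
  In \<open>Get\<close> and \<open>Put\<close> the last argument is the register that holds the array index.  Reading
  outside of an array gives 0, writing outside of it has no effect.
\<close>

inductive exec :: "cmd \<Rightarrow> state \<Rightarrow> nat \<Rightarrow> state \<Rightarrow> bool" where
  Const: "exec (Const r c) (R, A) 1 (R(r := c), A)"
| Add: "exec (Add r p q) (R, A) 1 (R(r := R p + R q), A)"
| Sub: "exec (Sub r p q) (R, A) 1 (R(r := R p - R q), A)"
| Len: "exec (Len r a) (R, A) 1 (R(r := int (length (A a))), A)"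
| Get: "exec (Get r a p) (R, A) 1
          (R(r := (if 0 \<le> R p then nth_default 0 (A a) (nat (R p)) else 0)), A)"
| Put: "exec (Put a r p) (R, A) 1
          (R, A(a := (if 0 \<le> R p then (A a)[nat (R p) := R r] else A a)))"
| Push: "exec (Push a r) (R, A) 1 (R, A(a := A a @ [R r]))"
| Seq: "exec M s t s' \<Longrightarrow> exec M' s' t' s'' \<Longrightarrow> exec (Seq M M') s (t + t') s''"
| CondTrue: "R r > 0 \<Longrightarrow> exec M (R, A) t s \<Longrightarrow> exec (Cond r M M') (R, A) (Suc t) s"
| CondFalse: "R r \<le> 0 \<Longrightarrow> exec M' (R, A) t s \<Longrightarrow> exec (Cond r M M') (R, A) (Suc t) s"
| WhileTrue: "R r > 0 \<Longrightarrow> exec M (R, A) t s \<Longrightarrow> exec (While r M) s t' s' \<Longrightarrow>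
    exec (While r M) (R, A) (Suc (t + t')) s'"
| WhileFalse: "R r \<le> 0 \<Longrightarrow> exec (While r M) (R, A) 1 (R, A)"

text \<open>
  The inputs are stored in the arrays 1, 2, \dots; the output is the final content of array 0.
\<close>

definition init :: "int list list \<Rightarrow> state" where
  "init xss = ((\<lambda>_. 0), (\<lambda>a. nth_default [] ([] # xss) a))"

definition run :: "cmd \<Rightarrow> int list list \<Rightarrow> nat \<Rightarrow> int list \<Rightarrow> bool" where
  "run M xss t zs \<longleftrightarrow> (\<exists>R A. exec M (init xss) t (R, A) \<and> A 0 = zs)"

text \<open>Binary length: the digits of the absolute value and a sign, for every entry.\<close>

definition size_int :: "int \<Rightarrow> nat" where
  "size_int z = floorlog 2 (nat \<bar>z\<bar>) + 1"

definition bitsize :: "int list \<Rightarrow> nat" where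
  "bitsize xs = (\<Sum>x\<leftarrow>xs. size_int x)"


section \<open>Complexity classes\<close>

definition class_P :: "int list set set" where
  "class_P = {L. \<exists>M (p :: nat poly). \<forall>xs. \<exists>t.
     run M [xs] t [of_bool (xs \<in> L)] \<and> t \<le> poly p (bitsize xs)}"

definition poly_time_relation :: "(int list \<Rightarrow> int list \<Rightarrow> bool) \<Rightarrow> bool" where
  "poly_time_relation W \<longleftrightarrow> (\<exists>M (p :: nat poly). \<forall>xs ys. \<exists>t.
     run M [xs, ys] t [of_bool (W xs ys)] \<and> t \<le> poly p (bitsize xs + bitsize ys))"

definition class_NP :: "int list set set" where
  "class_NP = {L. \<exists>W (q :: nat poly). poly_time_relation W \<and>
     (\<forall>xs. xs \<in> L \<longleftrightarrow> (\<exists>ys. bitsize ys \<le> poly q (bitsize xs) \<and> W xs ys))}"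

text \<open>
  NP-hardness of a minimisation problem with objective values in \<open>nat\<close> is NP-hardness, with respect
  to polynomial-time many-one reductions, of its decision version: given an instance and a bound
  \<open>k\<close>, is there a feasible solution of cost at most \<open>k\<close>?  Here \<open>codes i\<close> is the set of integer
  sequences that describe \<open>i\<close>; it is empty if \<open>i\<close> is not an instance of the problem.
\<close>

definition NP_hard_minimisation ::
  "('i \<Rightarrow> int list set) \<Rightarrow> ('i \<Rightarrow> 's \<Rightarrow> bool) \<Rightarrow> ('i \<Rightarrow> 's \<Rightarrow> nat) \<Rightarrow> bool" where
  "NP_hard_minimisation codes feasible cost \<longleftrightarrow>
    (\<forall>L \<in> class_NP. \<exists>M (p :: nat poly). \<forall>xs. \<exists>t i w k.
       run M [xs] t (int k # w) \<and> t \<le> poly p (bitsize xs) \<and> w \<in> codes i \<and>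
       (xs \<in> L \<longleftrightarrow> (\<exists>s. feasible i s \<and> cost i s \<le> k)))"

text \<open>
  An algorithm has to output a code of an optimal solution.  Pseudo-polynomial bounds are polynomial
  in the sum of input size and magnitude of the numerical data; this is the same as being bounded by
  a bivariate polynomial with natural coefficients in both quantities.
\<close>

record 'i optimisation_problem =
  instances :: "'i set"
  encode :: "'i \<Rightarrow> int list"
  magnitude :: "'i \<Rightarrow> nat"
  solutions :: "'i \<Rightarrow> int list set"

definition polynomial_algorithm :: "cmd \<Rightarrow> 'i optimisation_problem \<Rightarrow> bool" where
  "polynomial_algorithm M \<Pi> \<longleftrightarrow> (\<exists>p :: nat poly. \<forall>i \<in> instances \<Pi>. \<exists>t zs.
     run M [encode \<Pi> i] t zs \<and> zs \<in> solutions \<Pi> i \<and> t \<le> poly p (bitsize (encode \<Pi> i)))"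

definition pseudo_polynomial_algorithm :: "cmd \<Rightarrow> 'i optimisation_problem \<Rightarrow> bool" where
  "pseudo_polynomial_algorithm M \<Pi> \<longleftrightarrow> (\<exists>p :: nat poly. \<forall>i \<in> instances \<Pi>. \<exists>t zs.
     run M [encode \<Pi> i] t zs \<and> zs \<in> solutions \<Pi> i \<and>
     t \<le> poly p (bitsize (encode \<Pi> i) + magnitude \<Pi> i))"


section \<open>Minimum bisection of grid graphs with holes\<close>

type_synonym point = "int \<times> int"
type_synonym graph = "point set \<times> point set set"

text \<open>Edges are two-element sets; the subgraph need not be induced.\<close>

definition grid_adjacent :: "point \<Rightarrow> point \<Rightarrow> bool" where
  "grid_adjacent u v \<longleftrightarrow> (fst u - fst v)\<^sup>2 + (snd u - snd v)\<^sup>2 = 1"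

definition grid_subgraph :: "graph \<Rightarrow> bool" where
  "grid_subgraph = (\<lambda>(V, E). finite V \<and> E \<subseteq> {{u, v} | u v. u \<in> V \<and> v \<in> V \<and> grid_adjacent u v})"

definition bisection :: "graph \<Rightarrow> point set \<Rightarrow> bool" where
  "bisection = (\<lambda>(V, E) S. S \<subseteq> V \<and> int (card S) \<le> \<lceil>rat_of_nat (card V) / 2\<rceil> \<and>
     int (card (V - S)) \<le> \<lceil>rat_of_nat (card V) / 2\<rceil>)"

definition cut_size :: "graph \<Rightarrow> point set \<Rightarrow> nat" where
  "cut_size = (\<lambda>(V, E) S. card {e \<in> E. \<exists>u v. e = {u, v} \<and> u \<in> S \<and> v \<in> V - S})"

text \<open>
  A graph is described by any listing, without repetitions, of its nodes and then of its edges, each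
  list preceded by its length; \<open>es\<close> contains every edge with one of its two orientations.
\<close>

definition graph_codes :: "graph \<Rightarrow> int list set" where
  "graph_codes = (\<lambda>(V, E).
    {int (length vs) # concat (map (\<lambda>(a, b). [a, b]) vs) @
     int (length es) # concat (map (\<lambda>((a, b), (c, d)). [a, b, c, d]) es) | vs es.
       grid_subgraph (V, E) \<and> set vs = V \<and> distinct vs \<and>
       set (map (\<lambda>(u, v). {u, v}) es) = E \<and> distinct (map (\<lambda>(u, v). {u, v}) es)})"

definition MBFH_NP_hard :: bool where
  "MBFH_NP_hard \<longleftrightarrow> NP_hard_minimisation graph_codes bisection cut_size"


section \<open>Trust-region integer programs\<close>

text \<open>
  Matrices are functions of a row index in \<open>{1..rows}\<close> and a column index in \<open>{1..cols}\<close>; their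
  values elsewhere are irrelevant.  The contiguous set of admissible values is \<open>{lower..upper}\<close>.
\<close>

record grid_data =
  rows :: nat
  cols :: nat
  lower :: int
  upper :: int
  start :: "nat \<Rightarrow> nat \<Rightarrow> int"
  cost :: "nat \<Rightarrow> nat \<Rightarrow> rat"
  radius :: nat

record tr_ip = grid_data +
  alpha :: rat

text \<open>
  \<open>vweight i j\<close> belongs to the jump between \<open>(i, j)\<close> and \<open>(i + 1, j)\<close>, and \<open>hweight i j\<close> to the jump
  between \<open>(i, j)\<close> and \<open>(i, j + 1)\<close>.
\<close>

record wtr_ip = grid_data +
  vweight :: "nat \<Rightarrow> nat \<Rightarrow> rat"
  hweight :: "nat \<Rightarrow> nat \<Rightarrow> rat"
  tr_weight :: "nat \<Rightarrow> nat \<Rightarrow> rat"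

definition admissible :: "'a grid_data_scheme \<Rightarrow> (nat \<Rightarrow> nat \<Rightarrow> int) \<Rightarrow> bool" where
  "admissible I y \<longleftrightarrow> (\<forall>i \<in> {1..rows I}. \<forall>j \<in> {1..cols I}. y i j \<in> {lower I..upper I})"

definition tr_ip_instance :: "tr_ip \<Rightarrow> bool" where
  "tr_ip_instance I \<longleftrightarrow> admissible I (start I) \<and> alpha I > 0"

definition tr_ip_objective :: "tr_ip \<Rightarrow> (nat \<Rightarrow> nat \<Rightarrow> int) \<Rightarrow> rat" where
  "tr_ip_objective I d =
     (\<Sum>i = 1..rows I. \<Sum>j = 1..cols I. cost I i j * of_int (d i j)) +
     alpha I * (\<Sum>j = 1..cols I. \<Sum>i = 1..<rows I.
       of_int \<bar>start I (i + 1) j + d (i + 1) j - start I i j - d i j\<bar>) +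
     alpha I * (\<Sum>i = 1..rows I. \<Sum>j = 1..<cols I.
       of_int \<bar>start I i (j + 1) + d i (j + 1) - start I i j - d i j\<bar>)"

definition tr_ip_feasible :: "tr_ip \<Rightarrow> (nat \<Rightarrow> nat \<Rightarrow> int) \<Rightarrow> bool" where
  "tr_ip_feasible I d \<longleftrightarrow> admissible I (\<lambda>i j. start I i j + d i j) \<and>
     (\<Sum>i = 1..rows I. \<Sum>j = 1..cols I. \<bar>d i j\<bar>) \<le> int (radius I)"

definition tr_ip_optimal :: "tr_ip \<Rightarrow> (nat \<Rightarrow> nat \<Rightarrow> int) \<Rightarrow> bool" where
  "tr_ip_optimal I d \<longleftrightarrow> tr_ip_feasible I d \<and>
     (\<forall>d'. tr_ip_feasible I d' \<longrightarrow> tr_ip_objective I d \<le> tr_ip_objective I d')"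

definition wtr_ip_instance :: "wtr_ip \<Rightarrow> bool" where
  "wtr_ip_instance I \<longleftrightarrow> admissible I (start I) \<and>
     (\<forall>i \<in> {1..<rows I}. \<forall>j \<in> {1..cols I}. vweight I i j \<ge> 0) \<and>
     (\<forall>i \<in> {1..rows I}. \<forall>j \<in> {1..<cols I}. hweight I i j \<ge> 0) \<and>
     (\<forall>i \<in> {1..rows I}. \<forall>j \<in> {1..cols I}. tr_weight I i j \<ge> 0)"

definition wtr_ip_objective :: "wtr_ip \<Rightarrow> (nat \<Rightarrow> nat \<Rightarrow> int) \<Rightarrow> rat" where
  "wtr_ip_objective I d =
     (\<Sum>i = 1..rows I. \<Sum>j = 1..cols I. cost I i j * of_int (d i j)) +
     (\<Sum>j = 1..cols I. \<Sum>i = 1..<rows I.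
       vweight I i j * of_int \<bar>start I (i + 1) j + d (i + 1) j - start I i j - d i j\<bar>) +
     (\<Sum>i = 1..rows I. \<Sum>j = 1..<cols I.
       hweight I i j * of_int \<bar>start I i (j + 1) + d i (j + 1) - start I i j - d i j\<bar>)"

definition wtr_ip_feasible :: "wtr_ip \<Rightarrow> (nat \<Rightarrow> nat \<Rightarrow> int) \<Rightarrow> bool" where
  "wtr_ip_feasible I d \<longleftrightarrow> admissible I (\<lambda>i j. start I i j + d i j) \<and>
     (\<Sum>i = 1..rows I. \<Sum>j = 1..cols I. tr_weight I i j * of_int \<bar>d i j\<bar>) \<le> of_nat (radius I)"

definition wtr_ip_optimal :: "wtr_ip \<Rightarrow> (nat \<Rightarrow> nat \<Rightarrow> int) \<Rightarrow> bool" where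
  "wtr_ip_optimal I d \<longleftrightarrow> wtr_ip_feasible I d \<and>
     (\<forall>d'. wtr_ip_feasible I d' \<longrightarrow> wtr_ip_objective I d \<le> wtr_ip_objective I d')"


section \<open>Encodings and magnitudes\<close>

text \<open>Matrices are listed row by row, a rational as numerator and (positive) denominator.\<close>

definition entries :: "nat list \<Rightarrow> nat list \<Rightarrow> (nat \<Rightarrow> nat \<Rightarrow> 'a) \<Rightarrow> 'a list" where
  "entries is js A = concat (map (\<lambda>i. map (A i) js) is)"

definition rat_codes :: "rat list \<Rightarrow> int list" where
  "rat_codes qs = concat (map (\<lambda>q. [fst (quotient_of q), snd (quotient_of q)]) qs)"

definition grid_encode :: "'a grid_data_scheme \<Rightarrow> int list" where
  "grid_encode I = [int (rows I), int (cols I), lower I, upper I, int (radius I)] @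
     entries [1..<rows I + 1] [1..<cols I + 1] (start I) @
     rat_codes (entries [1..<rows I + 1] [1..<cols I + 1] (cost I))"

text \<open>Multiplication with the least common denominator of the list.\<close>

definition scale_to_int :: "rat list \<Rightarrow> int list" where
  "scale_to_int qs = map (\<lambda>q. \<lfloor>of_int (Lcm (set (map (snd \<circ> quotient_of) qs))) * q\<rfloor>) qs"

definition max_abs :: "int list \<Rightarrow> nat" where
  "max_abs zs = Max (insert 0 (set (map (\<lambda>z. nat \<bar>z\<bar>) zs)))"

text \<open>
  The objective coefficients are scaled by a common factor, and so are the coefficients and the
  right-hand side of the trust-region constraint.  The remaining data are integers already.
\<close>

definition TR_IP :: "tr_ip optimisation_problem" where
  "TR_IP = \<lparr>
     instances = {I. tr_ip_instance I},
     encode = (\<lambda>I. grid_encode I @ rat_codes [alpha I]),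
     magnitude = (\<lambda>I. max_abs (
       [lower I, upper I, int (radius I)] @
       entries [1..<rows I + 1] [1..<cols I + 1] (start I) @
       scale_to_int (alpha I # entries [1..<rows I + 1] [1..<cols I + 1] (cost I)))),
     solutions = (\<lambda>I. {entries [1..<rows I + 1] [1..<cols I + 1] d | d. tr_ip_optimal I d})\<rparr>"

definition wTR_IP_2D :: "wtr_ip optimisation_problem" where
  "wTR_IP_2D = \<lparr>
     instances = {I. wtr_ip_instance I},
     encode = (\<lambda>I. grid_encode I @
       rat_codes (entries [1..<rows I] [1..<cols I + 1] (vweight I)) @
       rat_codes (entries [1..<rows I + 1] [1..<cols I] (hweight I)) @
       rat_codes (entries [1..<rows I + 1] [1..<cols I + 1] (tr_weight I))),
     magnitude = (\<lambda>I. max_abs (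
       [lower I, upper I] @
       entries [1..<rows I + 1] [1..<cols I + 1] (start I) @
       scale_to_int (entries [1..<rows I + 1] [1..<cols I + 1] (cost I) @
         entries [1..<rows I] [1..<cols I + 1] (vweight I) @
         entries [1..<rows I + 1] [1..<cols I] (hweight I)) @
       scale_to_int (of_nat (radius I) # entries [1..<rows I + 1] [1..<cols I + 1] (tr_weight I)))),
     solutions = (\<lambda>I. {entries [1..<rows I + 1] [1..<cols I + 1] d | d. wtr_ip_optimal I d})\<rparr>"

end

theory Submission
  imports Defs
begin

text \<open>Minimum bisection reduces to the trust-region problem with \<open>\<Xi> = {0, 1}\<close> and zero start. There
\<open>d\<close> is the indicator of a set of grid cells, the trust region bounds the size of this set, and the jump
terms count its boundary. A graph is drawn on the grid as follows: every vertex becomes a solid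
square block of cells, and every edge becomes a single bridge cell between two neighbouring blocks. All
other cells are holes.

Since all jumps have the same weight \<open>\<alpha>\<close>, jumps at holes have to be removed from the objective. If \<open>t\<close>
is the indicator of the drawing \<open>T\<close>, then \<open>\<bar>y q - y p\<bar>\<close> is at least the jump inside of \<open>T\<close> plus
\<open>(t q - t p) (y q - y p)\<close>, with equality if \<open>y\<close> vanishes on the holes. Summation by parts turns the last
term into a linear function of \<open>y\<close>, the discrete Laplacian of \<open>t\<close>, and the costs \<open>c\<close> cancel it
(\<open>energy_ge\<close>, \<open>energy_eq\<close>). What remains is \<open>\<alpha>\<close> times the number of jumps inside of the drawing,
minus a reward of 1 for every selected cell of the drawing.

With \<open>e\<close> edges, \<open>\<alpha> = e + 1\<close> and blocks of side \<open>L = 2 (e + 1)\<close>, the trust region leaves room for half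
of the blocks and all bridges. A bisection with cut \<open>k\<close> selects whole blocks and makes \<open>k\<close> jumps.
Conversely, a cheap selection has fewer than \<open>L\<close> jumps in a block, hence every block has a constant row
and a constant column and is almost constant; replacing its values by the majority value changes the
number of cells too little to affect the number of selected blocks, and it increases the cut by no more
than the number of jumps that it removes (\<open>rounding\<close>). So the solution of one instance decides whether
there is a bisection with at most \<open>k\<close> cut edges (\<open>optimum_decides\<close>).

The coordinates of the graph are written in binary, so the grid that contains it may be exponentially
large. Replacing every coordinate by its rank among the occurring ones keeps neighbours adjacent, and
afterwards all numbers of the instance are polynomial in the length of the code of the graph. This is
why pseudo-polynomial algorithms are excluded, too.

The weighted problem contains the unweighted one, so the same program serves both: only the list of
weights at the end of the code differs. The decision procedure runs the given reduction to the
bisection problem, draws the graph, runs the given solver and evaluates the solution; each of the four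
parts works on its own registers and arrays (\<open>exec_rename\<close>). Hence a solver puts NP into P
(\<open>NP_subset_P_if_solvable\<close>), and together with \<open>P_subset_NP\<close> this contradicts the assumption.\<close>

section \<open>Renaming of registers and arrays; weakest preconditions\<close>

fun rename :: "(nat \<Rightarrow> nat) \<Rightarrow> (nat \<Rightarrow> nat) \<Rightarrow> cmd \<Rightarrow> cmd" where
  "rename f g (Const r c) = Const (f r) c"
| "rename f g (Add r p q) = Add (f r) (f p) (f q)"
| "rename f g (Sub r p q) = Sub (f r) (f p) (f q)"
| "rename f g (Len r a) = Len (f r) (g a)"
| "rename f g (Get r a p) = Get (f r) (g a) (f p)"
| "rename f g (Put a r p) = Put (g a) (f r) (f p)"
| "rename f g (Push a r) = Push (g a) (f r)"
| "rename f g (Seq M M') = Seq (rename f g M) (rename f g M')"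
| "rename f g (Cond r M M') = Cond (f r) (rename f g M) (rename f g M')"
| "rename f g (While r M) = While (f r) (rename f g M)"

inductive_cases exec_ConstE: "exec (Const r c) s t s'"
inductive_cases exec_AddE: "exec (Add r p q) s t s'"
inductive_cases exec_SubE: "exec (Sub r p q) s t s'"
inductive_cases exec_LenE: "exec (Len r a) s t s'"
inductive_cases exec_GetE: "exec (Get r a p) s t s'"
inductive_cases exec_PutE: "exec (Put a r p) s t s'"
inductive_cases exec_PushE: "exec (Push a r) s t s'"
inductive_cases exec_SeqE: "exec (Seq M M') s t s'"
inductive_cases exec_CondE: "exec (Cond r M M') s t s'"

definition fetch :: "int list \<Rightarrow> int \<Rightarrow> int" where
  "fetch xs i = (if 0 \<le> i then nth_default 0 xs (nat i) else 0)"

definition store :: "int list \<Rightarrow> int \<Rightarrow> int \<Rightarrow> int list" where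
  "store xs i z = (if 0 \<le> i then xs[nat i := z] else xs)"

lemma exec_basic:
  "exec (Const r c) (R, A) t s \<longleftrightarrow> t = 1 \<and> s = (R(r := c), A)"
  "exec (Add r p q) (R, A) t s \<longleftrightarrow> t = 1 \<and> s = (R(r := R p + R q), A)"
  "exec (Sub r p q) (R, A) t s \<longleftrightarrow> t = 1 \<and> s = (R(r := R p - R q), A)"
  "exec (Len r a) (R, A) t s \<longleftrightarrow> t = 1 \<and> s = (R(r := int (length (A a))), A)"
  "exec (Get r a p) (R, A) t s \<longleftrightarrow> t = 1 \<and> s = (R(r := fetch (A a) (R p)), A)"
  "exec (Put a r p) (R, A) t s \<longleftrightarrow> t = 1 \<and> s = (R, A(a := store (A a) (R p) (R r)))"
  "exec (Push a r) (R, A) t s \<longleftrightarrow> t = 1 \<and> s = (R, A(a := A a @ [R r]))"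
  unfolding fetch_def store_def
  by (rule iffI, (erule exec_ConstE exec_AddE exec_SubE exec_LenE exec_GetE exec_PutE exec_PushE, simp),
      elim conjE, hypsubst, rule exec.intros)+

text \<open>Programs cannot clear arrays. To run two programs one after the other, the second one gets fresh
registers and arrays by an injective renaming; everything outside of the range of the renaming survives.\<close>

lemma exec_rename:
  assumes "exec M s t s'" "inj f" "inj g" "s = (R \<circ> f, A \<circ> g)"
  shows "\<exists>R' A'. exec (rename f g M) (R, A) t (R', A') \<and> s' = (R' \<circ> f, A' \<circ> g) \<and>
    (\<forall>r. r \<notin> range f \<longrightarrow> R' r = R r) \<and> (\<forall>a. a \<notin> range g \<longrightarrow> A' a = A a)"
proof -
  note inj = inj_eq[OF \<open>inj f\<close>] inj_eq[OF \<open>inj g\<close>]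
  let ?sim = "\<lambda>R A R1 A1 (s' :: state). s' = (R1 \<circ> f, A1 \<circ> g) \<and>
    (\<forall>r. r \<notin> range f \<longrightarrow> R1 r = R r) \<and> (\<forall>a. a \<notin> range g \<longrightarrow> A1 a = A a)"
  have step: "\<exists>R' A'. exec (rename f g M) (R, A) t (R', A') \<and> ?sim R A R' A' s'"
    if "exec (rename f g M) (R, A) t (R1, A1)" "?sim R A R1 A1 s'" for M s' t R1 A1 R A
    using that by blast
  show ?thesis
    using assms(1,4)
  proof (induction arbitrary: R A rule: exec.induct)
    case (Const r c R0 A0)
    then show ?case
      by (intro step[where ?R1.0 = "R(f r := c)" and ?A1.0 = A])
        (auto simp: fun_eq_iff inj exec_basic fetch_def store_def)
  next
    case (Add r p q R0 A0)
    then show ?case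
      by (intro step[where ?R1.0 = "R(f r := R (f p) + R (f q))" and ?A1.0 = A])
        (auto simp: fun_eq_iff inj exec_basic fetch_def store_def)
  next
    case (Sub r p q R0 A0)
    then show ?case
      by (intro step[where ?R1.0 = "R(f r := R (f p) - R (f q))" and ?A1.0 = A])
        (auto simp: fun_eq_iff inj exec_basic fetch_def store_def)
  next
    case (Len r a R0 A0)
    then show ?case
      by (intro step[where ?R1.0 = "R(f r := int (length (A (g a))))" and ?A1.0 = A])
        (auto simp: fun_eq_iff inj exec_basic fetch_def store_def)
  next
    case (Get r a p R0 A0)
    then show ?case
      by (intro step[where ?R1.0 = "R(f r :=
            (if 0 \<le> R (f p) then nth_default 0 (A (g a)) (nat (R (f p))) else 0))" and ?A1.0 = A])
        (auto simp: fun_eq_iff inj exec_basic fetch_def store_def)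
  next
    case (Put a r p R0 A0)
    then show ?case
      by (intro step[where ?R1.0 = R and ?A1.0 = "A(g a :=
            (if 0 \<le> R (f p) then (A (g a))[nat (R (f p)) := R (f r)] else A (g a)))"])
        (auto simp: fun_eq_iff inj exec_basic fetch_def store_def)
  next
    case (Push a r R0 A0)
    then show ?case
      by (intro step[where ?R1.0 = R and ?A1.0 = "A(g a := A (g a) @ [R (f r)])"])
        (auto simp: fun_eq_iff inj exec_basic fetch_def store_def)
  next
    case (Seq M1 s t s' M2 t' s'')
    obtain R1 A1 where 1: "exec (rename f g M1) (R, A) t (R1, A1)" "?sim R A R1 A1 s'"
      using Seq.IH(1)[OF Seq.prems] by blast
    obtain R2 A2 where 2: "exec (rename f g M2) (R1, A1) t' (R2, A2)" "?sim R1 A1 R2 A2 s''"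
      using Seq.IH(2)[OF conjunct1[OF 1(2)]] by blast
    show ?case
      using 1 2 by (intro step[where ?R1.0 = R2 and ?A1.0 = A2]) (auto intro: exec.intros)
  next
    case (CondTrue R0 r M1 A0 t s M2)
    obtain R1 A1 where 1: "exec (rename f g M1) (R, A) t (R1, A1)" "?sim R A R1 A1 s"
      using CondTrue.IH[OF CondTrue.prems] by blast
    show ?case
      using 1 CondTrue.hyps CondTrue.prems by (intro step[where ?R1.0 = R1 and ?A1.0 = A1]) (auto intro: exec.intros)
  next
    case (CondFalse R0 r M2 A0 t s M1)
    obtain R1 A1 where 1: "exec (rename f g M2) (R, A) t (R1, A1)" "?sim R A R1 A1 s"
      using CondFalse.IH[OF CondFalse.prems] by blast
    show ?case
      using 1 CondFalse.hyps CondFalse.prems by (intro step[where ?R1.0 = R1 and ?A1.0 = A1]) (auto intro: exec.intros)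
  next
    case (WhileTrue R0 r M1 A0 t s t' s')
    obtain R1 A1 where 1: "exec (rename f g M1) (R, A) t (R1, A1)" "?sim R A R1 A1 s"
      using WhileTrue.IH(1)[OF WhileTrue.prems] by blast
    obtain R2 A2 where 2: "exec (rename f g (While r M1)) (R1, A1) t' (R2, A2)"
      "?sim R1 A1 R2 A2 s'"
      using WhileTrue.IH(2)[OF conjunct1[OF 1(2)]] by blast
    show ?case
      using 1 2 WhileTrue.hyps WhileTrue.prems
      by (intro step[where ?R1.0 = R2 and ?A1.0 = A2]) (auto intro: exec.intros)
  next
    case (WhileFalse R0 r M1 A0)
    then show ?case
      by (intro step[where ?R1.0 = R and ?A1.0 = A]) (auto intro: exec.WhileFalse[unfolded One_nat_def])
  qed
qed

text \<open>An array grows by at most one entry per step. Thus the output of a polynomial-time reduction is polynomially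
long, and so are the numbers of nodes and edges that it describes; the size of the numbers in it does not
matter because all later steps have unit cost.\<close>

lemma exec_length:
  assumes "exec M s t s'"
  shows "length (snd s' a) \<le> length (snd s a) + t"
  using assms by (induction rule: exec.induct) auto

text \<open>The postcondition also speaks about the running time. The equations below execute straight-line code
symbolically; loops need an invariant.\<close>

definition wp :: "cmd \<Rightarrow> (nat \<Rightarrow> state \<Rightarrow> bool) \<Rightarrow> state \<Rightarrow> bool" where
  "wp M Q s \<longleftrightarrow> (\<exists>t s'. exec M s t s' \<and> Q t s')"

lemma wp_basic [simp]:
  "wp (Const r c) Q (R, A) \<longleftrightarrow> Q 1 (R(r := c), A)"
  "wp (Add r p q) Q (R, A) \<longleftrightarrow> Q 1 (R(r := R p + R q), A)"
  "wp (Sub r p q) Q (R, A) \<longleftrightarrow> Q 1 (R(r := R p - R q), A)"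
  "wp (Len r a) Q (R, A) \<longleftrightarrow> Q 1 (R(r := int (length (A a))), A)"
  "wp (Get r a p) Q (R, A) \<longleftrightarrow> Q 1 (R(r := fetch (A a) (R p)), A)"
  "wp (Put a r p) Q (R, A) \<longleftrightarrow> Q 1 (R, A(a := store (A a) (R p) (R r)))"
  "wp (Push a r) Q (R, A) \<longleftrightarrow> Q 1 (R, A(a := A a @ [R r]))"
  unfolding wp_def exec_basic by auto

lemma wp_Seq [simp]: "wp (Seq M M') Q s \<longleftrightarrow> wp M (\<lambda>t. wp M' (\<lambda>t'. Q (t + t'))) s"
  unfolding wp_def by (blast elim: exec_SeqE intro: exec.Seq)

lemma wp_Cond [simp]:
  "wp (Cond r M M') Q (R, A) \<longleftrightarrow> wp (if R r > 0 then M else M') (\<lambda>t. Q (Suc t)) (R, A)"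
proof
  assume "wp (Cond r M M') Q (R, A)"
  then show "wp (if R r > 0 then M else M') (\<lambda>t. Q (Suc t)) (R, A)"
    unfolding wp_def by (force elim!: exec_CondE)
next
  assume "wp (if R r > 0 then M else M') (\<lambda>t. Q (Suc t)) (R, A)"
  then show "wp (Cond r M M') Q (R, A)"
    unfolding wp_def using exec.CondTrue[of R r M A] exec.CondFalse[of R r M' A]
    by (cases "R r > 0") (simp, blast, simp, blast)
qed

lemma wp_mono:
  assumes "wp M Q s" "\<And>t s'. Q t s' \<Longrightarrow> Q' t s'"
  shows "wp M Q' s"
  using assms unfolding wp_def by blast

lemma wp_While:
  assumes "I 0 s" "I' = I n"
    and step: "\<And>k R A. k < n \<Longrightarrow> I k (R, A) \<Longrightarrow> R r > 0 \<and> wp M (\<lambda>t s'. t \<le> T \<and> I (Suc k) s') (R, A)"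
    and final: "\<And>R A. I n (R, A) \<Longrightarrow> R r \<le> 0"
  shows "wp (While r M) (\<lambda>t s'. t \<le> n * (T + 1) + 1 \<and> I' s') s"
proof -
  have "wp (While r M) (\<lambda>t s'. t \<le> (n - k) * (T + 1) + 1 \<and> I n s') s" if "I k s" "k \<le> n" for k s
    using that(2,1)
  proof (induction k arbitrary: s rule: inc_induct)
    case base
    then show ?case
      using final[of "fst s" "snd s"] exec.WhileFalse[of "fst s" r M "snd s"]
      unfolding wp_def by (intro exI[of _ 1] exI[of _ s]) auto
  next
    case (step k)
    obtain t s' where s': "fst s r > 0" "exec M (fst s, snd s) t s'" "t \<le> T" "I (Suc k) s'"
      using assms(3)[of k "fst s" "snd s"] step by (auto simp: wp_def)
    obtain t' s'' where s'': "exec (While r M) s' t' s''" "t' \<le> (n - Suc k) * (T + 1) + 1" "I n s''"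
      using step.IH[OF s'(4)] by (auto simp: wp_def)
    have "Suc (t + t') \<le> (n - k) * (T + 1) + 1"
      using s'(3) s''(2) step(2) by (simp add: Suc_diff_Suc[symmetric] del: Suc_diff_Suc)
    then show ?case
      unfolding wp_def using WhileTrue[OF s'(1,2) s''(1)] s''(3) by (metis prod.collapse)
  qed
  from this[of 0 s] show ?thesis using assms(1,2) by simp
qed

section \<open>Total variation with compensated holes\<close>

type_synonym cell = "nat \<times> nat"

type_synonym picture = "nat \<Rightarrow> nat \<Rightarrow> int"

abbreviation interior :: "nat \<Rightarrow> cell set" where
  "interior N \<equiv> {1..<N - 1} \<times> {1..<N - 1}"

text \<open>Cells are pairs of a row and a column, counted from 0. Only vertical jumps are defined; the horizontal
ones are the vertical ones of the transposed picture.\<close>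

definition jump :: "cell set \<Rightarrow> picture \<Rightarrow> nat \<Rightarrow> nat \<Rightarrow> int" where
  "jump T y x z = (if (x, z) \<in> T \<and> (Suc x, z) \<in> T then \<bar>y (Suc x) z - y x z\<bar> else 0)"

definition vjumps :: "nat \<Rightarrow> cell set \<Rightarrow> picture \<Rightarrow> int" where
  "vjumps N T y = (\<Sum>x<N. \<Sum>z<N. jump T y x z)"

definition flip :: "(nat \<Rightarrow> nat \<Rightarrow> 'a) \<Rightarrow> nat \<Rightarrow> nat \<Rightarrow> 'a" where
  "flip y x z = y z x"

definition jumps :: "nat \<Rightarrow> cell set \<Rightarrow> picture \<Rightarrow> int" where
  "jumps N T y = vjumps N T y + vjumps N (T\<inverse>) (flip y)"

definition mass :: "nat \<Rightarrow> cell set \<Rightarrow> picture \<Rightarrow> int" where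
  "mass N T y = (\<Sum>x<N. \<Sum>z<N. if (x, z) \<in> T then y x z else 0)"

definition binary :: "nat \<Rightarrow> picture \<Rightarrow> bool" where
  "binary N y \<longleftrightarrow> (\<forall>x<N. \<forall>z<N. y x z \<in> {0, 1})"

text \<open>The cost of a cell: \<open>a\<close> times the Laplacian of the indicator of \<open>T\<close>, and a reward of 1 on \<open>T\<close>. The
subtraction \<open>x - 1\<close> is harmless at \<open>x = 0\<close> since the drawings never touch the border.\<close>

definition field :: "int \<Rightarrow> cell set \<Rightarrow> nat \<Rightarrow> nat \<Rightarrow> int" where
  "field a T x z = a * (of_bool ((Suc x, z) \<in> T) + of_bool ((x - 1, z) \<in> T) + of_bool ((x, Suc z) \<in> T)
     + of_bool ((x, z - 1) \<in> T) - 4 * of_bool ((x, z) \<in> T)) - of_bool ((x, z) \<in> T)"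

definition energy :: "nat \<Rightarrow> int \<Rightarrow> cell set \<Rightarrow> picture \<Rightarrow> int" where
  "energy N a T y = (\<Sum>x<N. \<Sum>z<N. field a T x z * y x z)
     + a * (\<Sum>z<N. \<Sum>x<N - 1. \<bar>y (Suc x) z - y x z\<bar>)
     + a * (\<Sum>x<N. \<Sum>z<N - 1. \<bar>y x (Suc z) - y x z\<bar>)"

lemma discrete_Green:
  fixes t y :: "nat \<Rightarrow> int"
  assumes "t 0 = 0" "t K = 0" "t (Suc K) = 0"
  shows "(\<Sum>x<K. (t (Suc x) - t x) * (y (Suc x) - y x)) =
    - (\<Sum>x<Suc K. (t (Suc x) + t (x - 1) - 2 * t x) * y x)"
proof -
  have 1: "(\<Sum>x<K. (t (Suc x) - t x) * y (Suc x)) = (\<Sum>x<Suc K. (t x - t (x - 1)) * y x)"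
    by (subst sum.lessThan_Suc_shift) simp
  have 2: "(\<Sum>x<K. (t (Suc x) - t x) * y x) = (\<Sum>x<Suc K. (t (Suc x) - t x) * y x)"
    using assms by simp
  have "(\<Sum>x<K. (t (Suc x) - t x) * (y (Suc x) - y x)) =
    (\<Sum>x<Suc K. (t x - t (x - 1)) * y x) - (\<Sum>x<Suc K. (t (Suc x) - t x) * y x)"
    unfolding 1[symmetric] 2[symmetric] by (simp add: right_diff_distrib sum_subtractf)
  also have "\<dots> = - (\<Sum>x<Suc K. (t (Suc x) + t (x - 1) - 2 * t x) * y x)"
    unfolding sum_subtractf[symmetric] sum_negf[symmetric]
    by (intro sum.cong) (auto simp: algebra_simps)
  finally show ?thesis .
qed

lemma vjumps_alt:
  assumes T: "T \<subseteq> interior N" and "N > 0"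
  shows "vjumps N T y = (\<Sum>z<N. \<Sum>x<N - 1. jump T y x z)"
proof -
  obtain K where K: "N = Suc K" using \<open>N > 0\<close> by (cases N) auto
  have "jump T y K z = 0" for z
    using T K by (auto simp: jump_def)
  then show ?thesis
    unfolding vjumps_def K by (subst sum.swap) (simp add: sum.lessThan_Suc del: One_nat_def)
qed

text \<open>The difference of the two sides of the inequality \<open>\<bar>y q - y p\<bar> \<ge> jump + (t q - t p) (y q - y p)\<close> for vertical
neighbours \<open>p\<close>, \<open>q\<close>. It is never negative for 0-1-valued \<open>y\<close>, and it vanishes if \<open>y\<close> does so on the holes.\<close>

abbreviation defect :: "cell set \<Rightarrow> picture \<Rightarrow> nat \<Rightarrow> nat \<Rightarrow> int" where
  "defect T y x z \<equiv> \<bar>y (Suc x) z - y x z\<bar> - jump T y x z -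
     (of_bool ((Suc x, z) \<in> T) - of_bool ((x, z) \<in> T)) * (y (Suc x) z - y x z)"

lemma energy_mass_jumps:
  fixes y :: picture
  assumes T: "T \<subseteq> interior N" and "N > 0"
  shows "energy N a T y = a * jumps N T y - mass N T y +
    a * ((\<Sum>z<N. \<Sum>x<N - 1. defect T y x z) + (\<Sum>z<N. \<Sum>x<N - 1. defect (T\<inverse>) (flip y) x z))"
proof -
  obtain K where K: "N = Suc K" using \<open>N > 0\<close> by (cases N) auto
  have green: "(\<Sum>z<N. \<Sum>x<N - 1. (of_bool ((Suc x, z) \<in> T) - of_bool ((x, z) \<in> T)) * (y (Suc x) z - y x z))
    = - (\<Sum>x<N. \<Sum>z<N. (of_bool ((Suc x, z) \<in> T) + of_bool ((x - 1, z) \<in> T) - 2 * of_bool ((x, z) \<in> T)) * y x z)"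
    if "T \<subseteq> interior N" for T and y :: picture
  proof -
    have "(\<Sum>x<N - 1. (of_bool ((Suc x, z) \<in> T) - of_bool ((x, z) \<in> T)) * (y (Suc x) z - y x z))
      = - (\<Sum>x<N. (of_bool ((Suc x, z) \<in> T) + of_bool ((x - 1, z) \<in> T) - 2 * of_bool ((x, z) \<in> T)) * y x z)" for z
      using discrete_Green[of "\<lambda>x. of_bool ((x, z) \<in> T)" K "\<lambda>x. y x z"] that unfolding K
      by (force simp del: One_nat_def sum.lessThan_Suc)
    then show ?thesis
      by (subst sum.swap[of _ "{..<N}" "{..<N}"]) (simp add: sum_negf)
  qed
  have T': "T\<inverse> \<subseteq> interior N"
    using T by auto
  have v: "(\<Sum>z<N. \<Sum>x<N - 1. \<bar>y (Suc x) z - y x z\<bar>) = vjumps N T y + (\<Sum>z<N. \<Sum>x<N - 1. defect T y x z)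
     - (\<Sum>x<N. \<Sum>z<N. (of_bool ((Suc x, z) \<in> T) + of_bool ((x - 1, z) \<in> T) - 2 * of_bool ((x, z) \<in> T)) * y x z)"
    if "T \<subseteq> interior N" for T and y :: picture
    using green[OF that, of y] vjumps_alt[OF that \<open>N > 0\<close>, of y]
    unfolding sum_subtractf by simp
  have h: "(\<Sum>x<N. \<Sum>z<N - 1. \<bar>y x (Suc z) - y x z\<bar>) =
      vjumps N (T\<inverse>) (flip y) + (\<Sum>z<N. \<Sum>x<N - 1. defect (T\<inverse>) (flip y) x z)
     - (\<Sum>x<N. \<Sum>z<N. (of_bool ((x, Suc z) \<in> T) + of_bool ((x, z - 1) \<in> T) - 2 * of_bool ((x, z) \<in> T)) * y x z)"
    using v[OF T', of "flip y"]
    by (subst (2) sum.swap) (simp add: flip_def)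
  have f: "(\<Sum>x<N. \<Sum>z<N. field a T x z * y x z) =
     a * (\<Sum>x<N. \<Sum>z<N. (of_bool ((Suc x, z) \<in> T) + of_bool ((x - 1, z) \<in> T) - 2 * of_bool ((x, z) \<in> T)) * y x z) +
     a * (\<Sum>x<N. \<Sum>z<N. (of_bool ((x, Suc z) \<in> T) + of_bool ((x, z - 1) \<in> T) - 2 * of_bool ((x, z) \<in> T)) * y x z)
     - mass N T y"
    unfolding mass_def sum_distrib_left sum.distrib[symmetric] sum_subtractf[symmetric]
    by (intro sum.cong refl) (auto simp: field_def algebra_simps)
  show ?thesis
    unfolding energy_def f v[OF T] h jumps_def by (simp add: algebra_simps)
qed

lemma energy_ge:
  assumes T: "T \<subseteq> interior N" and "N > 0" "a \<ge> 0" "binary N y"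
  shows "a * jumps N T y - mass N T y \<le> energy N a T y"
proof -
  have "0 \<le> defect T y x z"
    if "binary N y" "x < N - 1" "z < N" for x z T and y :: picture
  proof -
    have "y x z \<in> {0,1}" "y (Suc x) z \<in> {0,1}" using that by (auto simp: binary_def)
    then show ?thesis by (auto simp: jump_def)
  qed
  then have nonneg: "0 \<le> (\<Sum>z<N. \<Sum>x<N - 1. defect T y x z)"
    if "binary N y" for T and y :: picture
    using that by (intro sum_nonneg) (simp del: One_nat_def)
  have "binary N (flip y)" using assms by (auto simp: binary_def flip_def)
  from add_nonneg_nonneg[OF nonneg[OF \<open>binary N y\<close>, of T] nonneg[OF this, of "T\<inverse>"]]
  show ?thesis
    unfolding energy_mass_jumps[OF assms(1,2)] using \<open>a \<ge> 0\<close>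
    by (simp del: One_nat_def converse_iff)
qed

lemma energy_eq:
  assumes T: "T \<subseteq> interior N" and "N > 0" "binary N y"
    and supp: "\<And>x z. x < N \<Longrightarrow> z < N \<Longrightarrow> (x, z) \<notin> T \<Longrightarrow> y x z = 0"
  shows "energy N a T y = a * jumps N T y - mass N T y"
proof -
  have "defect T y x z = 0"
    if "binary N y" "\<And>x z. x < N \<Longrightarrow> z < N \<Longrightarrow> (x, z) \<notin> T \<Longrightarrow> y x z = 0"
      "x < N - 1" "z < N" for x z T and y :: picture
  proof -
    have "y x z \<in> {0,1}" "y (Suc x) z \<in> {0,1}" "(x, z) \<notin> T \<Longrightarrow> y x z = 0"
      "(Suc x, z) \<notin> T \<Longrightarrow> y (Suc x) z = 0"
      using that by (auto simp: binary_def)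
    then show ?thesis by (auto simp: jump_def)
  qed
  then have zero: "(\<Sum>z<N. \<Sum>x<N - 1. defect T y x z) = 0"
    if "binary N y" "\<And>x z. x < N \<Longrightarrow> z < N \<Longrightarrow> (x, z) \<notin> T \<Longrightarrow> y x z = 0"
    for T and y :: picture
    using that by (intro sum.neutral ballI) (simp del: One_nat_def)
  have "binary N (flip y)" "\<And>x z. x < N \<Longrightarrow> z < N \<Longrightarrow> (x, z) \<notin> T\<inverse> \<Longrightarrow> flip y x z = 0"
    using assms by (auto simp: binary_def flip_def)
  from zero[OF this] zero[OF assms(3) supp] show ?thesis
    unfolding energy_mass_jumps[OF assms(1,2)] by (simp del: One_nat_def converse_iff)
qed

section \<open>Blocks and bridges\<close>

text \<open>Keeps row and column indices in the form \<open>i * Suc L + p\<close>.\<close>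

declare mult_Suc [simp del] mult_Suc_right [simp del]

text \<open>The grid is divided into squares of side \<open>L + 1\<close>. A block fills its square except for the first row and the
first column, which are left for the bridges to the preceding blocks. The edge \<open>(i, j)\<close> in \<open>EV\<close> joins
\<open>(i, j)\<close> and \<open>(i + 1, j)\<close>, and \<open>(i, j)\<close> in \<open>EH\<close> joins \<open>(i, j)\<close> and \<open>(i, j + 1)\<close>.\<close>

definition block :: "nat \<Rightarrow> cell \<Rightarrow> cell set" where
  "block L = (\<lambda>(i, j). {i * Suc L + 1..i * Suc L + L} \<times> {j * Suc L + 1..j * Suc L + L})"

definition vbridge :: "nat \<Rightarrow> cell \<Rightarrow> cell" where
  "vbridge L = (\<lambda>(i, j). (Suc i * Suc L, j * Suc L + 1))"

definition hbridge :: "nat \<Rightarrow> cell \<Rightarrow> cell" where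
  "hbridge L = (\<lambda>(i, j). (i * Suc L + 1, Suc j * Suc L))"

definition gadget :: "nat \<Rightarrow> cell set \<Rightarrow> cell set \<Rightarrow> cell set \<Rightarrow> cell set" where
  "gadget L V EV EH = (\<Union>v\<in>V. block L v) \<union> vbridge L ` EV \<union> hbridge L ` EH"

definition grid_graph :: "nat \<Rightarrow> cell set \<Rightarrow> cell set \<Rightarrow> cell set \<Rightarrow> bool" where
  "grid_graph n V EV EH \<longleftrightarrow> V \<subseteq> {..<n} \<times> {..<n} \<and>
     (\<forall>(i, j) \<in> EV. (i, j) \<in> V \<and> (Suc i, j) \<in> V) \<and> (\<forall>(i, j) \<in> EH. (i, j) \<in> V \<and> (i, Suc j) \<in> V)"

definition vcut :: "cell set \<Rightarrow> cell set \<Rightarrow> nat" where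
  "vcut EV S = card {(i, j) \<in> EV. ((i, j) \<in> S) \<noteq> ((Suc i, j) \<in> S)}"

definition cut :: "cell set \<Rightarrow> cell set \<Rightarrow> cell set \<Rightarrow> nat" where
  "cut EV EH S = vcut EV S + vcut (EH\<inverse>) (S\<inverse>)"

lemma grid_graph_converse: "grid_graph n V EV EH \<Longrightarrow> grid_graph n (V\<inverse>) (EH\<inverse>) (EV\<inverse>)"
  by (fastforce simp: grid_graph_def)

lemma grid_graph_finite:
  assumes "grid_graph n V EV EH"
  shows "finite V" "finite EV" "finite EH"
proof -
  have "V \<subseteq> {..<n} \<times> {..<n}" "EV \<subseteq> V" "EH \<subseteq> V"
    using assms by (auto simp: grid_graph_def)
  then show "finite V" "finite EV" "finite EH"
    by (meson finite_SigmaI finite_lessThan finite_subset)+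
qed

lemma gadget_converse: "(gadget L V EV EH)\<inverse> = gadget L (V\<inverse>) (EH\<inverse>) (EV\<inverse>)"
  by (auto simp: gadget_def block_def vbridge_def hbridge_def image_iff split: prod.splits; force)

lemma mem_block:
  assumes "p \<le> L" "q \<le> L"
  shows "(i * Suc L + p, j * Suc L + q) \<in> block L (i', j') \<longleftrightarrow> i = i' \<and> j = j' \<and> 1 \<le> p \<and> 1 \<le> q"
proof -
  have *: "a * Suc L + p \<in> {b * Suc L + 1..b * Suc L + L} \<longleftrightarrow> a = b \<and> 1 \<le> p" if "p \<le> L" for a b p
  proof
    assume *: "a * Suc L + p \<in> {b * Suc L + 1..b * Suc L + L}"
    then obtain r where r: "a * Suc L + p = b * Suc L + r" "1 \<le> r" "r \<le> L"
      by (metis atLeastAtMost_iff add_le_cancel_left le_iff_add le_add1 le_trans)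
    have "a = (a * Suc L + p) div Suc L" using that by simp
    also have "\<dots> = b" unfolding r(1) using r(3) by simp
    finally show "a = b \<and> 1 \<le> p" using r by simp
  qed (use that in auto)
  show ?thesis
    using *[OF assms(1), of i i'] *[OF assms(2), of j j'] by (auto simp: block_def)
qed

lemma index_eq_iff:
  assumes "p \<le> L" "q \<le> L"
  shows "i * Suc L + p = j * Suc L + q \<longleftrightarrow> i = j \<and> p = q"
proof
  assume *: "i * Suc L + p = j * Suc L + q"
  have "i = (i * Suc L + p) div Suc L" using assms by simp
  also have "\<dots> = j" unfolding * using assms by simp
  finally show "i = j \<and> p = q" using * by simp
qed simp

text \<open>Membership by quotients \<open>i\<close>, \<open>j\<close> and remainders \<open>p\<close>, \<open>q\<close> modulo \<open>L + 1\<close>. In particular, two bridges are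
never adjacent, and a bridge touches only the two blocks that it joins.\<close>

lemma mem_gadget:
  assumes "p \<le> L" "q \<le> L" "L \<ge> 1"
  shows "(i * Suc L + p, j * Suc L + q) \<in> gadget L V EV EH \<longleftrightarrow>
    (1 \<le> p \<and> 1 \<le> q \<and> (i, j) \<in> V) \<or> (p = 0 \<and> q = 1 \<and> i \<noteq> 0 \<and> (i - 1, j) \<in> EV) \<or>
    (p = 1 \<and> q = 0 \<and> j \<noteq> 0 \<and> (i, j - 1) \<in> EH)"
proof -
  have 1: "(i * Suc L + p, j * Suc L + q) \<in> (\<Union>v\<in>V. block L v) \<longleftrightarrow> 1 \<le> p \<and> 1 \<le> q \<and> (i, j) \<in> V"
    using mem_block[OF assms(1,2)] unfolding Union_iff by (force simp: Bex_def)
  have "(i * Suc L + p, j * Suc L + q) = vbridge L (i', j') \<longleftrightarrow> i = Suc i' \<and> p = 0 \<and> j = j' \<and> q = 1" for i' j'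
    using index_eq_iff[of p L 0 i "Suc i'"] index_eq_iff[of q L 1 j "j'"] assms
    by (simp add: vbridge_def)
  then have 2: "(i * Suc L + p, j * Suc L + q) \<in> vbridge L ` EV \<longleftrightarrow> p = 0 \<and> q = 1 \<and> i \<noteq> 0 \<and> (i - 1, j) \<in> EV"
    unfolding image_iff Bex_def split_paired_Ex by (cases i) auto
  have "(i * Suc L + p, j * Suc L + q) = hbridge L (i', j') \<longleftrightarrow> i = i' \<and> p = 1 \<and> j = Suc j' \<and> q = 0" for i' j'
    using index_eq_iff[of q L 0 j "Suc j'"] index_eq_iff[of p L 1 i "i'"] assms
    by (simp add: hbridge_def)
  then have 3: "(i * Suc L + p, j * Suc L + q) \<in> hbridge L ` EH \<longleftrightarrow> p = 1 \<and> q = 0 \<and> j \<noteq> 0 \<and> (i, j - 1) \<in> EH"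
    unfolding image_iff Bex_def split_paired_Ex by (cases j) auto
  show ?thesis
    unfolding gadget_def Un_iff 1 2 3 by blast
qed

lemma gadget_bounds:
  assumes "grid_graph n V EV EH" and L: "L \<ge> 1"
  shows "gadget L V EV EH \<subseteq> {1..<n * Suc L} \<times> {1..<n * Suc L}"
proof -
  have *: "i * Suc L + p < n * Suc L" if "i < n" "p \<le> L" for i p
  proof -
    have "i * Suc L + p < Suc i * Suc L" using that by (simp add: mult_Suc)
    also have "\<dots> \<le> n * Suc L" using that by (intro mult_right_mono) auto
    finally show ?thesis .
  qed
  show ?thesis
  proof (rule subsetI)
    fix c assume "c \<in> gadget L V EV EH"
    then consider v where "v \<in> V" "c \<in> block L v" | e where "e \<in> EV" "c = vbridge L e"
      | e where "e \<in> EH" "c = hbridge L e"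
      unfolding gadget_def by blast
    then show "c \<in> {1..<n * Suc L} \<times> {1..<n * Suc L}"
    proof cases
      case 1
      obtain i j where v: "v = (i, j)" by fastforce
      then have "i < n" "j < n" using 1 assms by (auto simp: grid_graph_def)
      then show ?thesis using *[of i L] *[of j L] 1 unfolding v block_def by auto
    next
      case 2
      obtain i j where e: "e = (i, j)" by fastforce
      then have "Suc i < n" "j < n" using 2 assms by (auto simp: grid_graph_def)
      then show ?thesis using *[of "Suc i" 0] *[of j 1] L 2 unfolding e vbridge_def by auto
    next
      case 3
      obtain i j where e: "e = (i, j)" by fastforce
      then have "i < n" "Suc j < n" using 3 assms by (auto simp: grid_graph_def)
      then show ?thesis using *[of "Suc j" 0] *[of i 1] L 3 unfolding e hbridge_def by auto
    qed
  qed
qed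

lemma sum_grid:
  fixes F :: picture
  shows "(\<Sum>x<n * k. \<Sum>z<n * k. F x z) = (\<Sum>i<n. \<Sum>j<n. \<Sum>p<k. \<Sum>q<k. F (i * k + p) (j * k + q))"
proof -
  have *: "(\<Sum>x<n * k. f x) = (\<Sum>i<n. \<Sum>p<k. f (i * k + p))" for f :: "nat \<Rightarrow> int"
  proof (induction n)
    case (Suc n)
    have "{..<Suc n * k} = {..<n * k} \<union> {n * k..<n * k + k}" by (auto simp: mult_Suc)
    then have "(\<Sum>x<Suc n * k. f x) = (\<Sum>x<n * k. f x) + (\<Sum>x=n * k..<n * k + k. f x)"
      by (simp add: sum.union_disjoint ivl_disj_int)
    moreover have "(\<Sum>x=n * k..<n * k + k. f x) = (\<Sum>p<k. f (n * k + p))"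
      using sum.shift_bounds_nat_ivl[of f 0 "n * k" k] by (simp add: add.commute lessThan_atLeast0)
    ultimately show ?case using Suc by simp
  qed simp
  show ?thesis
    unfolding * by (subst (2) sum.swap) simp
qed

text \<open>The columns of a block on which \<open>y\<close> is not constant. Applied to \<open>flip y\<close> it yields the mixed rows.\<close>

definition mixed :: "nat \<Rightarrow> picture \<Rightarrow> nat \<Rightarrow> nat \<Rightarrow> nat set" where
  "mixed L y i j = {q \<in> {1..L}. \<exists>p \<in> {1..L}. y (i * Suc L + p) (j * Suc L + q) \<noteq> y (i * Suc L + 1) (j * Suc L + q)}"

lemma variation_ge:
  fixes f :: "nat \<Rightarrow> int"
  assumes "p \<in> {1..L}"
  shows "\<bar>f p - f 1\<bar> \<le> (\<Sum>r = 1..<L. \<bar>f (Suc r) - f r\<bar>)"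
proof -
  have "\<bar>f p - f 1\<bar> \<le> (\<Sum>r = 1..<p. \<bar>f (Suc r) - f r\<bar>)"
    using sum_Suc_diff'[of 1 p f] sum_abs[of "\<lambda>r. f (Suc r) - f r" "{1..<p}"] assms
    by (simp del: sum_abs)
  also have "\<dots> \<le> (\<Sum>r = 1..<L. \<bar>f (Suc r) - f r\<bar>)"
    using assms by (intro sum_mono2) auto
  finally show ?thesis .
qed

lemma jump_nonneg [simp]: "jump T y x z \<ge> 0"
  by (simp add: jump_def)

text \<open>The difference of the two block cells that the vertical bridge \<open>(i, j)\<close> joins.\<close>

abbreviation bridge_gap :: "nat \<Rightarrow> picture \<Rightarrow> nat \<Rightarrow> nat \<Rightarrow> int" where
  "bridge_gap L y i j \<equiv> \<bar>y (i * Suc L + L) (j * Suc L + 1) - y (Suc i * Suc L + 1) (j * Suc L + 1)\<bar>"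

text \<open>Every mixed column of a block contains a jump, and the two jumps at a bridge add up to at least the difference
of the two cells that the bridge joins. All these jumps are at different places.\<close>

lemma vjumps_ge:
  assumes G: "grid_graph n V EV EH" and L: "L \<ge> 2"
  shows "(\<Sum>(i, j)\<in>V. int (card (mixed L y i j))) +
      (\<Sum>(i, j)\<in>EV. bridge_gap L y i j)
    \<le> vjumps (n * Suc L + 1) (gadget L V EV EH) y"
proof -
  let ?T = "gadget L V EV EH" and ?s = "Suc L"
  let ?J = "jump ?T y" and ?G = "{..<n} \<times> {..<n}"
  have fin: "finite V" "finite EV" using grid_graph_finite[OF G] by auto
  have V: "V \<subseteq> {..<n} \<times> {..<n}" and EV: "EV \<subseteq> V" "\<And>i j. (i, j) \<in> EV \<Longrightarrow> (Suc i, j) \<in> V"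
    using G by (auto simp: grid_graph_def)
  have inner: "(\<Sum>p<?s. \<Sum>q<?s. ?J (i * ?s + p) (j * ?s + q)) \<ge>
    of_bool ((i, j) \<in> V) * int (card (mixed L y i j)) + ?J (i * ?s) (j * ?s + 1) + ?J (i * ?s + L) (j * ?s + 1)" for i j
  proof -
    have A: "int (card (mixed L y i j)) \<le> (\<Sum>p=1..<L. \<Sum>q<?s. ?J (i * ?s + p) (j * ?s + q))" if "(i, j) \<in> V"
    proof -
      have "int (card (mixed L y i j)) = (\<Sum>q\<in>mixed L y i j. 1)" by simp
      also have "\<dots> \<le> (\<Sum>q\<in>mixed L y i j. \<Sum>p=1..<L. ?J (i * ?s + p) (j * ?s + q))"
      proof (rule sum_mono)
        fix q assume "q \<in> mixed L y i j"
        then obtain p where p: "p \<in> {1..L}" "q \<in> {1..L}"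
          "y (i * Suc L + p) (j * Suc L + q) \<noteq> y (i * Suc L + 1) (j * Suc L + q)" by (auto simp: mixed_def)
        have "1 \<le> \<bar>y (i * Suc L + p) (j * Suc L + q) - y (i * Suc L + 1) (j * Suc L + q)\<bar>"
          using p(3) by auto
        also have "\<dots> \<le> (\<Sum>r=1..<L. \<bar>y (i * Suc L + Suc r) (j * Suc L + q) - y (i * Suc L + r) (j * Suc L + q)\<bar>)"
          using variation_ge[OF p(1), of "\<lambda>p. y (i * Suc L + p) (j * Suc L + q)"] by simp
        also have "\<dots> = (\<Sum>r=1..<L. ?J (i * ?s + r) (j * ?s + q))"
        proof (rule sum.cong)
          fix r assume "r \<in> {1..<L}"
          then have "(i * ?s + r, j * ?s + q) \<in> ?T" "(i * ?s + Suc r, j * ?s + q) \<in> ?T"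
            using p(2) that by (subst mem_gadget; auto)+
          then show "\<bar>y (i * Suc L + Suc r) (j * Suc L + q) - y (i * Suc L + r) (j * Suc L + q)\<bar> = ?J (i * ?s + r) (j * ?s + q)"
            by (simp add: jump_def)
        qed simp
        finally show "1 \<le> (\<Sum>p=1..<L. ?J (i * ?s + p) (j * ?s + q))" .
      qed
      also have "\<dots> \<le> (\<Sum>q<?s. \<Sum>p=1..<L. ?J (i * ?s + p) (j * ?s + q))"
        by (intro sum_mono2 sum_nonneg) (auto simp: mixed_def)
      also have "\<dots> = (\<Sum>p=1..<L. \<Sum>q<?s. ?J (i * ?s + p) (j * ?s + q))" by (rule sum.swap)
      finally show ?thesis .
    qed
    have B: "?J x (j * ?s + 1) \<le> (\<Sum>q<?s. ?J x (j * ?s + q))" for x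
      using L by (intro member_le_sum[of 1 _ "\<lambda>q. ?J x (j * ?s + q)"]) auto
    have split: "{..<?s} = insert 0 (insert L {1..<L})" using L by auto
    have "(\<Sum>p<?s. \<Sum>q<?s. ?J (i * ?s + p) (j * ?s + q)) =
       (\<Sum>q<?s. ?J (i * ?s) (j * ?s + q)) + (\<Sum>q<?s. ?J (i * ?s + L) (j * ?s + q))
       + (\<Sum>p=1..<L. \<Sum>q<?s. ?J (i * ?s + p) (j * ?s + q))"
      using L by (subst (1) split) simp
    moreover have "0 \<le> (\<Sum>p=1..<L. \<Sum>q<?s. ?J (i * ?s + p) (j * ?s + q))"
      by (intro sum_nonneg) simp
    ultimately show ?thesis
      using A B[of "i * ?s"] B[of "i * ?s + L"]
      by (cases "(i, j) \<in> V") (simp_all del: sum.lessThan_Suc One_nat_def)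
  qed
  have "(\<Sum>(i, j)\<in>V. int (card (mixed L y i j))) = (\<Sum>(i,j)\<in>?G. of_bool ((i, j) \<in> V) * int (card (mixed L y i j)))"
    using V by (intro sum.mono_neutral_cong_left) auto
  moreover have "(\<Sum>(i, j)\<in>EV. ?J (i * ?s + L) (j * ?s + 1)) \<le> (\<Sum>(i,j)\<in>?G. ?J (i * ?s + L) (j * ?s + 1))"
    using V EV by (intro sum_mono2) auto
  moreover have "(\<Sum>(i, j)\<in>EV. ?J (Suc i * ?s) (j * ?s + 1)) \<le> (\<Sum>(i,j)\<in>?G. ?J (i * ?s) (j * ?s + 1))"
  proof -
    have "(\<Sum>(i, j)\<in>EV. ?J (Suc i * ?s) (j * ?s + 1)) = (\<Sum>(i,j)\<in>map_prod Suc id ` EV. ?J (i * ?s) (j * ?s + 1))"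
      by (subst sum.reindex) (auto simp: inj_on_def intro!: sum.cong)
    also have "\<dots> \<le> (\<Sum>(i,j)\<in>?G. ?J (i * ?s) (j * ?s + 1))"
      using V EV by (intro sum_mono2) auto
    finally show ?thesis .
  qed
  moreover have "(\<Sum>(i, j)\<in>EV. bridge_gap L y i j)
    \<le> (\<Sum>(i, j)\<in>EV. ?J (i * ?s + L) (j * ?s + 1)) + (\<Sum>(i, j)\<in>EV. ?J (Suc i * ?s) (j * ?s + 1))"
  proof -
    have "\<bar>y (i * ?s + L) (j * ?s + 1) - y (Suc i * ?s + 1) (j * ?s + 1)\<bar>
      \<le> ?J (i * ?s + L) (j * ?s + 1) + ?J (Suc i * ?s) (j * ?s + 1)" if "(i, j) \<in> EV" for i j
    proof -
      have "(i * ?s + L, j * ?s + 1) \<in> ?T" "(Suc i * ?s + 1, j * ?s + 1) \<in> ?T" "(Suc i * ?s + 0, j * ?s + 1) \<in> ?T"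
        using that L EV by (subst mem_gadget; auto)+
      moreover have "Suc (i * ?s + L) = Suc i * ?s" by (simp add: mult_Suc)
      ultimately show ?thesis by (simp add: jump_def)
    qed
    then show ?thesis unfolding sum.distrib[symmetric] by (intro sum_mono) auto
  qed
  moreover have "(\<Sum>(i,j)\<in>?G. \<Sum>p<?s. \<Sum>q<?s. ?J (i * ?s + p) (j * ?s + q)) \<ge>
     (\<Sum>(i,j)\<in>?G. of_bool ((i, j) \<in> V) * int (card (mixed L y i j))) +
     (\<Sum>(i,j)\<in>?G. ?J (i * ?s) (j * ?s + 1)) + (\<Sum>(i,j)\<in>?G. ?J (i * ?s + L) (j * ?s + 1))"
    unfolding sum.distrib[symmetric] using inner by (intro sum_mono) auto
  moreover have "(\<Sum>(i,j)\<in>?G. \<Sum>p<?s. \<Sum>q<?s. ?J (i * ?s + p) (j * ?s + q)) = (\<Sum>x<n * ?s. \<Sum>z<n * ?s. ?J x z)"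
    unfolding sum_grid by (simp add: sum.cartesian_product)
  moreover have "(\<Sum>x<n * ?s. \<Sum>z<n * ?s. ?J x z) \<le> vjumps (n * ?s + 1) ?T y"
    unfolding vjumps_def by (auto intro!: add_increasing2 sum_nonneg sum_mono)
  ultimately show ?thesis by linarith
qed

definition blocksum :: "nat \<Rightarrow> picture \<Rightarrow> nat \<Rightarrow> nat \<Rightarrow> int" where
  "blocksum L y i j = (\<Sum>p=1..L. \<Sum>q=1..L. y (i * Suc L + p) (j * Suc L + q))"

lemma card_block [simp]: "card (block L v) = L * L"
  by (cases v) (simp add: block_def card_cartesian_product)

lemma finite_block [simp]: "finite (block L v)"
  by (cases v) (simp add: block_def)

lemma block_disjoint: "v \<noteq> w \<Longrightarrow> block L v \<inter> block L w = {}"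
proof (rule ccontr)
  assume "v \<noteq> w" "block L v \<inter> block L w \<noteq> {}"
  then obtain c where c: "c \<in> block L v" "c \<in> block L w" by blast
  obtain i j where v: "v = (i, j)" by fastforce
  obtain i' j' where w: "w = (i', j')" by fastforce
  define p q where "p = fst c - i * Suc L" and "q = snd c - j * Suc L"
  have pq: "c = (i * Suc L + p, j * Suc L + q)" "p \<le> L" "q \<le> L"
    using c(1) by (auto simp: v block_def p_def q_def)
  show False
    using c \<open>v \<noteq> w\<close> pq(2,3) unfolding v w pq(1) by (auto simp: mem_block)
qed

lemma sum_block: "(\<Sum>(x, z)\<in>block L (i, j). y x z) = blocksum L y i j" for y :: picture
proof -
  have shift: "(\<Sum>x = a + 1..a + L. f x) = (\<Sum>p = 1..L. f (a + p))" for f :: "nat \<Rightarrow> int" and a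
    using sum.shift_bounds_cl_nat_ivl[of f 1 a L] by (simp add: add.commute)
  show ?thesis
    unfolding block_def blocksum_def prod.case sum.cartesian_product[symmetric] shift ..
qed

lemma sum_blocks:
  fixes y :: picture
  assumes "finite V"
  shows "(\<Sum>(x, z)\<in>(\<Union>v\<in>V. block L v). y x z) = (\<Sum>(i, j)\<in>V. blocksum L y i j)"
  using assms block_disjoint
  by (subst sum.UNION_disjoint) (auto simp: sum_block intro!: sum.cong)

lemma mass_eq:
  assumes "T \<subseteq> {..<N} \<times> {..<N}"
  shows "mass N T y = (\<Sum>(x, z)\<in>T. y x z)"
proof -
  have "(\<Sum>(x, z)\<in>T. y x z) = (\<Sum>(x, z)\<in>{..<N} \<times> {..<N}. if (x, z) \<in> T then y x z else 0)"
    using assms by (intro sum.mono_neutral_cong_left) auto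
  then show ?thesis by (simp add: mass_def sum.cartesian_product)
qed

lemma mass_bounds:
  assumes G: "grid_graph n V EV EH" and L: "L \<ge> 1" and y: "binary (n * Suc L + 1) y"
  shows "(\<Sum>(i, j)\<in>V. blocksum L y i j) \<le> mass (n * Suc L + 1) (gadget L V EV EH) y"
    and "mass (n * Suc L + 1) (gadget L V EV EH) y \<le>
      (\<Sum>(i, j)\<in>V. blocksum L y i j) + int (card EV + card EH)"
proof -
  let ?T = "gadget L V EV EH" and ?B = "\<Union>v\<in>V. block L v"
  let ?M = "vbridge L ` EV \<union> hbridge L ` EH"
  have fin: "finite V" "finite EV" "finite EH" using grid_graph_finite[OF G] by auto
  have T: "?T \<subseteq> {..<n * Suc L + 1} \<times> {..<n * Suc L + 1}"
    using gadget_bounds[OF G L] by fastforce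
  have finT: "finite ?T" using fin by (simp add: gadget_def)
  have y01: "y x z \<in> {0, 1}" if "(x, z) \<in> ?T" for x z
    using y T that unfolding binary_def by blast
  have TB: "?T = ?B \<union> ?M" by (auto simp: gadget_def)
  show "(\<Sum>(i, j)\<in>V. blocksum L y i j) \<le> mass (n * Suc L + 1) ?T y"
    unfolding mass_eq[OF T] sum_blocks[OF fin(1), symmetric]
    using finT y01 by (intro sum_mono2) (fastforce simp: TB)+
  have "(\<Sum>(x, z)\<in>?T. y x z) = (\<Sum>(x, z)\<in>?B. y x z) + (\<Sum>(x, z)\<in>?M - ?B. y x z)"
    unfolding TB using fin by (subst sum.union_disjoint[symmetric]) (auto intro!: sum.cong)
  also have "(\<Sum>(x, z)\<in>?M - ?B. y x z) \<le> (\<Sum>(x, z)\<in>?M - ?B. 1)"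
    using y01 unfolding TB by (intro sum_mono) fastforce
  also have "\<dots> = int (card (?M - ?B))" by (simp add: case_prod_unfold)
  also have "\<dots> \<le> int (card EV + card EH)"
  proof -
    have "card (?M - ?B) \<le> card ?M" using fin by (intro card_mono) auto
    also have "\<dots> \<le> card (vbridge L ` EV) + card (hbridge L ` EH)" by (rule card_Un_le)
    also have "\<dots> \<le> card EV + card EH" using fin by (intro add_mono card_image_le)
    finally show ?thesis by simp
  qed
  finally show "mass (n * Suc L + 1) ?T y \<le> (\<Sum>(i, j)\<in>V. blocksum L y i j) + int (card EV + card EH)"
    unfolding mass_eq[OF T] sum_blocks[OF fin(1)] by simp
qed

text \<open>The cells of the drawing that belong to a set \<open>S\<close> of vertices. By the integer division a bridge goes with the
later of its two blocks, so it causes a jump only if the edge is cut.\<close>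

definition selection :: "nat \<Rightarrow> cell set \<Rightarrow> cell set \<Rightarrow> nat \<Rightarrow> nat \<Rightarrow> int" where
  "selection L T S x z = of_bool ((x, z) \<in> T \<and> (x div Suc L, z div Suc L) \<in> S)"

lemma selection_converse: "flip (selection L T S) = selection L (T\<inverse>) (S\<inverse>)"
  by (auto simp: flip_def selection_def fun_eq_iff)

lemma binary_selection: "binary N (selection L T S)"
  by (auto simp: binary_def selection_def)

lemma vjumps_selection_le:
  assumes G: "grid_graph n V EV EH" and L: "L \<ge> 2"
  defines "T \<equiv> gadget L V EV EH"
  shows "vjumps N T (selection L T S) \<le> int (vcut EV S)"
proof -
  let ?C = "{(i, j) \<in> EV. ((i, j) \<in> S) \<noteq> ((Suc i, j) \<in> S)}"
  let ?f = "\<lambda>(i, j). (i * Suc L + L, j * Suc L + 1)"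
  let ?J = "jump T (selection L T S)"
  have fin: "finite ?C" using grid_graph_finite[OF G] by (auto intro: finite_subset)
  have J: "?J x z \<le> of_bool ((x, z) \<in> ?f ` ?C)" for x z
  proof (cases "(x, z) \<in> T \<and> (Suc x, z) \<in> T \<and> ((x div Suc L, z div Suc L) \<in> S) \<noteq> ((Suc x div Suc L, z div Suc L) \<in> S)")
    case True
    define i p j q where ij: "i = x div Suc L" "p = x mod Suc L" "j = z div Suc L" "q = z mod Suc L"
    have xz: "x = i * Suc L + p" "z = j * Suc L + q" "p \<le> L" "q \<le> L"
      unfolding ij by (simp_all add: less_Suc_eq_le[symmetric] del: mult_Suc_right)
    have p: "p = L"
    proof (rule ccontr)
      assume "p \<noteq> L"
      then have "Suc x div Suc L = i"
        using xz by (intro div_nat_eqI) (auto simp: mult_Suc mult_Suc_right mult.commute)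
      then show False using True ij by auto
    qed
    have Sx: "Suc x = Suc i * Suc L + 0" by (simp add: xz p mult_Suc)
    have "Suc x div Suc L = Suc i" unfolding Sx by (metis add_0_right nonzero_mult_div_cancel_right nat.distinct(1))
    then have S: "((i, j) \<in> S) \<noteq> ((Suc i, j) \<in> S)" using True ij by auto
    have "(Suc i * Suc L + 0, j * Suc L + q) \<in> T" using True Sx xz by simp
    then have "(i, j) \<in> EV" "q = 1"
      unfolding T_def using mem_gadget[of 0 L q "Suc i" j] xz L by auto
    with S xz p have "(x, z) \<in> ?f ` ?C" by force
    then show ?thesis by (simp add: jump_def selection_def)
  qed (auto simp: jump_def selection_def)
  define D where "D = ?f ` ?C"
  have "vjumps N T (selection L T S) = (\<Sum>c\<in>{..<N} \<times> {..<N}. ?J (fst c) (snd c))"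
    unfolding vjumps_def by (simp add: sum.cartesian_product case_prod_unfold)
  also have "\<dots> \<le> (\<Sum>c\<in>{..<N} \<times> {..<N}. of_bool (c \<in> D))"
    using J unfolding D_def[symmetric] by (intro sum_mono) (metis prod.collapse)
  also have "\<dots> = int (card ({..<N} \<times> {..<N} \<inter> D))"
    by (subst sum_of_bool_eq) (auto simp: Int_def)
  also have "\<dots> \<le> int (card D)" using fin unfolding D_def by (intro of_nat_mono card_mono) auto
  also have "\<dots> \<le> int (card ?C)" using fin unfolding D_def by (intro of_nat_mono card_image_le)
  finally show ?thesis by (simp add: vcut_def)
qed

lemma jumps_selection_le:
  assumes G: "grid_graph n V EV EH" and L: "L \<ge> 2"
  defines "T \<equiv> gadget L V EV EH"
  shows "jumps N T (selection L T S) \<le> int (cut EV EH S)"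
  using vjumps_selection_le[OF G L, of N S] vjumps_selection_le[OF grid_graph_converse[OF G] L, of N "S\<inverse>"]
  unfolding jumps_def cut_def T_def selection_converse gadget_converse by simp

lemma blocksum_selection:
  assumes G: "grid_graph n V EV EH" and L: "L \<ge> 1" and "(i, j) \<in> V"
  shows "blocksum L (selection L (gadget L V EV EH) S) i j = int (L * L) * of_bool ((i, j) \<in> S)"
proof -
  have "selection L (gadget L V EV EH) S (i * Suc L + p) (j * Suc L + q) = of_bool ((i, j) \<in> S)"
    if "p \<in> {1..L}" "q \<in> {1..L}" for p q
  proof -
    have "(i * Suc L + p) div Suc L = i" "(j * Suc L + q) div Suc L = j"
      using that by auto
    then show ?thesis
      using that L assms(3) by (simp add: selection_def mem_gadget)
  qed
  then show ?thesis by (simp add: blocksum_def)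
qed

text \<open>With fewer than \<open>L\<close> mixed lines there are a constant row and a constant column. They meet, so they have the same
value, and every line that contains another value crosses one of them and is mixed.\<close>

lemma majority:
  assumes y: "\<And>p q. p \<in> {1..L} \<Longrightarrow> q \<in> {1..L} \<Longrightarrow> y (i * Suc L + p) (j * Suc L + q) \<in> {0, 1}"
    and few: "card (mixed L y i j) + card (mixed L (flip y) j i) < L"
  obtains m where "m \<in> {0, 1}" "\<And>p q. p \<in> {1..L} \<Longrightarrow> q \<in> {1..L} \<Longrightarrow>
    y (i * Suc L + p) (j * Suc L + q) \<noteq> m \<Longrightarrow> p \<in> mixed L (flip y) j i \<and> q \<in> mixed L y i j"
proof -
  have 1: "\<exists>q\<in>{1..L}. q \<notin> A" if "card A < L" "A \<subseteq> {1..L}" for A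
  proof (rule ccontr)
    assume "\<not> (\<exists>q\<in>{1..L}. q \<notin> A)"
    then have "{1..L} = A" using that by auto
    then show False using that by auto
  qed
  have sub: "mixed L y i j \<subseteq> {1..L}" "mixed L (flip y) j i \<subseteq> {1..L}" by (auto simp: mixed_def)
  obtain c where c: "c \<in> {1..L}" "c \<notin> mixed L y i j"
    using 1[OF _ sub(1)] few by auto
  obtain r where r: "r \<in> {1..L}" "r \<notin> mixed L (flip y) j i"
    using 1[OF _ sub(2)] few by auto
  have L: "1 \<in> {1..L}" using c by simp
  have col: "y (i * Suc L + p) (j * Suc L + q) = y (i * Suc L + p') (j * Suc L + q)"
    if "q \<in> {1..L}" "q \<notin> mixed L y i j" "p \<in> {1..L}" "p' \<in> {1..L}" for p p' q
    using that by (auto simp: mixed_def)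
  have row: "y (i * Suc L + p) (j * Suc L + q) = y (i * Suc L + p) (j * Suc L + q')"
    if "p \<in> {1..L}" "p \<notin> mixed L (flip y) j i" "q \<in> {1..L}" "q' \<in> {1..L}" for p q q'
    using that by (auto simp: mixed_def flip_def)
  show ?thesis
  proof (rule that[of "y (i * Suc L + r) (j * Suc L + c)"])
    show "y (i * Suc L + r) (j * Suc L + c) \<in> {0, 1}" using y r c by blast
    fix p q assume pq: "p \<in> {1..L}" "q \<in> {1..L}"
      "y (i * Suc L + p) (j * Suc L + q) \<noteq> y (i * Suc L + r) (j * Suc L + c)"
    show "p \<in> mixed L (flip y) j i \<and> q \<in> mixed L y i j"
      using row[of p q c] col[of c p r] col[of q p r] row[of r q c] pq r c by metis
  qed
qed

lemma sum_of_squares_le: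
  fixes f :: "'a \<Rightarrow> int"
  assumes "\<And>v. v \<in> V \<Longrightarrow> f v \<ge> 0"
  shows "(\<Sum>v\<in>V. f v * f v) \<le> (\<Sum>v\<in>V. f v) * (\<Sum>v\<in>V. f v)"
proof (cases "finite V")
  case True
  have "f v * f v \<le> f v * (\<Sum>w\<in>V. f w)" if "v \<in> V" for v
    using assms that True by (intro mult_left_mono member_le_sum) auto
  then show ?thesis unfolding sum_distrib_right by (intro sum_mono)
qed simp

lemma finite_mixed [simp]: "finite (mixed L y i j)"
  by (simp add: mixed_def)

section \<open>Rounding to a bisection\<close>

text \<open>If rounding changes the block cell at the end of a vertical bridge, then the first or the last row of the block
is mixed. Different bridges at a block use different lines, so these changes are paid by the jumps on mixed lines.\<close>

lemma vcut_rounding: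
  assumes G: "grid_graph n V EV EH" and L: "L \<ge> 2"
    and m: "\<And>v. v \<in> V \<Longrightarrow> m v \<in> {0, 1 :: int}"
    and maj: "\<And>i j p q. (i, j) \<in> V \<Longrightarrow> p \<in> {1..L} \<Longrightarrow> q \<in> {1..L} \<Longrightarrow>
      y (i * Suc L + p) (j * Suc L + q) \<noteq> m (i, j) \<Longrightarrow> p \<in> mixed L (flip y) j i"
    and y: "\<And>i j p q. (i, j) \<in> V \<Longrightarrow> p \<in> {1..L} \<Longrightarrow> q \<in> {1..L} \<Longrightarrow>
      y (i * Suc L + p) (j * Suc L + q) \<in> {0, 1}"
  shows "int (vcut EV {v \<in> V. m v = 1}) \<le>
    (\<Sum>(i, j)\<in>EV. bridge_gap L y i j) +
    (\<Sum>(i, j)\<in>V. int (card (mixed L (flip y) j i)))"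
proof -
  let ?R = "\<lambda>i j. mixed L (flip y) j i"
  have fin: "finite V" "finite EV" using grid_graph_finite[OF G] by auto
  have EV: "EV \<subseteq> V" "\<And>i j. (i, j) \<in> EV \<Longrightarrow> (Suc i, j) \<in> V"
    using G by (auto simp: grid_graph_def)
  have "int (vcut EV {v \<in> V. m v = 1}) = (\<Sum>(i, j)\<in>EV. \<bar>m (i, j) - m (Suc i, j)\<bar>)"
  proof -
    have "(\<Sum>(i, j)\<in>EV. \<bar>m (i, j) - m (Suc i, j)\<bar>) =
      (\<Sum>(i, j)\<in>EV. of_bool (((i, j) \<in> {v \<in> V. m v = 1}) \<noteq> ((Suc i, j) \<in> {v \<in> V. m v = 1})))"
    proof (intro sum.cong refl, clarify)
      fix i j assume "(i, j) \<in> EV"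
      then have "(i, j) \<in> V" "(Suc i, j) \<in> V" using EV by auto
      then show "\<bar>m (i, j) - m (Suc i, j)\<bar> =
        of_bool (((i, j) \<in> {v \<in> V. m v = 1}) \<noteq> ((Suc i, j) \<in> {v \<in> V. m v = 1}))"
        using m[of "(i, j)"] m[of "(Suc i, j)"] by auto
    qed
    also have "\<dots> = int (vcut EV {v \<in> V. m v = 1})"
      using fin unfolding case_prod_unfold vcut_def by (subst sum_of_bool_eq) (simp_all add: Int_def)
    finally show ?thesis by simp
  qed
  also have "\<dots> \<le> (\<Sum>(i, j)\<in>EV. bridge_gap L y i j
     + of_bool (L \<in> ?R i j) + of_bool (1 \<in> ?R (Suc i) j))"
  proof (rule sum_mono, clarify)
    fix i j assume ij: "(i, j) \<in> EV"
    have v: "(i, j) \<in> V" "(Suc i, j) \<in> V" using EV ij by auto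
    have "\<bar>y (i * Suc L + L) (j * Suc L + 1) - m (i, j)\<bar> \<le> of_bool (L \<in> ?R i j)"
      using maj[OF v(1), of L 1] y[OF v(1), of L 1] m[OF v(1)] L
      by (cases "L \<in> ?R i j") auto
    moreover have "\<bar>y (Suc i * Suc L + 1) (j * Suc L + 1) - m (Suc i, j)\<bar> \<le> of_bool (1 \<in> ?R (Suc i) j)"
      using maj[OF v(2), of 1 1] y[OF v(2), of 1 1] m[OF v(2)] L
      by (cases "1 \<in> ?R (Suc i) j") auto
    ultimately show "\<bar>m (i, j) - m (Suc i, j)\<bar> \<le> bridge_gap L y i j
      + of_bool (L \<in> ?R i j) + of_bool (1 \<in> ?R (Suc i) j)"
      by linarith
  qed
  also have "\<dots> = (\<Sum>(i, j)\<in>EV. bridge_gap L y i j)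
     + (\<Sum>(i, j)\<in>EV. of_bool (L \<in> ?R i j)) + (\<Sum>(i, j)\<in>EV. of_bool (1 \<in> ?R (Suc i) j))"
    by (simp add: sum.distrib case_prod_unfold)
  finally have *: "int (vcut EV {v \<in> V. m v = 1}) \<le>
    (\<Sum>(i, j)\<in>EV. bridge_gap L y i j)
     + (\<Sum>(i, j)\<in>EV. of_bool (L \<in> ?R i j)) + (\<Sum>(i, j)\<in>EV. of_bool (1 \<in> ?R (Suc i) j))" .
  have bottom: "(\<Sum>(i, j)\<in>EV. of_bool (L \<in> ?R i j) :: int) \<le> (\<Sum>(i, j)\<in>V. of_bool (L \<in> ?R i j))"
    using fin EV by (intro sum_mono2) auto
  have "(\<Sum>(i, j)\<in>EV. of_bool (1 \<in> ?R (Suc i) j) :: int) =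
      (\<Sum>(i, j)\<in>map_prod Suc id ` EV. of_bool (1 \<in> ?R i j))"
    by (subst sum.reindex) (auto simp: inj_on_def intro!: sum.cong)
  also have "\<dots> \<le> (\<Sum>(i, j)\<in>V. of_bool (1 \<in> ?R i j))"
    using fin EV by (intro sum_mono2) auto
  finally have top: "(\<Sum>(i, j)\<in>EV. of_bool (1 \<in> ?R (Suc i) j) :: int) \<le> (\<Sum>(i, j)\<in>V. of_bool (1 \<in> ?R i j))" .
  have ends: "of_bool (L \<in> M) + of_bool (1 \<in> M) \<le> int (card M)" if "finite M" for M
  proof -
    have "card ({L, 1} \<inter> M) \<le> card M" using that by (intro card_mono) auto
    moreover have "of_bool (L \<in> M) + of_bool (1 \<in> M) = int (card ({L, 1} \<inter> M))"
      using L by auto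
    ultimately show ?thesis by simp
  qed
  have "(\<Sum>(i, j)\<in>V. of_bool (L \<in> ?R i j)) + (\<Sum>(i, j)\<in>V. of_bool (1 \<in> ?R i j)) \<le> (\<Sum>(i, j)\<in>V. int (card (?R i j)))"
    unfolding sum.distrib[symmetric] case_prod_unfold by (rule sum_mono, rule ends, rule finite_mixed)
  with * bottom top show ?thesis by linarith
qed

text \<open>The cells that deviate from the majority lie at crossings of mixed rows and mixed columns.\<close>

lemma blocksum_rounding:
  assumes m: "m \<in> {0, 1 :: int}"
    and maj: "\<And>p q. p \<in> {1..L} \<Longrightarrow> q \<in> {1..L} \<Longrightarrow>
      y (i * Suc L + p) (j * Suc L + q) \<noteq> m \<Longrightarrow> p \<in> mixed L (flip y) j i \<and> q \<in> mixed L y i j"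
    and y: "\<And>p q. p \<in> {1..L} \<Longrightarrow> q \<in> {1..L} \<Longrightarrow> y (i * Suc L + p) (j * Suc L + q) \<in> {0, 1}"
  shows "\<bar>blocksum L y i j - int (L * L) * m\<bar> \<le> int (card (mixed L (flip y) j i) * card (mixed L y i j))"
proof -
  let ?A = "mixed L (flip y) j i" and ?B = "mixed L y i j"
  have "\<bar>blocksum L y i j - int (L * L) * m\<bar> = \<bar>\<Sum>(p, q)\<in>{1..L} \<times> {1..L}. y (i * Suc L + p) (j * Suc L + q) - m\<bar>"
    by (simp add: blocksum_def sum.cartesian_product case_prod_unfold sum_subtractf)
  also have "\<dots> \<le> (\<Sum>(p, q)\<in>{1..L} \<times> {1..L}. \<bar>y (i * Suc L + p) (j * Suc L + q) - m\<bar>)"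
    unfolding case_prod_unfold by (rule sum_abs)
  also have "\<dots> \<le> (\<Sum>c\<in>{1..L} \<times> {1..L}. of_bool (c \<in> ?A \<times> ?B))"
  proof (rule sum_mono, clarify)
    fix p q assume "p \<in> {1..L}" "q \<in> {1..L}"
    then show "\<bar>y (i * Suc L + p) (j * Suc L + q) - m\<bar> \<le> of_bool ((p, q) \<in> ?A \<times> ?B)"
      using maj[of p q] y[of p q] m by auto
  qed
  also have "\<dots> = int (card ({1..L} \<times> {1..L} \<inter> ?A \<times> ?B))"
    by (subst sum_of_bool_eq) (auto simp: Int_def)
  also have "\<dots> \<le> int (card (?A \<times> ?B))" by (intro of_nat_mono card_mono) auto
  finally show ?thesis by (simp add: card_cartesian_product)
qed

lemma flip_flip [simp]: "flip (flip y) = y"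
  by (simp add: flip_def fun_eq_iff)

text \<open>The constants fit as follows. A cheap selection has at most \<open>k < e\<close> jumps. The number of its cells exceeds the quota
\<open>h L\<^sup>2\<close> by at most \<open>e\<close> and falls short of it by at most \<open>(e + 1) k\<close>; at most \<open>e\<close> of them are bridges, and rounding
changes the number of cells in blocks by at most \<open>k\<^sup>2\<close>. Altogether this is less than the size
\<open>L\<^sup>2 = 4 (e + 1)\<^sup>2\<close> of one block, so exactly \<open>h\<close> blocks remain.\<close>

theorem rounding:
  fixes k :: nat
  assumes G: "grid_graph n V EV EH" and e: "e = card EV + card EH" and L: "L = 2 * (e + 1)"
  defines "T \<equiv> gadget L V EV EH" and "N \<equiv> n * Suc L + 1"
  assumes y: "binary N y"
    and upper: "mass N T y \<le> int (L * L * h + e)"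
    and cheap: "int (e + 1) * jumps N T y - mass N T y \<le> int (e + 1) * int k - int (L * L * h)"
    and k: "k < e"
  obtains S where "S \<subseteq> V" "card S = h" "cut EV EH S \<le> k"
proof -
  let ?R = "\<lambda>i j. mixed L (flip y) j i" and ?C = "\<lambda>i j. mixed L y i j"
  let ?b = "\<lambda>(i, j). int (card (?C i j)) + int (card (?R i j))"
  define C where "C = jumps N T y"
  have L2: "L \<ge> 2" "L \<ge> 1" using L by auto
  have fin: "finite V" "finite EV" "finite EH" using grid_graph_finite[OF G] by auto
  have T: "T \<subseteq> {..<N} \<times> {..<N}"
    using gadget_bounds[OF G L2(2)] unfolding T_def N_def by fastforce
  have y01: "y (i * Suc L + p) (j * Suc L + q) \<in> {0, 1}" if "(i, j) \<in> V" "p \<in> {1..L}" "q \<in> {1..L}" for i j p q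
  proof -
    have "(i * Suc L + p, j * Suc L + q) \<in> T" using that L2 unfolding T_def by (subst mem_gadget) auto
    then show ?thesis using T y unfolding binary_def by blast
  qed
  \<comment> \<open>The jumps at vertical and at horizontal bridges; \<open>?b v\<close> counts the mixed lines of the block of \<open>v\<close>.\<close>
  define X where "X = (\<Sum>(i, j)\<in>EV. bridge_gap L y i j)"
  define Y where "Y = (\<Sum>(i, j)\<in>EH\<inverse>. bridge_gap L (flip y) i j)"
  have swap: "(\<Sum>(i, j)\<in>V\<inverse>. f i j) = (\<Sum>(i, j)\<in>V. f j i)" for f :: picture
    by (rule sum.reindex_bij_witness[of _ prod.swap prod.swap]) auto
  have "C \<ge> (\<Sum>v\<in>V. ?b v) + X + Y"
    using vjumps_ge[OF G L2(1), of y] vjumps_ge[OF grid_graph_converse[OF G] L2(1), of "flip y"]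
    unfolding C_def jumps_def X_def Y_def T_def N_def gadget_converse swap
    by (simp add: sum.distrib case_prod_unfold)
  moreover have "X \<ge> 0" "Y \<ge> 0" unfolding X_def Y_def by (auto intro!: sum_nonneg)
  moreover have "C \<le> int k"
  proof (rule ccontr)
    assume "\<not> C \<le> int k"
    then have "int (e + 1) * (int k + 1) \<le> int (e + 1) * C" by (intro mult_left_mono) auto
    then show False using upper cheap unfolding C_def[symmetric] by (simp add: algebra_simps)
  qed
  ultimately have bC: "(\<Sum>v\<in>V. ?b v) \<le> int k" by linarith
  have "\<exists>m. m \<in> {0, 1 :: int} \<and> (\<forall>p q. p \<in> {1..L} \<longrightarrow> q \<in> {1..L} \<longrightarrow>
      y (fst v * Suc L + p) (snd v * Suc L + q) \<noteq> m \<longrightarrow>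
      p \<in> ?R (fst v) (snd v) \<and> q \<in> ?C (fst v) (snd v))" if "v \<in> V" for v
  proof -
    have "k < L" using k unfolding L by (simp add: mult_Suc_right)
    have "?b v \<le> (\<Sum>v\<in>V. ?b v)" using fin that by (intro member_le_sum) auto
    then have "card (?C (fst v) (snd v)) + card (?R (fst v) (snd v)) < L"
      using bC \<open>k < L\<close> unfolding case_prod_unfold by linarith
    then show ?thesis
      using majority[of L y "fst v" "snd v"] y01 that by (metis prod.collapse)
  qed
  then obtain m where "\<forall>v\<in>V. m v \<in> {0, 1 :: int} \<and> (\<forall>p q. p \<in> {1..L} \<longrightarrow> q \<in> {1..L} \<longrightarrow>
      y (fst v * Suc L + p) (snd v * Suc L + q) \<noteq> m v \<longrightarrow>
      p \<in> ?R (fst v) (snd v) \<and> q \<in> ?C (fst v) (snd v))"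
    by metis
  then have m: "\<And>v. v \<in> V \<Longrightarrow> m v \<in> {0, 1}" and maj: "\<And>i j p q. (i, j) \<in> V \<Longrightarrow>
     p \<in> {1..L} \<Longrightarrow> q \<in> {1..L} \<Longrightarrow> y (i * Suc L + p) (j * Suc L + q) \<noteq> m (i, j) \<Longrightarrow>
     p \<in> ?R i j \<and> q \<in> ?C i j"
    by fastforce+
  \<comment> \<open>Rounding: \<open>m v\<close> is the majority value in the block of \<open>v\<close>.\<close>
  define S where "S = {v \<in> V. m v = 1}"
  have "S \<subseteq> V" "finite S" using fin by (auto simp: S_def)
  have cutV: "int (vcut EV S) \<le> X + (\<Sum>(i, j)\<in>V. int (card (?R i j)))"
    unfolding S_def X_def using maj y01 m by (intro vcut_rounding[OF G L2(1)]) blast+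
  have cutH: "int (vcut (EH\<inverse>) (S\<inverse>)) \<le> Y + (\<Sum>(i, j)\<in>V. int (card (?C i j)))"
  proof -
    have "S\<inverse> = {v \<in> V\<inverse>. (m \<circ> prod.swap) v = 1}" by (auto simp: S_def)
    moreover have "int (vcut (EH\<inverse>) {v \<in> V\<inverse>. (m \<circ> prod.swap) v = 1}) \<le>
      Y + (\<Sum>(i, j)\<in>V\<inverse>. int (card (mixed L (flip (flip y)) j i)))"
      unfolding Y_def
    proof (rule vcut_rounding[OF grid_graph_converse[OF G] L2(1)])
      show "(m \<circ> prod.swap) v \<in> {0, 1}" if "v \<in> V\<inverse>" for v using m[of "prod.swap v"] that by (cases v) simp
      show "p \<in> mixed L (flip (flip y)) j i" if "(i, j) \<in> V\<inverse>" "p \<in> {1..L}" "q \<in> {1..L}"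
        "flip y (i * Suc L + p) (j * Suc L + q) \<noteq> (m \<circ> prod.swap) (i, j)" for i j p q
        using maj[of j i q p] that by (simp add: flip_def[of y])
      show "flip y (i * Suc L + p) (j * Suc L + q) \<in> {0, 1}" if "(i, j) \<in> V\<inverse>" "p \<in> {1..L}" "q \<in> {1..L}" for i j p q
        using y01[of j i q p] that by (simp add: flip_def)
    qed
    ultimately show ?thesis unfolding swap by simp
  qed
  have "int (cut EV EH S) \<le> C"
    using cutV cutH \<open>C \<ge> (\<Sum>v\<in>V. ?b v) + X + Y\<close> unfolding cut_def
    by (simp add: sum.distrib case_prod_unfold)
  then have "cut EV EH S \<le> k" using \<open>C \<le> int k\<close> by linarith
  moreover have "card S = h"
  proof -
    define P where "P = (\<Sum>(i, j)\<in>V. blocksum L y i j)"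
    have "\<bar>P - int (L * L) * int (card S)\<bar> \<le> int k * int k"
    proof -
      have cS: "int (card S) = (\<Sum>v\<in>V. m v)"
      proof -
        have "(\<Sum>v\<in>V. m v) = (\<Sum>v\<in>V. of_bool (m v = 1))" using m by (intro sum.cong) auto
        also have "\<dots> = int (card S)" using fin by (subst sum_of_bool_eq) (auto simp: S_def Int_def)
        finally show ?thesis by simp
      qed
      have "\<bar>P - int (L * L) * int (card S)\<bar> = \<bar>\<Sum>(i, j)\<in>V. blocksum L y i j - int (L * L) * m (i, j)\<bar>"
        unfolding P_def cS by (simp add: sum_subtractf sum_distrib_left case_prod_unfold)
      also have "\<dots> \<le> (\<Sum>(i, j)\<in>V. \<bar>blocksum L y i j - int (L * L) * m (i, j)\<bar>)"
        unfolding case_prod_unfold by (rule sum_abs)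
      also have "\<dots> \<le> (\<Sum>v\<in>V. ?b v * ?b v)"
      proof (rule sum_mono, clarify)
        fix i j assume v: "(i, j) \<in> V"
        have "\<bar>blocksum L y i j - int (L * L) * m (i, j)\<bar> \<le> int (card (?R i j) * card (?C i j))"
          using blocksum_rounding[of "m (i, j)" L y i j] m[OF v] maj[OF v] y01[OF v] by blast
        also have "\<dots> = int (card (?R i j)) * int (card (?C i j))" by simp
        also have "\<dots> \<le> ?b (i, j) * ?b (i, j)" unfolding prod.case by (intro mult_mono) auto
        finally show "\<bar>blocksum L y i j - int (L * L) * m (i, j)\<bar> \<le>
          (int (card (?C i j)) + int (card (?R i j))) * (int (card (?C i j)) + int (card (?R i j)))" by simp
      qed
      also have "\<dots> \<le> (\<Sum>v\<in>V. ?b v) * (\<Sum>v\<in>V. ?b v)" by (rule sum_of_squares_le) auto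
      also have "\<dots> \<le> int k * int k" using bC by (intro mult_mono) (auto intro!: sum_nonneg)
      finally show ?thesis .
    qed
    moreover have "P \<le> mass N T y" "mass N T y \<le> P + int e"
      using mass_bounds[OF G L2(2)] y unfolding P_def N_def T_def e by auto
    moreover have "C \<ge> 0"
      using \<open>C \<ge> (\<Sum>v\<in>V. ?b v) + X + Y\<close> \<open>X \<ge> 0\<close> \<open>Y \<ge> 0\<close> sum_nonneg[of V ?b] by auto
    then have "int (e + 1) * C \<ge> 0" by simp
    then have "mass N T y \<ge> int (L * L * h) - int (e + 1) * int k"
      using cheap unfolding C_def by linarith
    moreover have "int k * int k \<le> int e * int e" "int (e + 1) * int k \<le> int (e + 1) * int e"
      using k by (auto intro!: mult_mono)
    moreover have "int (L * L) = 4 * (int e * int e) + 8 * int e + 4"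
      unfolding L by (simp add: algebra_simps)
    moreover have "int (e + 1) * int e = int e * int e + int e" by (simp add: algebra_simps)
    ultimately have *: "\<bar>int (L * L) * int (card S) - int (L * L) * int h\<bar> < int (L * L)"
      using upper by (simp only: of_nat_mult of_nat_add)
    then have "int (L * L) * \<bar>int (card S) - int h\<bar> < int (L * L) * 1"
      by (simp only: right_diff_distrib[symmetric] abs_mult abs_of_nat mult_1_right)
    then have "\<bar>int (card S) - int h\<bar> < 1"
      by (rule mult_left_less_imp_less) simp
    then show ?thesis by simp
  qed
  ultimately show thesis using that \<open>S \<subseteq> V\<close> by blast
qed

section \<open>Compression of coordinates\<close>

text \<open>The rank skips gaps between coordinates, but it maps \<open>a\<close> and \<open>a + 1\<close> to consecutive numbers if \<open>a\<close> occurs.\<close>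

definition rank :: "int set \<Rightarrow> int \<Rightarrow> nat" where
  "rank X a = card {b \<in> X. b < a}"

lemma rank_Suc:
  assumes "finite X" "a \<in> X"
  shows "rank X (a + 1) = Suc (rank X a)"
proof -
  have "{b \<in> X. b < a + 1} = insert a {b \<in> X. b < a}" using assms by auto
  then show ?thesis using assms by (simp add: rank_def)
qed

lemma rank_strict_mono:
  assumes "finite X" "a \<in> X" "a < b"
  shows "rank X a < rank X b"
  unfolding rank_def using assms by (intro psubset_card_mono) auto

lemma inj_on_rank: "finite X \<Longrightarrow> inj_on (rank X) X"
  by (rule inj_onI) (metis linorder_neqE nat_less_le rank_strict_mono)

lemma rank_less: "finite X \<Longrightarrow> a \<in> X \<Longrightarrow> rank X a < card X"
  unfolding rank_def by (intro psubset_card_mono) auto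

definition pos :: "point set \<Rightarrow> point \<Rightarrow> cell" where
  "pos V v = (rank (fst ` V) (fst v), rank (snd ` V) (snd v))"

definition below :: "point \<Rightarrow> point" where
  "below v = (fst v + 1, snd v)"

definition beside :: "point \<Rightarrow> point" where
  "beside v = (fst v, snd v + 1)"

definition vedges :: "graph \<Rightarrow> cell set" where
  "vedges = (\<lambda>(V, E). pos V ` {v. {v, below v} \<in> E})"

definition hedges :: "graph \<Rightarrow> cell set" where
  "hedges = (\<lambda>(V, E). pos V ` {v. {v, beside v} \<in> E})"

lemma inj_on_pos: "finite V \<Longrightarrow> inj_on (pos V) V"
  using inj_on_rank[of "fst ` V"] inj_on_rank[of "snd ` V"]
  by (intro inj_onI) (simp add: pos_def prod_eq_iff inj_on_eq_iff)

lemma pos_below: "finite V \<Longrightarrow> v \<in> V \<Longrightarrow> pos V (below v) = (Suc (fst (pos V v)), snd (pos V v))"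
  by (simp add: pos_def below_def rank_Suc)

lemma pos_beside: "finite V \<Longrightarrow> v \<in> V \<Longrightarrow> pos V (beside v) = (fst (pos V v), Suc (snd (pos V v)))"
  by (simp add: pos_def beside_def rank_Suc)

lemma int_squares_sum_1: "a\<^sup>2 + b\<^sup>2 = (1::int) \<longleftrightarrow> a = 0 \<and> (b = 1 \<or> b = -1) \<or> b = 0 \<and> (a = 1 \<or> a = -1)"
proof -
  have "a\<^sup>2 \<ge> 1" if "a \<noteq> 0" for a :: int
    using that by (simp add: int_one_le_iff_zero_less)
  then show ?thesis
    by (cases "a = 0"; cases "b = 0") (auto simp: power2_eq_1_iff, smt (verit))
qed

lemma grid_adjacent_iff:
  "grid_adjacent u v \<longleftrightarrow> v = below u \<or> u = below v \<or> v = beside u \<or> u = beside v"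
  unfolding grid_adjacent_def int_squares_sum_1 below_def beside_def
  by (auto simp: prod_eq_iff)

lemma vcut_converse:
  "vcut (F\<inverse>) (S\<inverse>) = card {c \<in> F. (c \<in> S) \<noteq> ((fst c, Suc (snd c)) \<in> S)}"
  unfolding vcut_def
  by (rule bij_betw_same_card[of prod.swap])
    (auto simp: bij_betw_def inj_on_def image_iff)

locale subgrid =
  fixes V :: "point set" and E :: "point set set"
  assumes grid: "grid_subgraph (V, E)"
begin

abbreviation "A \<equiv> {v. {v, below v} \<in> E}"
abbreviation "B \<equiv> {v. {v, beside v} \<in> E}"

lemma finite_V: "finite V" and E_sub: "E \<subseteq> {{u, v} | u v. u \<in> V \<and> v \<in> V \<and> grid_adjacent u v}"
  using grid by (auto simp: grid_subgraph_def)

lemma edge_ends: "{u, v} \<in> E \<Longrightarrow> u \<in> V \<and> v \<in> V"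
  using E_sub by (fastforce simp: doubleton_eq_iff)

lemma E_eq: "E = (\<lambda>v. {v, below v}) ` A \<union> (\<lambda>v. {v, beside v}) ` B"
proof (intro equalityI subsetI)
  fix e assume e: "e \<in> E"
  then obtain u v where uv: "e = {u, v}" "grid_adjacent u v" using E_sub by blast
  then show "e \<in> (\<lambda>v. {v, below v}) ` A \<union> (\<lambda>v. {v, beside v}) ` B"
    using e unfolding grid_adjacent_iff by (auto simp: insert_commute)
qed auto

lemma inj_below: "inj (\<lambda>v. {v, below v})"
  by (auto simp: inj_def doubleton_eq_iff below_def prod_eq_iff)

lemma inj_beside: "inj (\<lambda>v. {v, beside v})"
  by (auto simp: inj_def doubleton_eq_iff beside_def prod_eq_iff)

lemma below_beside: "{v, below v} \<noteq> {w, beside w}"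
  by (auto simp: doubleton_eq_iff beside_def below_def prod_eq_iff)

lemma A_sub: "A \<subseteq> V" "B \<subseteq> V"
  using edge_ends by blast+

text \<open>Every edge is counted at its upper or left end, with vertical and horizontal edges kept apart.\<close>

lemma card_filter_E: "card {e \<in> E. P e} = card {v \<in> A. P {v, below v}} + card {v \<in> B. P {v, beside v}}"
proof -
  have fin: "finite A" "finite B" using A_sub finite_V by (blast intro: finite_subset)+
  have "{e \<in> E. P e} = (\<lambda>v. {v, below v}) ` {v \<in> A. P {v, below v}} \<union> (\<lambda>v. {v, beside v}) ` {v \<in> B. P {v, beside v}}"
    by (subst E_eq) auto
  then have "card {e \<in> E. P e} = card ((\<lambda>v. {v, below v}) ` {v \<in> A. P {v, below v}}) +
    card ((\<lambda>v. {v, beside v}) ` {v \<in> B. P {v, beside v}})"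
    using fin below_beside by (simp only:) (rule card_Un_disjoint; auto)
  also have "\<dots> = card {v \<in> A. P {v, below v}} + card {v \<in> B. P {v, beside v}}"
    by (intro arg_cong2[where f = "(+)"] card_image inj_on_subset[OF inj_below] inj_on_subset[OF inj_beside]) auto
  finally show ?thesis .
qed

lemma card_E: "card E = card (vedges (V, E)) + card (hedges (V, E))"
  using card_filter_E[of "\<lambda>_. True"] inj_on_pos[OF finite_V] A_sub
  by (auto simp: vedges_def hedges_def card_image inj_on_subset)

lemma grid_graph: "grid_graph (card V) (pos V ` V) (vedges (V, E)) (hedges (V, E))"
proof -
  have "rank (fst ` V) (fst v) < card V" "rank (snd ` V) (snd v) < card V" if "v \<in> V" for v
    using that finite_V by (auto intro!: less_le_trans[OF rank_less] card_image_le)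
  then have "pos V ` V \<subseteq> {..<card V} \<times> {..<card V}" by (auto simp: pos_def)
  moreover have "c \<in> pos V ` V \<and> (Suc (fst c), snd c) \<in> pos V ` V" if c: "c \<in> vedges (V, E)" for c
  proof -
    obtain v where v: "c = pos V v" "{v, below v} \<in> E" using c by (auto simp: vedges_def)
    then show ?thesis
      using edge_ends[OF v(2)] pos_below[OF finite_V, of v] by (metis imageI)
  qed
  moreover have "c \<in> pos V ` V \<and> (fst c, Suc (snd c)) \<in> pos V ` V" if c: "c \<in> hedges (V, E)" for c
  proof -
    obtain v where v: "c = pos V v" "{v, beside v} \<in> E" using c by (auto simp: hedges_def)
    then show ?thesis
      using edge_ends[OF v(2)] pos_beside[OF finite_V, of v] by (metis imageI)
  qed
  ultimately show ?thesis
    unfolding grid_graph_def by (metis (no_types, lifting) case_prodI2 fst_conv snd_conv)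
qed

lemma crossing_iff:
  assumes "S \<subseteq> V" "u \<in> V" "v \<in> V"
  shows "(\<exists>a b. {u, v} = {a, b} \<and> a \<in> S \<and> b \<in> V - S) \<longleftrightarrow> (u \<in> S) \<noteq> (v \<in> S)"
  using assms unfolding doubleton_eq_iff by blast

lemma cut_pos:
  assumes S: "S \<subseteq> V"
  shows "cut (vedges (V, E)) (hedges (V, E)) (pos V ` S) = cut_size (V, E) S"
proof -
  have pS: "pos V v \<in> pos V ` S \<longleftrightarrow> v \<in> S" if "v \<in> V" for v
    using inj_on_image_mem_iff[OF inj_on_pos[OF finite_V] that S] .
  have filter_image: "{c \<in> f ` X. P c} = f ` {v \<in> X. P (f v)}" for f :: "point \<Rightarrow> cell" and X P
    by auto
  have v: "vcut (vedges (V, E)) (pos V ` S) = card {v \<in> A. (v \<in> S) \<noteq> (below v \<in> S)}"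
  proof -
    have "((pos V v \<in> pos V ` S) \<noteq> ((Suc (fst (pos V v)), snd (pos V v)) \<in> pos V ` S)) \<longleftrightarrow>
      (v \<in> S) \<noteq> (below v \<in> S)" if "v \<in> A" for v
      using that edge_ends[of v "below v"] by (simp add: pS pos_below[OF finite_V, symmetric])
    then have "{c \<in> vedges (V, E). (c \<in> pos V ` S) \<noteq> ((Suc (fst c), snd c) \<in> pos V ` S)} =
      pos V ` {v \<in> A. (v \<in> S) \<noteq> (below v \<in> S)}"
      unfolding vedges_def prod.case filter_image by (intro arg_cong[where f = "(`) (pos V)"]) blast
    then have "vcut (vedges (V, E)) (pos V ` S) = card (pos V ` {v \<in> A. (v \<in> S) \<noteq> (below v \<in> S)})"
      by (simp add: vcut_def case_prod_unfold)
    also have "\<dots> = card {v \<in> A. (v \<in> S) \<noteq> (below v \<in> S)}"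
      using A_sub by (intro card_image inj_on_subset[OF inj_on_pos[OF finite_V]]) blast
    finally show ?thesis .
  qed
  have h: "vcut ((hedges (V, E))\<inverse>) ((pos V ` S)\<inverse>) = card {v \<in> B. (v \<in> S) \<noteq> (beside v \<in> S)}"
  proof -
    have "((pos V v \<in> pos V ` S) \<noteq> ((fst (pos V v), Suc (snd (pos V v))) \<in> pos V ` S)) \<longleftrightarrow>
      (v \<in> S) \<noteq> (beside v \<in> S)" if "v \<in> B" for v
      using that edge_ends[of v "beside v"] by (simp add: pS pos_beside[OF finite_V, symmetric])
    then have "{c \<in> hedges (V, E). (c \<in> pos V ` S) \<noteq> ((fst c, Suc (snd c)) \<in> pos V ` S)} =
      pos V ` {v \<in> B. (v \<in> S) \<noteq> (beside v \<in> S)}"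
      unfolding hedges_def prod.case filter_image by (intro arg_cong[where f = "(`) (pos V)"]) blast
    then have "vcut ((hedges (V, E))\<inverse>) ((pos V ` S)\<inverse>) = card (pos V ` {v \<in> B. (v \<in> S) \<noteq> (beside v \<in> S)})"
      by (simp add: vcut_converse)
    also have "\<dots> = card {v \<in> B. (v \<in> S) \<noteq> (beside v \<in> S)}"
      using A_sub by (intro card_image inj_on_subset[OF inj_on_pos[OF finite_V]]) blast
    finally show ?thesis .
  qed
  show ?thesis
    unfolding cut_def cut_size_def prod.case v h card_filter_E
    by (intro arg_cong2[where f = "(+)"] arg_cong[where f = card] Collect_cong conj_cong refl
        crossing_iff[OF S, symmetric]) (blast dest: edge_ends)+
qed

text \<open>If the number of nodes is odd, a bisection may have either of two sizes; passing to the complement makes it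
\<open>\<lceil>n / 2\<rceil>\<close>.\<close>

lemma bisection_iff:
  "(\<exists>S. bisection (V, E) S \<and> cut_size (V, E) S \<le> k) \<longleftrightarrow>
   (\<exists>S \<subseteq> pos V ` V. card S = (card V + 1) div 2 \<and> cut (vedges (V, E)) (hedges (V, E)) S \<le> k)"
proof -
  have ceil: "\<lceil>rat_of_nat n / 2\<rceil> = int ((n + 1) div 2)" for n :: nat
  proof (cases "even n")
    case True
    then obtain m where "n = 2 * m" by blast
    then show ?thesis by simp
  next
    case False
    then obtain m where m: "n = 2 * m + 1" by (blast elim: oddE)
    show ?thesis unfolding m by (simp add: ceiling_eq_iff field_simps)
  qed
  have complement: "cut_size (V, E) (V - S) = cut_size (V, E) S" if "S \<subseteq> V" for S
  proof -
    have "(\<exists>u v. e = {u, v} \<and> u \<in> V - S \<and> v \<in> V - (V - S)) \<longleftrightarrow> (\<exists>u v. e = {u, v} \<and> u \<in> S \<and> v \<in> V - S)"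
      if e: "e \<in> E" for e
    proof -
      obtain u v where uv: "e = {u, v}" "u \<in> V" "v \<in> V" using e E_sub by blast
      show ?thesis
        unfolding uv(1) crossing_iff[OF \<open>S \<subseteq> V\<close> uv(2,3)] crossing_iff[OF Diff_subset uv(2,3)]
        using uv(2,3) by blast
    qed
    then show ?thesis
      unfolding cut_size_def prod.case by (intro arg_cong[where f = card] Collect_cong conj_cong refl)
  qed
  show ?thesis
  proof
    assume "\<exists>S. bisection (V, E) S \<and> cut_size (V, E) S \<le> k"
    then obtain S where S: "S \<subseteq> V" "card S \<le> (card V + 1) div 2" "card (V - S) \<le> (card V + 1) div 2"
      "cut_size (V, E) S \<le> k" by (auto simp: bisection_def ceil)
    have "card S + card (V - S) = card V"
      using S(1) finite_V card_mono[OF finite_V S(1)] by (simp add: card_Diff_subset finite_subset)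
    then have "card S = (card V + 1) div 2 \<or> card (V - S) = (card V + 1) div 2" using S(2,3) by linarith
    moreover define S' where "S' = (if card S = (card V + 1) div 2 then S else V - S)"
    ultimately have S': "S' \<subseteq> V" "card S' = (card V + 1) div 2" "cut_size (V, E) S' \<le> k"
      using S(1,4) complement[OF S(1)] by (simp_all split: if_splits)
    then show "\<exists>S \<subseteq> pos V ` V. card S = (card V + 1) div 2 \<and> cut (vedges (V, E)) (hedges (V, E)) S \<le> k"
      using cut_pos[OF S'(1)] card_image[OF inj_on_subset[OF inj_on_pos[OF finite_V] S'(1)]]
      by (intro exI[of _ "pos V ` S'"]) auto
  next
    assume "\<exists>S \<subseteq> pos V ` V. card S = (card V + 1) div 2 \<and> cut (vedges (V, E)) (hedges (V, E)) S \<le> k"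
    then obtain S where S: "S \<subseteq> V" "card (pos V ` S) = (card V + 1) div 2"
      "cut (vedges (V, E)) (hedges (V, E)) (pos V ` S) \<le> k"
      by (auto simp: subset_image_iff)
    then have "card S = (card V + 1) div 2"
      using card_image[OF inj_on_subset[OF inj_on_pos[OF finite_V] S(1)]] by simp
    moreover have "card (V - S) = card V - card S"
      using S(1) finite_V by (simp add: card_Diff_subset finite_subset)
    ultimately show "\<exists>S. bisection (V, E) S \<and> cut_size (V, E) S \<le> k"
      using S cut_pos[OF S(1)] by (intro exI[of _ S]) (auto simp: bisection_def ceil)
  qed
qed

end

section \<open>Optimal values decide the bisection problem\<close>

lemma vcut_le: "finite F \<Longrightarrow> vcut F S \<le> card F"
  unfolding vcut_def by (rule card_mono) auto

lemma cut_le: "finite EV \<Longrightarrow> finite EH \<Longrightarrow> cut EV EH S \<le> card EV + card EH"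
  unfolding cut_def using vcut_le[of EV S] vcut_le[of "EH\<inverse>" "S\<inverse>"] by simp

text \<open>The trust-region problem with admissible values 0 and 1 and zero start, stated for the values \<open>y = d\<close>.\<close>

definition feasible :: "nat \<Rightarrow> nat \<Rightarrow> picture \<Rightarrow> bool" where
  "feasible N r y \<longleftrightarrow> binary N y \<and> (\<Sum>x<N. \<Sum>z<N. y x z) \<le> int r"

definition optimal :: "nat \<Rightarrow> int \<Rightarrow> cell set \<Rightarrow> nat \<Rightarrow> picture \<Rightarrow> bool" where
  "optimal N a T r y \<longleftrightarrow> feasible N r y \<and> (\<forall>y'. feasible N r y' \<longrightarrow> energy N a T y \<le> energy N a T y')"

context subgrid
begin

definition width :: nat where
  "width = 2 * (card E + 1)"

definition side :: nat where
  "side = card V * Suc width + 1"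

definition cells :: "cell set" where
  "cells = gadget width (pos V ` V) (vedges (V, E)) (hedges (V, E))"

definition quota :: nat where
  "quota = width * width * ((card V + 1) div 2)"

lemma card_pos: "card (pos V ` V) = card V"
  by (rule card_image[OF inj_on_pos[OF finite_V]])

text \<open>The program evaluates jumps and mass of the optimal solution instead of the objective. This is correct for
solutions that use holes as well, because jumps and mass only give a lower bound for the objective, whereas they
give its exact value on the selection that belongs to a bisection.\<close>

theorem optimum_decides:
  fixes k :: nat
  assumes opt: "optimal side (int (card E + 1)) cells (quota + card E) y"
  shows "(\<exists>S. bisection (V, E) S \<and> cut_size (V, E) S \<le> k) \<longleftrightarrow>
    int (card E + 1) * jumps side cells y - mass side cells y \<le> int (card E + 1) * int k - int quota"
    (is "?lhs \<longleftrightarrow> ?rhs")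
proof -
  let ?N = side and ?L = width and ?e = "card E" and ?T = cells and ?h = "(card V + 1) div 2"
  let ?EV = "vedges (V, E)" and ?EH = "hedges (V, E)"
  note G = grid_graph
  have L: "?L \<ge> 2" "?L \<ge> 1" by (simp_all add: width_def mult_Suc_right)
  have y: "binary ?N y" "(\<Sum>x<?N. \<Sum>z<?N. y x z) \<le> int (quota + ?e)"
    using opt by (auto simp: optimal_def feasible_def)
  have T: "?T \<subseteq> {1..<?N - 1} \<times> {1..<?N - 1}"
    using gadget_bounds[OF G L(2)] by (simp add: cells_def side_def)
  have N: "?N > 0" by (simp add: side_def)
  show ?thesis
  proof
    assume ?lhs
    then obtain S where S: "S \<subseteq> pos V ` V" "card S = ?h" "cut ?EV ?EH S \<le> k"
      unfolding bisection_iff by blast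
    define s where "s = selection ?L ?T S"
    have s: "binary ?N s" unfolding s_def by (rule binary_selection)
    have "(\<Sum>(i, j)\<in>pos V ` V. blocksum ?L s i j) = (\<Sum>v\<in>pos V ` V. int (?L * ?L) * of_bool (v \<in> S))"
      using blocksum_selection[OF G L(2)] unfolding s_def cells_def
      by (intro sum.cong) auto
    also have "\<dots> = int (?L * ?L) * int (card (pos V ` V \<inter> S))"
      using finite_V by (simp add: sum_distrib_left[symmetric] sum_of_bool_eq Int_def)
    also have "pos V ` V \<inter> S = S" using S by blast
    finally have blocks: "(\<Sum>(i, j)\<in>pos V ` V. blocksum ?L s i j) = int quota"
      by (simp add: quota_def S)
    have mass: "int quota \<le> mass ?N ?T s" "mass ?N ?T s \<le> int quota + int ?e"
      using mass_bounds[OF G L(2), of s] s card_E blocks unfolding side_def cells_def by auto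
    have "mass ?N ?T s = (\<Sum>x<?N. \<Sum>z<?N. s x z)"
      unfolding mass_def by (intro sum.cong refl) (auto simp: s_def selection_def)
    then have "feasible ?N (quota + ?e) s"
      using s mass(2) by (simp add: feasible_def)
    then have "energy ?N (int (?e + 1)) ?T y \<le> energy ?N (int (?e + 1)) ?T s"
      using opt by (simp add: optimal_def)
    moreover have "energy ?N (int (?e + 1)) ?T s = int (?e + 1) * jumps ?N ?T s - mass ?N ?T s"
      using T N s by (rule energy_eq) (auto simp: s_def selection_def)
    moreover have "jumps ?N ?T s \<le> int k"
      using jumps_selection_le[OF G L(1), of ?N S] S(3) by (simp add: s_def cells_def)
    then have "int (?e + 1) * jumps ?N ?T s \<le> int (?e + 1) * int k" by (intro mult_left_mono) auto
    moreover have "int (?e + 1) * jumps ?N ?T y - mass ?N ?T y \<le> energy ?N (int (?e + 1)) ?T y"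
      using T N _ y(1) by (rule energy_ge) simp
    ultimately show ?rhs
      using mass(1) by linarith
  next
    assume ?rhs
    show ?lhs
    proof (cases "k < ?e")
      case True
      have "mass ?N ?T y \<le> (\<Sum>x<?N. \<Sum>z<?N. y x z)"
        unfolding mass_def using y(1) by (intro sum_mono) (force simp: binary_def)
      with y(2) have "mass ?N ?T y \<le> int (?L * ?L * ?h + ?e)" by (simp add: quota_def)
      then obtain S where "S \<subseteq> pos V ` V" "card S = ?h" "cut ?EV ?EH S \<le> k"
        using rounding[OF G card_E width_def, of y ?h k] y(1) \<open>?rhs\<close> True
        by (auto simp: cells_def side_def quota_def)
      then show ?lhs unfolding bisection_iff by blast
    next
      case False
      have "?h \<le> card (pos V ` V)" unfolding card_pos by linarith
      then obtain S where "S \<subseteq> pos V ` V" "card S = ?h" by (rule obtain_subset_with_card_n)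
      moreover have "cut ?EV ?EH S \<le> k" using cut_le[OF grid_graph_finite(2,3)[OF G], of S] card_E False by simp
      ultimately show ?lhs unfolding bisection_iff by blast
    qed
  qed
qed

end

section \<open>The instances and their codes\<close>

declare mult_Suc [simp] mult_Suc_right [simp]

text \<open>Row-major order by division with remainder: indices start at 1 in the matrix and at 0 in the list.\<close>

lemma entries_eq:
  "entries [1..<n + 1] [1..<m + 1] A = map (\<lambda>i. A (Suc (i div m)) (Suc (i mod m))) [0..<n * m]"
proof (cases "m = 0")
  case False
  have row: "map (A (Suc n)) [1..<m + 1] = map (\<lambda>i. A (Suc (i div m)) (Suc (i mod m))) [n * m..<n * m + m]" for n
  proof (rule nth_equalityI)
    fix i assume "i < length (map (A (Suc n)) [1..<m + 1])"
    then show "map (A (Suc n)) [1..<m + 1] ! i = map (\<lambda>i. A (Suc (i div m)) (Suc (i mod m))) [n * m..<n * m + m] ! i"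
      by (simp del: upt_Suc)
  qed simp
  show ?thesis
  proof (induction n)
    case (Suc n)
    have "entries [1..<Suc n + 1] [1..<m + 1] A = entries [1..<n + 1] [1..<m + 1] A @ map (A (Suc n)) [1..<m + 1]"
      by (simp add: entries_def del: upt_Suc) (simp add: upt_Suc)
    also have "\<dots> = map (\<lambda>i. A (Suc (i div m)) (Suc (i mod m))) ([0..<n * m] @ [n * m..<n * m + m])"
      unfolding Suc row by simp
    also have "[0..<n * m] @ [n * m..<n * m + m] = [0..<Suc n * m]"
      using upt_add_eq_append[of 0 "n * m" m] by (simp add: mult_Suc add.commute)
    finally show ?case .
  qed (simp add: entries_def)
qed (simp add: entries_def)

lemma entries_Suc:
  "entries [Suc 0..<Suc n] [Suc 0..<Suc m] A = map (\<lambda>i. A (Suc (i div m)) (Suc (i mod m))) [0..<n * m]"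
  using entries_eq[of n m A] by (simp del: upt_Suc)

lemma entries_const: "entries is js (\<lambda>_ _. c) = replicate (length is * length js) c"
proof -
  have "concat (map (\<lambda>_. replicate m c) is) = replicate (length is * m) c" for m
    by (induction "is") (auto simp: replicate_add)
  then show ?thesis by (simp add: entries_def map_replicate_const)
qed

lemma rat_codes_of_int: "rat_codes (map of_int zs) = concat (map (\<lambda>z. [z, 1]) zs)"
  by (simp add: rat_codes_def comp_def)

lemma scale_to_int_of_int: "scale_to_int (map of_int zs) = zs"
proof -
  have "Lcm (set (map (snd \<circ> quotient_of) (map rat_of_int zs))) = 1"
    by (cases zs) (auto simp: image_constant_conv)
  then show ?thesis unfolding scale_to_int_def by (simp only: map_map comp_def) (simp del: set_map)
qed

text \<open>Instances from a side \<open>N\<close>, a radius \<open>r\<close>, a jump weight \<open>a\<close> and a drawing \<open>T\<close>.\<close>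

definition tr_ip_of :: "nat \<Rightarrow> nat \<Rightarrow> nat \<Rightarrow> cell set \<Rightarrow> tr_ip" where
  "tr_ip_of N r a T = \<lparr>rows = N, cols = N, lower = 0, upper = 1, start = \<lambda>_ _. 0,
     cost = \<lambda>i j. of_int (field (int a) T (i - 1) (j - 1)), radius = r, alpha = of_nat a\<rparr>"

definition wtr_ip_of :: "nat \<Rightarrow> nat \<Rightarrow> nat \<Rightarrow> cell set \<Rightarrow> wtr_ip" where
  "wtr_ip_of N r a T = \<lparr>rows = N, cols = N, lower = 0, upper = 1, start = \<lambda>_ _. 0,
     cost = \<lambda>i j. of_int (field (int a) T (i - 1) (j - 1)), radius = r,
     vweight = \<lambda>_ _. of_nat a, hweight = \<lambda>_ _. of_nat a, tr_weight = \<lambda>_ _. 1\<rparr>"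

lemma tr_ip_of_sel [simp]:
  "rows (tr_ip_of N r a T) = N" "cols (tr_ip_of N r a T) = N" "lower (tr_ip_of N r a T) = 0"
  "upper (tr_ip_of N r a T) = 1" "start (tr_ip_of N r a T) = (\<lambda>_ _. 0)" "radius (tr_ip_of N r a T) = r"
  "cost (tr_ip_of N r a T) = (\<lambda>i j. of_int (field (int a) T (i - 1) (j - 1)))"
  "alpha (tr_ip_of N r a T) = of_nat a"
  by (simp_all add: tr_ip_of_def)

lemma wtr_ip_of_sel [simp]:
  "rows (wtr_ip_of N r a T) = N" "cols (wtr_ip_of N r a T) = N" "lower (wtr_ip_of N r a T) = 0"
  "upper (wtr_ip_of N r a T) = 1" "start (wtr_ip_of N r a T) = (\<lambda>_ _. 0)" "radius (wtr_ip_of N r a T) = r"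
  "cost (wtr_ip_of N r a T) = (\<lambda>i j. of_int (field (int a) T (i - 1) (j - 1)))"
  "vweight (wtr_ip_of N r a T) = (\<lambda>_ _. of_nat a)" "hweight (wtr_ip_of N r a T) = (\<lambda>_ _. of_nat a)"
  "tr_weight (wtr_ip_of N r a T) = (\<lambda>_ _. 1)"
  by (simp_all add: wtr_ip_of_def)

lemma wtr_ip_of_eq:
  "wtr_ip_objective (wtr_ip_of N r a T) = tr_ip_objective (tr_ip_of N r a T)"
  "wtr_ip_feasible (wtr_ip_of N r a T) = tr_ip_feasible (tr_ip_of N r a T)"
proof -
  show "wtr_ip_objective (wtr_ip_of N r a T) = tr_ip_objective (tr_ip_of N r a T)"
    by (simp add: fun_eq_iff wtr_ip_objective_def tr_ip_objective_def sum_distrib_left)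
  have "(\<Sum>i = 1..N. \<Sum>j = 1..N. 1 * of_int \<bar>d i j\<bar> :: rat) \<le> of_nat r \<longleftrightarrow>
    (\<Sum>i = 1..N. \<Sum>j = 1..N. \<bar>d i j\<bar>) \<le> int r" for d
  proof -
    have "(\<Sum>i = 1..N. \<Sum>j = 1..N. 1 * of_int \<bar>d i j\<bar> :: rat) = of_int (\<Sum>i = 1..N. \<Sum>j = 1..N. \<bar>d i j\<bar>)"
      by simp
    then show ?thesis by (metis of_int_le_iff of_int_of_nat_eq)
  qed
  then show "wtr_ip_feasible (wtr_ip_of N r a T) = tr_ip_feasible (tr_ip_of N r a T)"
    by (simp add: fun_eq_iff wtr_ip_feasible_def tr_ip_feasible_def admissible_def)
qed

lemma wtr_ip_optimal_eq:
  "wtr_ip_optimal (wtr_ip_of N r a T) = tr_ip_optimal (tr_ip_of N r a T)"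
  by (simp add: fun_eq_iff wtr_ip_optimal_def tr_ip_optimal_def wtr_ip_of_eq)

lemma tr_ip_objective_of:
  "tr_ip_objective (tr_ip_of N r a T) d = of_int (energy N (int a) T (\<lambda>x z. d (Suc x) (Suc z)))"
proof -
  have shift: "(\<Sum>i = 1..<N. f i) = (\<Sum>x<N - 1. f (Suc x))" for f :: "nat \<Rightarrow> int"
    by (cases N) (simp_all add: sum.shift_bounds_Suc_ivl lessThan_atLeast0 del: sum.op_ivl_Suc)
  have "tr_ip_objective (tr_ip_of N r a T) d = of_int (
    (\<Sum>i = 1..N. \<Sum>j = 1..N. field (int a) T (i - 1) (j - 1) * d i j) +
    int a * (\<Sum>j = 1..N. \<Sum>i = 1..<N. \<bar>d (i + 1) j - d i j\<bar>) +
    int a * (\<Sum>i = 1..N. \<Sum>j = 1..<N. \<bar>d i (j + 1) - d i j\<bar>))"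
    by (simp add: tr_ip_objective_def)
  then show ?thesis
    unfolding energy_def shift by (simp add: sum.atLeast1_atMost_eq)
qed

lemma tr_ip_feasible_of:
  "tr_ip_feasible (tr_ip_of N r a T) d \<longleftrightarrow> feasible N r (\<lambda>x z. d (Suc x) (Suc z))"
proof -
  have adm: "admissible (tr_ip_of N r a T) (\<lambda>i j. 0 + d i j) \<longleftrightarrow> binary N (\<lambda>x z. d (Suc x) (Suc z))"
  proof
    assume "admissible (tr_ip_of N r a T) (\<lambda>i j. 0 + d i j)"
    then have "d (Suc x) (Suc z) \<in> {0..1}" if "x < N" "z < N" for x z
      using that by (simp add: admissible_def)
    then have "d (Suc x) (Suc z) = 0 \<or> d (Suc x) (Suc z) = 1" if "x < N" "z < N" for x z
      using that by (metis atLeastAtMost_iff antisym_conv1 int_one_le_iff_zero_less linorder_not_less)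
    then show "binary N (\<lambda>x z. d (Suc x) (Suc z))" by (simp add: binary_def)
  next
    assume *: "binary N (\<lambda>x z. d (Suc x) (Suc z))"
    have "d i j \<in> {0..1}" if ij: "i \<in> {1..N}" "j \<in> {1..N}" for i j
    proof -
      obtain x z where "i = Suc x" "j = Suc z" "x < N" "z < N"
        using ij by (cases i; cases j) auto
      then show ?thesis using * by (force simp: binary_def)
    qed
    then show "admissible (tr_ip_of N r a T) (\<lambda>i j. 0 + d i j)" by (simp add: admissible_def)
  qed
  have "(\<Sum>i = 1..N. \<Sum>j = 1..N. \<bar>d i j\<bar>) = (\<Sum>x<N. \<Sum>z<N. d (Suc x) (Suc z))"
    if "binary N (\<lambda>x z. d (Suc x) (Suc z))"
    unfolding One_nat_def sum.atLeast1_atMost_eq using that by (intro sum.cong refl) (force simp: binary_def)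
  then show ?thesis
    using adm by (auto simp: tr_ip_feasible_def feasible_def)
qed

lemma tr_ip_optimal_of:
  assumes "tr_ip_optimal (tr_ip_of N r a T) d"
  shows "optimal N (int a) T r (\<lambda>x z. d (Suc x) (Suc z))"
proof -
  have "energy N (int a) T (\<lambda>x z. d (Suc x) (Suc z)) \<le> energy N (int a) T y'" if "feasible N r y'" for y'
  proof -
    have "tr_ip_feasible (tr_ip_of N r a T) (\<lambda>i j. y' (i - 1) (j - 1))"
      using that by (simp add: tr_ip_feasible_of)
    then have "tr_ip_objective (tr_ip_of N r a T) d \<le> tr_ip_objective (tr_ip_of N r a T) (\<lambda>i j. y' (i - 1) (j - 1))"
      using assms by (simp add: tr_ip_optimal_def)
    then show ?thesis by (simp add: tr_ip_objective_of)
  qed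
  then show ?thesis
    using assms by (simp add: optimal_def tr_ip_optimal_def tr_ip_feasible_of)
qed

definition grid_code :: "nat \<Rightarrow> nat \<Rightarrow> nat \<Rightarrow> cell set \<Rightarrow> int list" where
  "grid_code N r a T = [int N, int N, 0, 1, int r] @ replicate (N * N) 0 @
     concat (map (\<lambda>i. [field (int a) T (i div N) (i mod N), 1]) [0..<N * N])"

text \<open>The end of the codes of both problems: only the jump weight itself in the unweighted case, and two matrices of jump
weights and one of weights 1 in the weighted case.\<close>

definition weight_code :: "nat \<Rightarrow> nat \<Rightarrow> nat \<Rightarrow> int list" where
  "weight_code p q a = concat (replicate p [int a, 1]) @ concat (replicate q [1, 1])"

lemma encode_TR_IP:
  "encode TR_IP (tr_ip_of N r a T) = grid_code N r a T @ weight_code 1 0 a"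
proof -
  have "rat_codes [of_nat a] = [int a, 1]"
    using rat_codes_of_int[of "[int a]"] by simp
  moreover have "rat_codes (map (\<lambda>i. of_int (f i)) xs) = concat (map (\<lambda>i. [f i, 1]) xs)" for f :: "nat \<Rightarrow> int" and xs
    using rat_codes_of_int[of "map f xs"] by (simp add: comp_def)
  ultimately show ?thesis
    by (simp add: TR_IP_def grid_encode_def entries_Suc grid_code_def weight_code_def map_replicate_const del: upt_Suc)
qed

lemma encode_wTR_IP_2D:
  "encode wTR_IP_2D (wtr_ip_of N r a T) =
     grid_code N r a T @ weight_code ((N - 1) * N + N * (N - 1)) (N * N) a"
proof -
  have const: "rat_codes (entries is js (\<lambda>_ _. of_int c)) = concat (replicate (length is * length js) [c, 1])" for c "is" js
    unfolding entries_const using rat_codes_of_int[of "replicate (length is * length js) c"] by simp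
  moreover have rep: "rat_codes (replicate u (of_int c)) = concat (replicate u [c, 1])" for c u
    using rat_codes_of_int[of "replicate u c"] by simp
  moreover have "rat_codes (map (\<lambda>i. of_int (f i)) xs) = concat (map (\<lambda>i. [f i, 1]) xs)" for f :: "nat \<Rightarrow> int" and xs
    using rat_codes_of_int[of "map f xs"] by (simp add: comp_def)
  ultimately show ?thesis
    using const[of _ _ "int a"] const[of _ _ 1] rep[of _ "int a"] rep[of _ 1]
    by (simp add: wTR_IP_2D_def grid_encode_def entries_Suc grid_code_def weight_code_def
        map_replicate_const replicate_add del: upt_Suc)
qed

lemma size_int_le: "size_int z \<le> nat \<bar>z\<bar> + 2"
proof -
  have "floorlog 2 n \<le> n + 1" for n
  proof (cases "n = 0")
    case False
    have "n < 2 ^ n" by simp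
    then show ?thesis using floorlog_leI[of n 2 n] by simp
  qed (simp add: floorlog_def)
  then show ?thesis by (simp add: size_int_def)
qed

lemma bitsize_le:
  assumes "\<And>z. z \<in> set xs \<Longrightarrow> \<bar>z\<bar> \<le> int W"
  shows "bitsize xs \<le> length xs * (W + 2)"
proof -
  have "size_int z \<le> W + 2" if "z \<in> set xs" for z
    using size_int_le[of z] assms[OF that] by linarith
  then show ?thesis
    unfolding bitsize_def using sum_list_mono[of xs size_int "\<lambda>_. W + 2"]
    by (simp add: sum_list_triv)
qed

lemma max_abs_le: "(\<And>z. z \<in> set xs \<Longrightarrow> \<bar>z\<bar> \<le> int W) \<Longrightarrow> max_abs xs \<le> W"
  unfolding max_abs_def by (subst Max_le_iff) (auto simp: nat_le_iff)

lemma field_bound: "\<bar>field (int a) T x z\<bar> \<le> 4 * int a + 1"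
  by (auto simp: field_def algebra_simps)

lemma code_bound:
  assumes "z \<in> set (grid_code N r a T @ weight_code p q a)"
  shows "\<bar>z\<bar> \<le> int (N + r + 4 * a + 1)"
proof -
  have "z \<in> {int N, 0, 1, int r, int a} \<or> (\<exists>x y. z = field (int a) T x y)"
    using assms by (auto simp: grid_code_def weight_code_def split: if_splits)
  then show ?thesis
    using order.trans[OF field_bound[of a T], of "int (N + r + 4 * a + 1)"] by auto
qed

lemma length_code: "length (grid_code N r a T @ weight_code p q a) = 5 + 3 * (N * N) + 2 * (p + q)"
  by (simp add: grid_code_def weight_code_def length_concat comp_def sum_list_triv sum_list_replicate)

lemma bitsize_code:
  "bitsize (grid_code N r a T @ weight_code p q a) \<le> (5 + 3 * (N * N) + 2 * (p + q)) * (N + r + 4 * a + 3)"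
proof -
  have "N + r + 4 * a + 1 + 2 = N + r + 4 * a + 3" by simp
  then show ?thesis
    using bitsize_le[of "grid_code N r a T @ weight_code p q a" "N + r + 4 * a + 1"] code_bound[of _ N r a T p q]
    by (simp only: length_code)
qed

lemma TR_IP_size:
  "bitsize (encode TR_IP (tr_ip_of N r a T)) + magnitude TR_IP (tr_ip_of N r a T) \<le>
    (7 + 9 * (N * N)) * (N + r + 4 * a + 3) + (N + r + 4 * a + 1)"
proof (rule add_mono)
  have "5 + 3 * (N * N) + 2 * (1 + 0) \<le> 7 + 9 * (N * N)" by simp
  then show "bitsize (encode TR_IP (tr_ip_of N r a T)) \<le> (7 + 9 * (N * N)) * (N + r + 4 * a + 3)"
    unfolding encode_TR_IP using bitsize_code[of N r a T 1 0] mult_le_mono1 order.trans by blast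
  have "scale_to_int (of_nat a # map (\<lambda>i. of_int (f i)) xs) = int a # map f xs" for f :: "nat \<Rightarrow> int" and xs
    using scale_to_int_of_int[of "int a # map f xs"] by (simp add: comp_def)
  then show "magnitude TR_IP (tr_ip_of N r a T) \<le> N + r + 4 * a + 1"
    unfolding TR_IP_def using order.trans[OF field_bound[of a T], of "int (N + r + 4 * a + 1)"]
    by (simp add: entries_Suc del: upt_Suc) (rule max_abs_le, auto)
qed

lemma wTR_IP_2D_size:
  "bitsize (encode wTR_IP_2D (wtr_ip_of N r a T)) + magnitude wTR_IP_2D (wtr_ip_of N r a T) \<le>
    (7 + 9 * (N * N)) * (N + r + 4 * a + 3) + (N + r + 4 * a + 1)"
proof (rule add_mono)
  let ?p = "(N - 1) * N + N * (N - 1)"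
  have "N * (N - 1) \<le> N * N" by simp
  moreover have "5 + 3 * s + 2 * (x + x + s) \<le> 7 + 9 * s" if "x \<le> s" for x s :: nat
    using that by (simp add: algebra_simps)
  ultimately have "5 + 3 * (N * N) + 2 * (?p + N * N) \<le> 7 + 9 * (N * N)"
    unfolding mult.commute[of "N - 1" N] by blast
  then show "bitsize (encode wTR_IP_2D (wtr_ip_of N r a T)) \<le> (7 + 9 * (N * N)) * (N + r + 4 * a + 3)"
    unfolding encode_wTR_IP_2D using bitsize_code[of N r a T ?p "N * N"] mult_le_mono1 order.trans by blast
  have 1: "scale_to_int (map (\<lambda>i. of_int (f i)) xs @ replicate u (of_nat a) @ replicate v (of_nat a)) =
    map f xs @ replicate u (int a) @ replicate v (int a)" for f :: "nat \<Rightarrow> int" and xs u v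
    using scale_to_int_of_int[of "map f xs @ replicate u (int a) @ replicate v (int a)"] by (simp add: comp_def)
  have 2: "scale_to_int (of_nat r # map (\<lambda>_. 1) xs) = int r # map (\<lambda>_. 1) xs" for xs :: "nat list"
    using scale_to_int_of_int[of "int r # map (\<lambda>_. 1) xs"] by (simp add: comp_def)
  show "magnitude wTR_IP_2D (wtr_ip_of N r a T) \<le> N + r + 4 * a + 1"
    unfolding wTR_IP_2D_def using order.trans[OF field_bound[of a T], of "int (N + r + 4 * a + 1)"]
    by (simp add: entries_const entries_Suc 1 2 del: upt_Suc) (rule max_abs_le, auto split: if_splits)
qed

lemma TR_IP_instance: "a > 0 \<Longrightarrow> tr_ip_of N r a T \<in> instances TR_IP"
  by (simp add: TR_IP_def tr_ip_instance_def admissible_def)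

lemma wTR_IP_2D_instance: "wtr_ip_of N r a T \<in> instances wTR_IP_2D"
  by (simp add: wTR_IP_2D_def wtr_ip_instance_def admissible_def)

lemma TR_IP_solutions:
  assumes "zs \<in> solutions TR_IP (tr_ip_of N r a T)"
  shows "\<exists>y. optimal N (int a) T r y \<and> zs = map (\<lambda>i. y (i div N) (i mod N)) [0..<N * N]"
  using assms tr_ip_optimal_of by (fastforce simp: TR_IP_def entries_Suc simp del: upt_Suc)

lemma wTR_IP_2D_solutions:
  assumes "zs \<in> solutions wTR_IP_2D (wtr_ip_of N r a T)"
  shows "\<exists>y. optimal N (int a) T r y \<and> zs = map (\<lambda>i. y (i div N) (i mod N)) [0..<N * N]"
  using assms tr_ip_optimal_of by (fastforce simp: wTR_IP_2D_def wtr_ip_optimal_eq entries_Suc simp del: upt_Suc)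

section \<open>Program fragments\<close>

text \<open>The rule for a call of a fragment whose final state is known exactly. The fragments reset their scratch registers
for this reason.\<close>

lemma wp_exact:
  assumes "wp M (\<lambda>t s'. t \<le> B \<and> s' = s1) s0" "s = s0" "\<And>t. t \<le> B \<Longrightarrow> Q t s1"
  shows "wp M Q s"
  unfolding assms(2) using assms(1) by (rule wp_mono) (use assms(3) in auto)

lemma fetch_nth [simp]: "i < length xs \<Longrightarrow> fetch xs (int i) = xs ! i"
  by (simp add: fetch_def nth_default_nth)

text \<open>Conventions of all fragments: register 0 contains 0, register 2 contains 1, and this loop counts the register \<open>c\<close> down to 0.\<close>

definition repeat :: "nat \<Rightarrow> cmd \<Rightarrow> cmd" where
  "repeat c M = While c (Seq M (Sub c c 2))"

abbreviation loop_round :: "nat \<Rightarrow> nat \<Rightarrow> (nat \<Rightarrow> int) \<Rightarrow> (state \<Rightarrow> bool) \<Rightarrow> nat \<Rightarrow> state \<Rightarrow> bool" where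
  "loop_round c T R J \<equiv> \<lambda>t (R', A'). t \<le> T \<and> R' c = R c \<and> R' 2 = 1 \<and> J (R'(c := R' c - 1), A')"

lemma wp_repeat:
  assumes "R c = int n" "I 0 (R, A)"
    and I: "\<And>k R A. I k (R, A) \<Longrightarrow> k \<le> n \<Longrightarrow> R c = int (n - k) \<and> R 2 = 1"
    and step: "\<And>k R A. k < n \<Longrightarrow> I k (R, A) \<Longrightarrow>
      wp M (loop_round c T R (I (Suc k))) (R, A)"
  shows "wp (repeat c M) (\<lambda>t s. t \<le> n * (T + 2) + 1 \<and> I n s) (R, A)"
proof -
  have "wp (While c (Seq M (Sub c c 2))) (\<lambda>t s'. t \<le> n * (Suc T + 1) + 1 \<and> I n s') (R, A)"
  proof (rule wp_While[where I = I])
    show "R c > 0 \<and> wp (Seq M (Sub c c 2)) (\<lambda>t s'. t \<le> Suc T \<and> I (Suc k) s') (R, A)"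
      if k: "k < n" "I k (R, A)" for k R A
    proof -
    have "wp (Seq M (Sub c c 2)) (\<lambda>t s'. t \<le> Suc T \<and> I (Suc k) s') (R, A)"
      unfolding wp_Seq by (rule wp_mono[OF step[OF k]]) auto
    then show ?thesis using I[OF k(2)] k(1) by simp
    qed
    show "R c \<le> 0" if "I n (R, A)" for R A
      using I[OF that] by simp
  qed (use assms(2) in simp_all)
  then show ?thesis by (simp add: repeat_def)
qed

text \<open>Ends with a reset of the scratch register 23, so that the empty sequence is a command, too.\<close>

primrec seq :: "cmd list \<Rightarrow> cmd" where
  "seq [] = Const 23 0"
| "seq (M # Ms) = Seq M (seq Ms)"

lemma wp_seq [simp]:
  "wp (seq []) Q (R, A) \<longleftrightarrow> Q 1 (R(23 := 0), A)"
  "wp (seq (M # Ms)) Q s \<longleftrightarrow> wp M (\<lambda>t. wp (seq Ms) (\<lambda>t'. Q (t + t'))) s"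
  by simp_all

declare seq.simps [simp del]

definition clear :: "nat list \<Rightarrow> cmd" where
  "clear rs = seq (map (\<lambda>r. Const r 0) rs)"

lemma wp_clear [simp]:
  "wp (clear []) Q (R, A) \<longleftrightarrow> Q 1 (R(23 := 0), A)"
  "wp (clear (r # rs)) Q (R, A) \<longleftrightarrow> wp (clear rs) (\<lambda>t. Q (Suc t)) (R(r := 0), A)"
  by (simp_all add: clear_def)

definition multiply :: "nat \<Rightarrow> nat \<Rightarrow> nat \<Rightarrow> cmd" where
  "multiply r p q = Seq (Const r 0) (Seq (Add 22 q 0) (repeat 22 (Add r r p)))"

lemma wp_multiply:
  assumes "R 0 = 0" "R 2 = 1" "R q = int m" "r \<notin> {0, 2, 22, p, q}" "p \<noteq> 22" "q \<noteq> 22"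
  shows "wp (multiply r p q) (\<lambda>t s. t \<le> m * 3 + 3 \<and> s = (R(r := R p * R q, 22 := 0), A)) (R, A)"
proof -
  let ?I = "\<lambda>k (R', A'). R' = R(r := R p * int k, 22 := int (m - k)) \<and> A' = A"
  have "wp (repeat 22 (Add r r p)) (\<lambda>t s. t \<le> m * (1 + 2) + 1 \<and> ?I m s) (R(r := 0, 22 := int m), A)"
    by (rule wp_repeat[where I = ?I]) (use assms in \<open>auto simp: fun_eq_iff algebra_simps\<close>)
  then show ?thesis
    unfolding multiply_def using assms by (auto elim!: wp_mono simp: fun_upd_twist)
qed

definition insert_new :: "int list \<Rightarrow> int \<Rightarrow> int list" where
  "insert_new xs v = (if v \<in> set xs then xs else xs @ [v])"

definition compare_entry :: "nat \<Rightarrow> cmd" where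
  "compare_entry D = seq [Sub 23 22 2, Get 25 D 23, Sub 26 25 27,
     Cond 26 (seq []) (seq [Sub 26 27 25, Cond 26 (seq []) (Const 24 0)]), clear [25, 26]]"

text \<open>Appends register 27 to the array \<open>D\<close> unless it occurs there. Register 24 is the flag for absence.\<close>

definition insert_array :: "nat \<Rightarrow> cmd" where
  "insert_array D = seq [clear [25, 26], Const 24 1, Len 22 D, repeat 22 (compare_entry D),
     Cond 24 (Push D 27) (seq []), Const 24 0]"

lemma fetch_from_end:
  assumes "k < length xs"
  shows "fetch xs (int (length xs) - int k - 1) = xs ! (length xs - Suc k)"
proof -
  have "int (length xs) - int k - 1 = int (length xs - Suc k)" using assms by simp
  then show ?thesis using assms by (simp only:) (rule fetch_nth, simp)
qed

lemma drop_nth_Cons: "k < length xs \<Longrightarrow> drop (length xs - Suc k) xs = xs ! (length xs - Suc k) # drop (length xs - k) xs"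
  using Cons_nth_drop_Suc[of "length xs - Suc k" xs] by (simp add: Suc_diff_Suc)

lemma wp_insert_array:
  assumes "R 0 = 0" "R 2 = 1"
  shows "wp (insert_array D) (\<lambda>t s. t \<le> length (A D) * 14 + 10 \<and>
    s = (R(22 := 0, 23 := 0, 24 := 0, 25 := 0, 26 := 0), A(D := insert_new (A D) (R 27)))) (R, A)"
proof -
  let ?xs = "A D"
  let ?I = "\<lambda>k s. s = (R(22 := int (length ?xs - k), 23 := 0,
    24 := of_bool (R 27 \<notin> set (drop (length ?xs - k) ?xs)), 25 := 0, 26 := 0), A)"
  have "wp (repeat 22 (compare_entry D))
     (\<lambda>t s. t \<le> length ?xs * (12 + 2) + 1 \<and> ?I (length ?xs) s)
     (R(22 := int (length ?xs), 23 := 0, 24 := 1, 25 := 0, 26 := 0), A)"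
  proof (rule wp_repeat[where I = ?I])
    fix k R' A' assume k: "k < length ?xs" "?I k (R', A')"
    show "wp (compare_entry D)
      (loop_round 22 12 R' (?I (Suc k))) (R', A')"
      using k assms unfolding compare_entry_def by (elim Pair_inject) (hypsubst, auto simp: drop_nth_Cons fetch_from_end fun_eq_iff of_bool_def)
  qed (use assms in \<open>auto simp: fun_eq_iff\<close>)
  note loop = this
  show ?thesis
    unfolding insert_array_def using assms
    by simp (rule wp_exact[OF loop], auto simp: insert_new_def fun_eq_iff)
qed

definition count_entry :: "nat \<Rightarrow> cmd" where
  "count_entry D = seq [Sub 23 22 2, Get 25 D 23, Sub 26 27 25,
     Cond 26 (Add 20 20 24) (seq []), clear [25, 26]]"

text \<open>Adds register 24 to register 20 for every entry of \<open>D\<close> below register 27. Multiples of a rank are computed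
without a multiplication this way.\<close>

definition add_rank :: "nat \<Rightarrow> cmd" where
  "add_rank D = seq [clear [25, 26], Len 22 D, repeat 22 (count_entry D)]"

lemma wp_add_rank:
  assumes "R 0 = 0" "R 2 = 1"
  shows "wp (add_rank D) (\<lambda>t s. t \<le> length (A D) * 11 + 7 \<and>
    s = (R(20 := R 20 + int (length (filter (\<lambda>v. v < R 27) (A D))) * R 24, 22 := 0, 23 := 0, 25 := 0, 26 := 0), A)) (R, A)"
proof -
  let ?xs = "A D"
  let ?I = "\<lambda>k s. s = (R(20 := R 20 + int (length (filter (\<lambda>v. v < R 27) (drop (length ?xs - k) ?xs))) * R 24,
    22 := int (length ?xs - k), 23 := 0, 25 := 0, 26 := 0), A)"
  have "wp (repeat 22 (count_entry D))
     (\<lambda>t s. t \<le> length ?xs * (9 + 2) + 1 \<and> ?I (length ?xs) s)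
     (R(22 := int (length ?xs), 23 := 0, 25 := 0, 26 := 0), A)"
  proof (rule wp_repeat[where I = ?I])
    fix k R' A' assume k: "k < length ?xs" "?I k (R', A')"
    show "wp (count_entry D)
      (loop_round 22 9 R' (?I (Suc k))) (R', A')"
      using k assms unfolding count_entry_def by (elim Pair_inject) (hypsubst, auto simp: drop_nth_Cons fetch_from_end fun_eq_iff distrib_right)
  qed (use assms in \<open>auto simp: fun_eq_iff\<close>)
  note loop = this
  show ?thesis
    unfolding add_rank_def using assms
    by simp (rule wp_exact[OF loop], auto simp: fun_eq_iff)
qed

text \<open>The picture as an array of length \<open>m\<close>: the jump weight \<open>a\<close> at the indices in \<open>Z\<close>, and 0 elsewhere. Storing \<open>a\<close>
instead of 1 saves multiplications when costs are computed. Indices out of range have no effect.\<close>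

definition marked :: "nat \<Rightarrow> int \<Rightarrow> int set \<Rightarrow> int list" where
  "marked m a Z = map (\<lambda>i. if int i \<in> Z then a else 0) [0..<m]"

lemma store_marked [simp]: "store (marked m a Z) i a = marked m a (insert i Z)"
  by (rule nth_equalityI) (auto simp: store_def marked_def nth_list_update)

text \<open>Registers: 5 jump weight, 6 block side, 13 grid side minus block side, 20 current index; array 4 is the picture.\<close>

definition fill_row :: cmd where
  "fill_row = seq [Add 24 6 0, repeat 24 (seq [Put 4 5 20, Add 20 20 2]), Add 20 20 13]"

definition fill_block :: cmd where
  "fill_block = seq [clear [24], Add 22 6 0, repeat 22 fill_row]"

lemma insert_ivl: "b \<le> c \<Longrightarrow> insert c {b..<c} = {b..<c + 1}" for b c :: int
  by auto

lemma wp_fill_row: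
  assumes "R 0 = 0" "R 2 = 1" "R 23 = 0" "R 6 = int L" "A 4 = marked m (R 5) Z"
  shows "wp fill_row (\<lambda>t s. t \<le> L * 5 + 4 \<and>
    s = (R(20 := R 20 + int L + R 13, 23 := 0, 24 := 0), A(4 := marked m (R 5) (Z \<union> {R 20..<R 20 + int L})))) (R, A)"
proof -
  let ?I = "\<lambda>k s. s = (R(20 := R 20 + int k, 23 := 0, 24 := int (L - k)),
    A(4 := marked m (R 5) (Z \<union> {R 20..<R 20 + int k})))"
  have loop: "wp (repeat 24 (seq [Put 4 5 20, Add 20 20 2])) (\<lambda>t s. t \<le> L * (3 + 2) + 1 \<and> ?I L s)
    (R(23 := 0, 24 := int L), A)"
  proof (rule wp_repeat[where I = ?I])
    fix k R' A' assume k: "k < L" "?I k (R', A')"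
    show "wp (seq [Put 4 5 20, Add 20 20 2])
      (loop_round 24 3 R' (?I (Suc k))) (R', A')"
      using k assms insert_ivl[of "R 20" "R 20 + int k"]
      by (elim Pair_inject) (hypsubst, auto simp: fun_eq_iff add_ac Un_insert_right[symmetric] simp del: Un_insert_right)
  qed (use assms in \<open>auto simp: fun_eq_iff\<close>)
  show ?thesis
    unfolding fill_row_def using assms
    by simp (rule wp_exact[OF loop], auto simp: fun_eq_iff)
qed

lemmas call_fill_row = wp_exact[OF wp_fill_row refl]

lemma wp_fill_block:
  assumes "R 0 = 0" "R 2 = 1" "R 6 = int L" "R 13 = N - int L" "A 4 = marked m (R 5) Z"
  shows "wp fill_block (\<lambda>t s. t \<le> L * (L * 5 + 6) + 5 \<and>
    s = (R(20 := R 20 + int L * N, 22 := 0, 23 := 0, 24 := 0),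
      A(4 := marked m (R 5) (Z \<union> (\<Union>p<L. {R 20 + int p * N..<R 20 + int p * N + int L}))))) (R, A)"
proof -
  let ?I = "\<lambda>k s. s = (R(20 := R 20 + int k * N, 22 := int (L - k), 23 := 0, 24 := 0),
    A(4 := marked m (R 5) (Z \<union> (\<Union>p<k. {R 20 + int p * N..<R 20 + int p * N + int L}))))"
  have loop: "wp (repeat 22 fill_row) (\<lambda>t s. t \<le> L * ((L * 5 + 4) + 2) + 1 \<and> ?I L s)
    (R(22 := int L, 23 := 0, 24 := 0), A)"
  proof (rule wp_repeat[where I = ?I])
    fix k R' A' assume k: "k < L" "?I k (R', A')"
    show "wp fill_row
      (loop_round 22 (L * 5 + 4) R' (?I (Suc k))) (R', A')"
      using k(2)
    proof (elim Pair_inject, hypsubst, intro call_fill_row[where L = L and m = m])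
    qed (use assms k(1) in \<open>auto simp: fun_eq_iff lessThan_Suc Un_ac algebra_simps\<close>)
  qed (use assms in \<open>auto simp: fun_eq_iff\<close>)
  show ?thesis
    unfolding fill_block_def using assms
    by simp (rule wp_exact[OF loop], auto simp: fun_eq_iff algebra_simps)
qed

lemmas call_fill_block = wp_exact[OF wp_fill_block refl]
lemmas call_add_rank = wp_exact[OF wp_add_rank refl]
lemmas call_insert_array = wp_exact[OF wp_insert_array refl]
lemmas call_multiply = wp_exact[OF wp_multiply refl]

definition count_less :: "int list \<Rightarrow> int \<Rightarrow> int" where
  "count_less xs v = int (length (filter (\<lambda>u. u < v) xs))"

text \<open>The index of the first cell of the block of the vertex with coordinates in registers \<open>x\<close> and \<open>y\<close>. Arrays 2 and
3 contain the occurring coordinates; registers 7, 8, 9 contain \<open>L + 1\<close>, the grid side \<open>N\<close> and \<open>(L + 1) N\<close>.\<close>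

definition base :: "nat \<Rightarrow> nat \<Rightarrow> cmd" where
  "base x y = seq [Add 20 8 2, Add 27 x 0, Add 24 9 0, add_rank 2, Add 27 y 0, Add 24 7 0, add_rank 3,
     clear [24, 27]]"

lemma wp_base:
  assumes "R 0 = 0" "R 2 = 1" "x \<notin> {20, 22, 23, 24, 25, 26, 27}" "y \<notin> {20, 22, 23, 24, 25, 26, 27}"
  shows "wp (base x y) (\<lambda>t s. t \<le> (length (A 2) + length (A 3)) * 11 + 23 \<and>
    s = (R(20 := R 8 + 1 + count_less (A 2) (R x) * R 9 + count_less (A 3) (R y) * R 7,
      22 := 0, 23 := 0, 24 := 0, 25 := 0, 26 := 0, 27 := 0), A)) (R, A)"
  unfolding base_def using assms
  by (auto intro!: call_add_rank simp: fun_eq_iff count_less_def)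

lemmas call_base = wp_exact[OF wp_base refl]


section \<open>Drawing the graph on the grid\<close>

definition code :: "nat \<Rightarrow> point list \<Rightarrow> (point \<times> point) list \<Rightarrow> int list" where
  "code k vs es = int k # int (length vs) # concat (map (\<lambda>(a, b). [a, b]) vs) @
     int (length es) # concat (map (\<lambda>((a, b), (c, d)). [a, b, c, d]) es)"

lemma concat_nth_blocks:
  assumes "\<And>x. length (f x) = l" "i < length xs" "c < l"
  shows "concat (map f xs) ! (i * l + c) = f (xs ! i) ! c"
  using assms(2)
proof (induction xs arbitrary: i)
  case (Cons x xs)
  then show ?case using assms(1,3) by (cases i) (auto simp: nth_append add.assoc)
qed simp

lemma length_concat_blocks: "(\<And>x. length (f x) = l) \<Longrightarrow> length (concat (map f xs)) = length xs * l"
  by (induction xs) auto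

lemma fetch_vertex:
  assumes "i < length vs" "W = code k vs es"
  shows "j = 2 + 2 * int i \<Longrightarrow> fetch W j = fst (vs ! i)"
    and "j = 3 + 2 * int i \<Longrightarrow> fetch W j = snd (vs ! i)"
proof -
  let ?f = "\<lambda>(a, b). [a, b] :: int list"
  have l: "length (?f x) = 2" for x by (cases x) simp
  have nth: "fetch W (2 + 2 * int i + int c) = ?f (vs ! i) ! c" if "c < 2" for c
  proof -
    have "i * 2 + c < length vs * 2" using assms(1) that by linarith
    then have "W ! (2 + (i * 2 + c)) = ?f (vs ! i) ! c" "2 + (i * 2 + c) < length W"
      using concat_nth_blocks[of ?f 2 i vs c, OF l assms(1) that] length_concat_blocks[of ?f 2 vs, OF l]
      by (auto simp: assms(2) code_def nth_append)
    moreover have "2 + 2 * int i + int c = int (2 + (i * 2 + c))" by simp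
    ultimately show ?thesis by (simp only: fetch_nth)
  qed
  show "j = 2 + 2 * int i \<Longrightarrow> fetch W j = fst (vs ! i)" using nth[of 0] by (simp split: prod.splits)
  show "j = 3 + 2 * int i \<Longrightarrow> fetch W j = snd (vs ! i)" using nth[of 1] by (auto split: prod.splits)
qed

lemma fetch_edge_count:
  assumes "W = code k vs es"
  shows "j = 2 + 2 * int (length vs) \<Longrightarrow> fetch W j = int (length es)"
proof -
  let ?f = "\<lambda>(a, b). [a, b] :: int list"
  have l: "length (?f x) = 2" for x by (cases x) simp
  have "W ! (2 + length vs * 2) = int (length es)" "2 + length vs * 2 < length W"
    using length_concat_blocks[of ?f 2 vs, OF l] by (auto simp: assms code_def nth_append)
  moreover have "2 + 2 * int (length vs) = int (2 + length vs * 2)" by simp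
  ultimately show "j = 2 + 2 * int (length vs) \<Longrightarrow> fetch W j = int (length es)" by (simp only: fetch_nth)
qed

lemma fetch_edge:
  assumes "i < length es" "W = code k vs es"
  shows "j = 3 + 2 * int (length vs) + 4 * int i \<Longrightarrow> fetch W j = fst (fst (es ! i))"
    and "j = 4 + 2 * int (length vs) + 4 * int i \<Longrightarrow> fetch W j = snd (fst (es ! i))"
    and "j = 5 + 2 * int (length vs) + 4 * int i \<Longrightarrow> fetch W j = fst (snd (es ! i))"
    and "j = 6 + 2 * int (length vs) + 4 * int i \<Longrightarrow> fetch W j = snd (snd (es ! i))"
proof -
  let ?f = "\<lambda>(a, b). [a, b] :: int list" and ?g = "\<lambda>((a, b), (c, d)). [a, b, c, d] :: int list"
  have l: "length (?f x) = 2" for x by (cases x) simp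
  have l': "length (?g x) = 4" for x by (auto split: prod.splits)
  have nth: "fetch W (3 + 2 * int (length vs) + 4 * int i + int c) = ?g (es ! i) ! c" if "c < 4" for c
  proof -
    have "i * 4 + c < length es * 4" using assms(1) that by linarith
    then have "W ! (3 + length vs * 2 + (i * 4 + c)) = ?g (es ! i) ! c" "3 + length vs * 2 + (i * 4 + c) < length W"
      using concat_nth_blocks[of ?g 4 i es c, OF l' assms(1) that] length_concat_blocks[of ?f 2 vs, OF l]
        length_concat_blocks[of ?g 4 es, OF l']
      by (auto simp: assms(2) code_def nth_append)
    moreover have "3 + 2 * int (length vs) + 4 * int i + int c = int (3 + length vs * 2 + (i * 4 + c))" by simp
    ultimately show ?thesis by (simp only: fetch_nth)
  qed
  show "j = 3 + 2 * int (length vs) + 4 * int i \<Longrightarrow> fetch W j = fst (fst (es ! i))"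
    using nth[of 0] by (simp split: prod.splits)
  show "j = 4 + 2 * int (length vs) + 4 * int i \<Longrightarrow> fetch W j = snd (fst (es ! i))"
    using nth[of 1] by (simp add: add.commute add.left_commute split: prod.splits)
  show "j = 5 + 2 * int (length vs) + 4 * int i \<Longrightarrow> fetch W j = fst (snd (es ! i))"
    using nth[of 2] by (simp add: add.commute add.left_commute split: prod.splits)
  show "j = 6 + 2 * int (length vs) + 4 * int i \<Longrightarrow> fetch W j = snd (snd (es ! i))"
    using nth[of 3] by (simp add: add.commute add.left_commute split: prod.splits)
qed

lemma fetch_code: "fetch (code k vs es) 0 = int k" "fetch (code k vs es) 1 = int (length vs)"
  by (simp_all add: fetch_def code_def)

definition distinct_list :: "int list \<Rightarrow> int list" where
  "distinct_list xs = foldl insert_new [] xs"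

lemma distinct_list_simps [simp]:
  "distinct_list [] = []" "distinct_list (xs @ [x]) = insert_new (distinct_list xs) x"
  by (simp_all add: distinct_list_def)

lemma distinct_list: "distinct (distinct_list xs) \<and> set (distinct_list xs) = set xs \<and> length (distinct_list xs) \<le> length xs"
  by (induction xs rule: rev_induct) (auto simp: insert_new_def)

text \<open>Array 100 contains the code of the graph after the bound \<open>k\<close>; register 15 is the reading position.\<close>

definition collect_step :: cmd where
  "collect_step = seq [Add 15 15 2, Get 27 100 15, insert_array 2, Add 15 15 2, Get 27 100 15, insert_array 3,
     Const 27 0]"

definition collect :: cmd where
  "collect = seq [Const 2 1, Get 31 100 0, Add 15 2 0, Get 3 100 15, clear [22, 24, 25, 26, 27], Add 14 3 0,
     repeat 14 collect_step]"

lemma wp_collect: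
  assumes "R 0 = 0" "A 100 = code k vs es" "A 2 = []" "A 3 = []"
  defines "n \<equiv> length vs"
  shows "wp collect (\<lambda>t s. t \<le> n * (n * 28 + 30) + 13 \<and>
    s = (R(2 := 1, 3 := int n, 14 := 0, 15 := 1 + 2 * int n, 22 := 0, 23 := 0, 24 := 0, 25 := 0, 26 := 0, 27 := 0, 31 := int k),
      A(2 := distinct_list (map fst vs), 3 := distinct_list (map snd vs)))) (R, A)"
proof -
  let ?I = "\<lambda>j s. s = (R(2 := 1, 3 := int n, 14 := int (n - j), 15 := 1 + 2 * int j, 22 := 0, 23 := 0, 24 := 0,
      25 := 0, 26 := 0, 27 := 0, 31 := int k),
      A(2 := distinct_list (map fst (take j vs)), 3 := distinct_list (map snd (take j vs))))"
  have loop: "wp (repeat 14 collect_step) (\<lambda>t s. t \<le> n * ((n * 28 + 28) + 2) + 1 \<and> ?I n s)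
    (R(2 := 1, 3 := int n, 14 := int n, 15 := 1, 22 := 0, 23 := 0, 24 := 0, 25 := 0, 26 := 0, 27 := 0, 31 := int k), A)"
  proof (rule wp_repeat[where I = ?I])
    fix j R' A' assume j: "j < n" "?I j (R', A')"
    have j': "j < length vs" using j by (simp add: n_def)
    have len: "length (distinct_list (map f (take j vs))) \<le> n" for f :: "point \<Rightarrow> int"
      using distinct_list[of "map f (take j vs)"] by (simp add: n_def)
    note f = fetch_vertex[OF j' assms(2)]
    show "wp collect_step (loop_round 14 (n * 28 + 28) R' (?I (Suc j))) (R', A')"
      unfolding collect_step_def using j(2)
      by (elim Pair_inject, hypsubst)
        (use j(1) len[of fst] len[of snd] assms(1) in
         \<open>auto intro!: call_insert_array simp: fun_eq_iff f take_Suc_conv_app_nth[OF j'] fun_upd_def\<close>)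
  qed (use assms in \<open>auto simp: fun_eq_iff\<close>)
  show ?thesis
    unfolding collect_def using assms(1-4)
    by (simp add: fetch_code n_def[symmetric])
      (rule wp_exact[OF loop], auto simp: fun_eq_iff n_def algebra_simps)
qed

text \<open>Decreasing \<open>n\<close> by 2 takes \<open>\<lceil>n / 2\<rceil>\<close> rounds, and each of them adds the size of a block to the radius.\<close>

definition half_loop :: cmd where
  "half_loop = While 14 (seq [Add 12 12 11, Sub 14 14 2, Sub 14 14 2])"

lemma wp_half_loop:
  assumes "R 2 = 1" "R 14 = int n" "R 23 = 0"
  shows "wp half_loop (\<lambda>t s. t \<le> (n + 1) div 2 * 5 + 1 \<and>
    s = (R(12 := R 12 + int ((n + 1) div 2) * R 11, 14 := int n - 2 * int ((n + 1) div 2)), A)) (R, A)"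
proof -
  let ?I = "\<lambda>i s. s = (R(12 := R 12 + int i * R 11, 14 := int n - 2 * int i), A)"
  have "wp half_loop (\<lambda>t s. t \<le> (n + 1) div 2 * (4 + 1) + 1 \<and> ?I ((n + 1) div 2) s) (R, A)"
    unfolding half_loop_def
  proof (rule wp_While[where I = ?I])
    show "0 < R' 14 \<and> wp (seq [Add 12 12 11, Sub 14 14 2, Sub 14 14 2]) (\<lambda>t s'. t \<le> 4 \<and> ?I (Suc i) s') (R', A')"
      if i: "i < (n + 1) div 2" "?I i (R', A')" for i R' A'
    proof -
      have "int n - 2 * int i > 0" using i(1) by linarith
      then show ?thesis
        using i(2) by (elim Pair_inject) (hypsubst, use assms in \<open>auto simp: fun_eq_iff algebra_simps\<close>)
    qed
    show "R' 14 \<le> 0" if i: "?I ((n + 1) div 2) (R', A')" for R' A'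
    proof -
      have "int n - 2 * int ((n + 1) div 2) \<le> 0" by linarith
      then show ?thesis using i by simp
    qed
  qed (use assms in \<open>auto simp: fun_eq_iff\<close>)
  then show ?thesis by simp
qed

lemmas call_half_loop = wp_exact[OF wp_half_loop refl]

text \<open>Registers: 4 number \<open>e\<close> of edges, 5 jump weight, 6 block side \<open>L\<close>, 7 \<open>L + 1\<close>, 8 grid side \<open>N\<close>, 9 \<open>(L + 1) N\<close>,
10 \<open>N\<^sup>2\<close>, 11 \<open>L\<^sup>2\<close>, 12 radius, 13 \<open>N - L\<close>.\<close>

definition sizes :: cmd where
  "sizes = seq [Add 15 15 2, Get 4 100 15, Add 5 4 2, Add 6 5 5, Add 7 6 2, multiply 8 3 7, Add 8 8 2,
     multiply 9 7 8, multiply 10 8 8, multiply 11 6 6, Sub 13 8 6, Add 12 4 0, Add 14 3 0, clear [], half_loop, Const 14 0]"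

lemma wp_sizes:
  fixes n :: nat
  assumes "R 0 = 0" "R 2 = 1" "R 3 = int (length vs)" "R 15 = 1 + 2 * int (length vs)" "A 100 = code k vs es"
  defines "n \<equiv> length vs" and "e \<equiv> length es"
  defines "L \<equiv> 2 * (e + 1)"
  defines "N \<equiv> n * Suc L + 1"
  shows "wp sizes (\<lambda>t s. t \<le> (Suc L + N + N + L) * 3 + (n + 1) * 5 + 40 \<and>
    s = (R(4 := int e, 5 := int (e + 1), 6 := int L, 7 := int (Suc L), 8 := int N, 9 := int (Suc L * N),
      10 := int (N * N), 11 := int (L * L), 12 := int (L * L * ((n + 1) div 2) + e), 13 := int N - int L, 14 := 0,
      15 := 2 + 2 * int n, 22 := 0, 23 := 0), A)) (R, A)"
proof -
  note f = fetch_edge_count[OF assms(5)]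
  have L: "int L = 2 * int e + 2" by (simp add: L_def)
  have N: "int n * (3 + 2 * int e) + 1 = int N" by (simp add: N_def L_def algebra_simps)
  have n: "int (length vs) = int n" by (simp add: n_def)
  have h: "(n + 1) div 2 * 5 \<le> (n + 1) * 5" by simp
  show ?thesis
    unfolding sizes_def
    apply (simp add: assms(1-4) f n e_def[symmetric])
    apply (rule call_multiply[where m = "Suc L"]; simp add: assms(1-4) n N L)
    apply (rule call_multiply[where m = N]; simp add: assms(1-4) n N)
    apply (rule call_multiply[where m = N]; simp add: assms(1-4) n N)
    apply (rule call_multiply[where m = L]; simp add: assms(1-4) n N L)
    apply (rule call_half_loop[where n = n]; simp add: assms(1-4) n N)
    apply (use h in \<open>auto simp: fun_eq_iff algebra_simps L\<close>)
    done
qed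

definition fresh_cells :: cmd where
  "fresh_cells = Seq (Add 22 10 0) (repeat 22 (Push 4 0))"

lemma wp_fresh_cells:
  assumes "R 0 = 0" "R 2 = 1" "R 10 = int m" "A 4 = []"
  shows "wp fresh_cells (\<lambda>t s. t \<le> m * 3 + 2 \<and> s = (R(22 := 0), A(4 := marked m a {}))) (R, A)"
proof -
  let ?I = "\<lambda>j s. s = (R(22 := int (m - j)), A(4 := replicate j 0))"
  have loop: "wp (repeat 22 (Push 4 0)) (\<lambda>t s. t \<le> m * (1 + 2) + 1 \<and> ?I m s) (R(22 := int m), A)"
    by (rule wp_repeat[where I = ?I]) (use assms in \<open>auto simp: fun_eq_iff replicate_append_same\<close>)
  show ?thesis
    unfolding fresh_cells_def using assms
    by simp (rule wp_exact[OF loop], auto simp: fun_eq_iff marked_def map_replicate_const)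
qed

lemmas call_collect = wp_exact[OF wp_collect refl]
lemmas call_sizes = wp_exact[OF wp_sizes refl]
lemmas call_fresh_cells = wp_exact[OF wp_fresh_cells refl]

text \<open>Row-major index of the first cell of the block of \<open>v\<close>.\<close>

definition address :: "int \<Rightarrow> int \<Rightarrow> int \<Rightarrow> int list \<Rightarrow> int list \<Rightarrow> point \<Rightarrow> int" where
  "address N sN s xs ys v = N + 1 + count_less xs (fst v) * sN + count_less ys (snd v) * s"

definition block_indices :: "int \<Rightarrow> nat \<Rightarrow> int \<Rightarrow> int set" where
  "block_indices N L b = (\<Union>p<L. {b + int p * N..<b + int p * N + int L})"

text \<open>The bridge precedes the later one of the two blocks by one row if the blocks are in the same column, and by one column
otherwise. The distance of the addresses distinguishes the cases: it is \<open>s = L + 1\<close> in the same row and \<open>s N\<close> in the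
same column.\<close>

definition bridge_index :: "int \<Rightarrow> int \<Rightarrow> int \<Rightarrow> int \<Rightarrow> int" where
  "bridge_index N s b c = max b c - (if \<bar>b - c\<bar> > s then N else 1)"

definition draw_vertex :: cmd where
  "draw_vertex = seq [Add 15 15 2, Get 16 100 15, Add 15 15 2, Get 17 100 15, base 16 17, fill_block, clear [16, 17, 20]]"

definition draw_vertices :: cmd where
  "draw_vertices = seq [clear [16, 17, 20, 22, 24, 25, 26, 27], Add 15 2 0, Add 14 3 0, repeat 14 draw_vertex]"

lemma wp_draw_vertices:
  assumes "R 0 = 0" "R 2 = 1" "R 3 = int (length vs)" "R 6 = int L" "R 13 = R 8 - int L"
    "A 100 = code k vs es" "A 4 = marked m (R 5) {}"
  defines "n \<equiv> length vs" and "b \<equiv> address (R 8) (R 9) (R 7) (A 2) (A 3)"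
  shows "wp draw_vertices (\<lambda>t s. t \<le> n * ((length (A 2) + length (A 3)) * 11 + L * (L * 5 + 6) + 40) + 14 \<and>
    s = (R(14 := 0, 15 := 1 + 2 * int n, 16 := 0, 17 := 0, 20 := 0, 22 := 0, 23 := 0, 24 := 0, 25 := 0, 26 := 0, 27 := 0),
      A(4 := marked m (R 5) (\<Union>v\<in>set vs. block_indices (R 8) L (b v))))) (R, A)"
proof -
  let ?I = "\<lambda>j s. s = (R(14 := int (n - j), 15 := 1 + 2 * int j, 16 := 0, 17 := 0, 20 := 0, 22 := 0, 23 := 0, 24 := 0,
      25 := 0, 26 := 0, 27 := 0), A(4 := marked m (R 5) (\<Union>v\<in>set (take j vs). block_indices (R 8) L (b v))))"
  let ?T = "(length (A 2) + length (A 3)) * 11 + L * (L * 5 + 6) + 38"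
  have loop: "wp (repeat 14 draw_vertex) (\<lambda>t s. t \<le> n * (?T + 2) + 1 \<and> ?I n s)
    (R(14 := int n, 15 := 1, 16 := 0, 17 := 0, 20 := 0, 22 := 0, 23 := 0, 24 := 0, 25 := 0, 26 := 0, 27 := 0), A)"
  proof (rule wp_repeat[where I = ?I])
    fix j R' A' assume j: "j < n" "?I j (R', A')"
    have j': "j < length vs" using j by (simp add: n_def)
    note f = fetch_vertex[OF j' assms(6)]
    show "wp draw_vertex (loop_round 14 ?T R' (?I (Suc j))) (R', A')"
      unfolding draw_vertex_def using j(2)
      apply (elim Pair_inject)
      apply hypsubst
      apply (simp add: assms(1-5) f)
      apply (rule call_base; simp add: assms(1-5))
      apply (rule call_fill_block[where L = L and m = m and N = "R 8"]; simp add: assms(1-6))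
      using j(1) apply (auto simp: fun_eq_iff take_Suc_conv_app_nth[OF j'] b_def address_def block_indices_def Un_commute algebra_simps)
      done
  qed (use assms in \<open>auto simp: fun_eq_iff\<close>)
  show ?thesis
    unfolding draw_vertices_def using assms(1-3)
    by (simp add: n_def[symmetric]) (rule wp_exact[OF loop], auto simp: fun_eq_iff n_def algebra_simps)
qed

definition draw_edge :: cmd where
  "draw_edge = seq [Add 15 15 2, Get 16 100 15, Add 15 15 2, Get 17 100 15, Add 15 15 2, Get 18 100 15,
     Add 15 15 2, Get 19 100 15, base 16 17, Add 21 20 0, base 18 19,
     Sub 24 21 20, Cond 24 (Add 20 21 0) (Sub 24 20 21), Sub 24 24 7, Cond 24 (Sub 20 20 8) (Sub 20 20 2),
     Put 4 5 20, clear [16, 17, 18, 19, 20, 21, 24]]"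

definition draw_edges :: cmd where
  "draw_edges = seq [clear [16, 17, 18, 19, 20, 21, 22, 24, 25, 26, 27], Add 15 15 2, Add 14 4 0, repeat 14 draw_edge]"

lemma wp_draw_edges:
  assumes "R 0 = 0" "R 2 = 1" "R 4 = int (length es)" "R 15 = 1 + 2 * int (length vs)"
    "A 100 = code k vs es" "A 4 = marked m (R 5) Z"
  defines "n \<equiv> length vs" and "e \<equiv> length es" and "b \<equiv> address (R 8) (R 9) (R 7) (A 2) (A 3)"
  shows "wp draw_edges (\<lambda>t s. t \<le> e * ((length (A 2) + length (A 3)) * 22 + 80) + 20 \<and>
    s = (R(14 := 0, 15 := 2 + 2 * int n + 4 * int e, 16 := 0, 17 := 0, 18 := 0, 19 := 0, 20 := 0, 21 := 0, 22 := 0, 23 := 0,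
        24 := 0, 25 := 0, 26 := 0, 27 := 0),
      A(4 := marked m (R 5) (Z \<union> (\<lambda>(u, v). bridge_index (R 8) (R 7) (b u) (b v)) ` set es)))) (R, A)"
proof -
  let ?I = "\<lambda>j s. s = (R(14 := int (e - j), 15 := 2 + 2 * int n + 4 * int j, 16 := 0, 17 := 0, 18 := 0, 19 := 0, 20 := 0,
      21 := 0, 22 := 0, 23 := 0, 24 := 0, 25 := 0, 26 := 0, 27 := 0),
      A(4 := marked m (R 5) (Z \<union> (\<lambda>(u, v). bridge_index (R 8) (R 7) (b u) (b v)) ` set (take j es))))"
  let ?T = "(length (A 2) + length (A 3)) * 22 + 78"
  have loop: "wp (repeat 14 draw_edge) (\<lambda>t s. t \<le> e * (?T + 2) + 1 \<and> ?I e s)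
    (R(14 := int e, 15 := 2 + 2 * int n, 16 := 0, 17 := 0, 18 := 0, 19 := 0, 20 := 0, 21 := 0, 22 := 0, 23 := 0, 24 := 0,
      25 := 0, 26 := 0, 27 := 0), A)"
  proof (rule wp_repeat[where I = ?I])
    fix j R' A' assume j: "j < e" "?I j (R', A')"
    have j': "j < length es" using j by (simp add: e_def)
    have step: "(\<lambda>(u, v). bridge_index (R 8) (R 7) (b u) (b v)) ` set (take (Suc j) es) =
      insert (bridge_index (R 8) (R 7) (b (fst (es ! j))) (b (snd (es ! j))))
        ((\<lambda>(u, v). bridge_index (R 8) (R 7) (b u) (b v)) ` set (take j es))"
      by (simp add: take_Suc_conv_app_nth[OF j'] case_prod_unfold)
    define X where "X = (\<lambda>(u, v). bridge_index (R 8) (R 7) (b u) (b v)) ` set (take j es)"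
    note f = fetch_edge[OF j' assms(5)]
    have b': "R 8 + 1 + count_less (A 2) (fst v) * R 9 + count_less (A 3) (snd v) * R 7 = b v" for v
      by (simp add: b_def address_def)
    show "wp draw_edge (loop_round 14 ?T R' (?I (Suc j))) (R', A')"
      unfolding draw_edge_def step X_def[symmetric] using j(2)[folded X_def]
      apply (elim Pair_inject)
      apply hypsubst
      apply (simp add: assms(1-4) f n_def)
      apply (rule call_base; simp add: assms(1-4) b')
      apply (rule call_base; simp add: assms(1-4) b')
      using j(1) apply (auto simp: fun_eq_iff bridge_index_def max_def n_def)
      done
  qed (use assms in \<open>auto simp: fun_eq_iff\<close>)
  show ?thesis
    unfolding draw_edges_def using assms(1-4)
    by (simp add: n_def[symmetric] e_def[symmetric]) (rule wp_exact[OF loop], auto simp: fun_eq_iff e_def algebra_simps)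
qed

lemmas call_draw_vertices = wp_exact[OF wp_draw_vertices refl]
lemmas call_draw_edges = wp_exact[OF wp_draw_edges refl]

section \<open>Writing the instance and evaluating the solution\<close>

text \<open>Reading beyond a row ends in the neighbouring row. As border cells are holes, this has no effect.\<close>

definition cost_at :: "int list \<Rightarrow> int \<Rightarrow> int \<Rightarrow> int" where
  "cost_at U N i = fetch U (i + 1) + fetch U (i - 1) + fetch U (i + N) + fetch U (i - N) - 4 * fetch U i
     - of_bool (fetch U i > 0)"

definition write_cost :: cmd where
  "write_cost = seq [Get 16 4 15, Add 20 15 2, Get 24 4 20, Sub 20 15 2, Get 17 4 20, Add 24 24 17,
     Add 20 15 8, Get 17 4 20, Add 24 24 17, Sub 20 15 8, Get 17 4 20, Add 24 24 17,
     Sub 24 24 16, Sub 24 24 16, Sub 24 24 16, Sub 24 24 16, Cond 16 (Sub 24 24 2) (seq []),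
     Push 103 24, Push 103 2, Add 15 15 2, clear [16, 17, 20, 24]]"

text \<open>Array 103 becomes the input of the solver.\<close>

definition write_instance :: cmd where
  "write_instance = seq [Push 103 8, Push 103 8, Push 103 0, Push 103 2, Push 103 12,
     Add 14 10 0, repeat 14 (Push 103 0), clear [15, 16, 17, 20, 24], Add 14 10 0, repeat 14 write_cost]"

lemma wp_write_instance:
  assumes "R 0 = 0" "R 2 = 1" "R 10 = int m"
  shows "wp write_instance (\<lambda>t s. t \<le> m * 33 + 16 \<and>
    s = (R(14 := 0, 15 := int m, 16 := 0, 17 := 0, 20 := 0, 23 := 0, 24 := 0),
      A(103 := A 103 @ [R 8, R 8, 0, 1, R 12] @ replicate m 0 @
        concat (map (\<lambda>i. [cost_at (A 4) (R 8) (int i), 1]) [0..<m])))) (R, A)"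
proof -
  define H where "H = A 103 @ [R 8, R 8, 0, 1, R 12]"
  define C where "C j = concat (map (\<lambda>i. [cost_at (A 4) (R 8) (int i), 1]) [0..<j])" for j
  have C: "C (Suc j) = C j @ [cost_at (A 4) (R 8) (int j), 1]" for j by (simp add: C_def)
  let ?I = "\<lambda>j s. s = (R(14 := int (m - j)), A(103 := H @ replicate j 0))"
  have loop1: "wp (repeat 14 (Push 103 0)) (\<lambda>t s. t \<le> m * (1 + 2) + 1 \<and> ?I m s) (R(14 := int m), A(103 := H))"
    by (rule wp_repeat[where I = ?I]) (use assms in \<open>auto simp: fun_eq_iff replicate_append_same\<close>)
  let ?J = "\<lambda>j s. s = (R(14 := int (m - j), 15 := int j, 16 := 0, 17 := 0, 20 := 0, 23 := 0, 24 := 0),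
    A(103 := H @ replicate m 0 @ C j))"
  have loop2: "wp (repeat 14 write_cost) (\<lambda>t s. t \<le> m * (27 + 2) + 1 \<and> ?J m s)
    (R(14 := int m, 15 := 0, 16 := 0, 17 := 0, 20 := 0, 23 := 0, 24 := 0), A(103 := H @ replicate m 0))"
  proof (rule wp_repeat[where I = ?J])
    fix j R' A' assume j: "j < m" "?J j (R', A')"
    show "wp write_cost (loop_round 14 27 R' (?J (Suc j))) (R', A')"
      unfolding write_cost_def C using j(2)
      by (elim Pair_inject) (hypsubst, use j(1) assms in \<open>auto simp: fun_eq_iff cost_at_def\<close>)
  qed (use assms in \<open>auto simp: fun_eq_iff C_def\<close>)
  show ?thesis
    unfolding write_instance_def using assms
    apply simp
    apply (rule wp_exact[OF loop1])
     apply (force simp: fun_eq_iff H_def)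
    apply simp
    apply (rule wp_exact[OF loop2])
     apply (force simp: fun_eq_iff)
    apply (auto simp: fun_eq_iff C_def H_def)
    done
qed

definition weight_counts :: "bool \<Rightarrow> cmd" where
  "weight_counts b = (if b then seq [Sub 28 10 8, Add 28 28 28, Add 29 10 0] else seq [Const 28 1, Const 29 0])"

definition write_weights :: cmd where
  "write_weights = seq [Add 14 28 0, repeat 14 (seq [Push 103 5, Push 103 2]),
     Add 14 29 0, repeat 14 (seq [Push 103 2, Push 103 2])]"

lemma wp_repeat_push:
  assumes "R 0 = 0" "R 2 = 1" "R 14 = int p" "R 23 = 0" "u \<noteq> 14" "u \<noteq> 23"
  shows "wp (repeat 14 (seq [Push 103 u, Push 103 2])) (\<lambda>t s. t \<le> p * 5 + 1 \<and>
    s = (R(14 := 0), A(103 := A 103 @ concat (replicate p [R u, 1])))) (R, A)"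
proof -
  let ?I = "\<lambda>j s. s = (R(14 := int (p - j)), A(103 := A 103 @ concat (replicate j [R u, 1])))"
  have app: "concat (replicate j [R u, 1]) @ [R u, 1] = [R u, 1] @ concat (replicate j [R u, 1])" for j
    by (induction j) auto
  have "wp (repeat 14 (seq [Push 103 u, Push 103 2])) (\<lambda>t s. t \<le> p * (3 + 2) + 1 \<and> ?I p s) (R, A)"
    by (rule wp_repeat[where I = ?I]) (use assms app in \<open>auto simp: fun_eq_iff\<close>)
  then show ?thesis by simp
qed

lemmas call_repeat_push = wp_exact[OF wp_repeat_push refl]

lemma wp_write_weights:
  assumes "R 0 = 0" "R 2 = 1" "R 28 = int p" "R 29 = int q" "R 23 = 0"
  shows "wp write_weights (\<lambda>t s. t \<le> (p + q) * 5 + 5 \<and>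
    s = (R(14 := 0), A(103 := A 103 @ concat (replicate p [R 5, 1]) @ concat (replicate q [1, 1])))) (R, A)"
  unfolding write_weights_def using assms
  apply simp
  apply (rule call_repeat_push[where p = p]; simp)
  apply (rule call_repeat_push[where p = q]; simp)
  apply (auto simp: fun_eq_iff)
  done

lemmas call_write_instance = wp_exact[OF wp_write_instance refl]
lemmas call_write_weights = wp_exact[OF wp_write_weights refl]

definition pair_cost :: "int \<Rightarrow> int list \<Rightarrow> int list \<Rightarrow> int \<Rightarrow> int \<Rightarrow> int" where
  "pair_cost a U zs i j = (if fetch U j > 0 \<and> fetch zs i \<noteq> fetch zs j then a else 0)"

text \<open>The contribution of a cell to jumps and mass, where each jump is counted at its upper or left cell. Array 101 contains
the output of the solver.\<close>

definition cell_cost :: "int \<Rightarrow> int list \<Rightarrow> int \<Rightarrow> int list \<Rightarrow> int \<Rightarrow> int" where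
  "cell_cost a U N zs i = (if fetch U i > 0
     then pair_cost a U zs i (i + 1) + pair_cost a U zs i (i + N) - fetch zs i else 0)"

definition add_jump :: cmd where
  "add_jump = seq [Get 16 4 20, Cond 16 (seq [Get 18 101 20, Sub 24 17 18, Cond 24 (Add 30 30 5)
     (seq [Sub 24 18 17, Cond 24 (Add 30 30 5) (seq [])])]) (seq []), clear [16, 18, 24]]"

lemma wp_add_jump:
  assumes "R 17 = fetch (A 101) i"
  shows "wp add_jump (\<lambda>t s. t \<le> 16 \<and>
    s = (R(16 := 0, 18 := 0, 23 := 0, 24 := 0, 30 := R 30 + pair_cost (R 5) (A 4) (A 101) i (R 20)), A)) (R, A)"
  unfolding add_jump_def using assms by (auto simp: fun_eq_iff pair_cost_def)

lemmas call_add_jump = wp_exact[OF wp_add_jump refl]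

definition add_cell :: cmd where
  "add_cell = seq [Get 16 4 15, Cond 16 (seq [Get 17 101 15, Sub 30 30 17, Add 20 15 2, add_jump,
     Add 20 15 8, add_jump]) (seq []), Add 15 15 2, clear [16, 17, 18, 20, 24]]"

lemma wp_add_cell:
  assumes "R 2 = 1"
  shows "wp add_cell (\<lambda>t s. t \<le> 50 \<and>
    s = (R(15 := R 15 + 1, 16 := 0, 17 := 0, 18 := 0, 20 := 0, 23 := 0, 24 := 0,
      30 := R 30 + cell_cost (R 5) (A 4) (R 8) (A 101) (R 15)), A)) (R, A)"
proof (cases "fetch (A 4) (R 15) > 0")
  case True
  then show ?thesis
    unfolding add_cell_def using assms
    apply simp
    apply (rule call_add_jump[where i = "R 15"]; simp)
    apply (rule call_add_jump[where i = "R 15"]; simp)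
    apply (auto simp: fun_eq_iff cell_cost_def)
    done
next
  case False
  then show ?thesis
    unfolding add_cell_def using assms by (auto simp: fun_eq_iff cell_cost_def)
qed

lemmas call_add_cell = wp_exact[OF wp_add_cell refl]

text \<open>Compares jumps and mass of the solution with \<open>a k\<close> minus the quota. The quota is the radius minus the number of edges,
and adding 1 at the end turns \<open>\<ge>\<close> into \<open>>\<close>.\<close>

definition decide :: cmd where
  "decide = seq [clear [15, 16, 17, 18, 20, 24, 30], Add 14 10 0, repeat 14 add_cell,
     Add 14 5 0, repeat 14 (Add 20 20 31), Sub 20 20 12, Add 20 20 4, Sub 20 20 30, Add 20 20 2,
     Cond 20 (Push 0 2) (Push 0 0)]"

lemma wp_decide:
  assumes "R 0 = 0" "R 2 = 1" "R 10 = int m" "R 5 = int a"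
  shows "wp decide (\<lambda>t s. t \<le> m * 52 + a * 3 + 20 \<and>
    snd s 0 = A 0 @ [of_bool ((\<Sum>i<m. cell_cost (R 5) (A 4) (R 8) (A 101) (int i)) \<le> int a * R 31 - (R 12 - R 4))]) (R, A)"
proof -
  define c where "c j = (\<Sum>i<j. cell_cost (R 5) (A 4) (R 8) (A 101) (int i))" for j :: nat
  let ?I = "\<lambda>j s. s = (R(14 := int (m - j), 15 := int j, 16 := 0, 17 := 0, 18 := 0, 20 := 0, 23 := 0, 24 := 0, 30 := c j), A)"
  have loop1: "wp (repeat 14 add_cell) (\<lambda>t s. t \<le> m * (50 + 2) + 1 \<and> ?I m s)
    (R(14 := int m, 15 := 0, 16 := 0, 17 := 0, 18 := 0, 20 := 0, 23 := 0, 24 := 0, 30 := 0), A)"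
  proof (rule wp_repeat[where I = ?I])
    fix j R' A' assume j: "j < m" "?I j (R', A')"
    show "wp add_cell (loop_round 14 50 R' (?I (Suc j))) (R', A')"
      using j(2)
      by (elim Pair_inject) (hypsubst, rule call_add_cell, use j(1) assms in \<open>auto simp: fun_eq_iff c_def\<close>)
  qed (use assms in \<open>auto simp: fun_eq_iff c_def\<close>)
  let ?R = "R(14 := int m, 15 := int m, 16 := 0, 17 := 0, 18 := 0, 20 := 0, 23 := 0, 24 := 0, 30 := c m)"
  let ?J = "\<lambda>j s. s = (?R(14 := int (a - j), 20 := int j * R 31), A)"
  have loop2: "wp (repeat 14 (Add 20 20 31)) (\<lambda>t s. t \<le> a * (1 + 2) + 1 \<and> ?J a s) (?R(14 := int a), A)"
    by (rule wp_repeat[where I = ?J]) (use assms in \<open>auto simp: fun_eq_iff algebra_simps\<close>)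
  define v :: int where "v = of_bool (c m \<le> int a * R 31 - (R 12 - R 4))"
  have "wp decide (\<lambda>t s. t \<le> m * 52 + a * 3 + 20 \<and> snd s 0 = A 0 @ [v]) (R, A)"
    unfolding decide_def using assms
    apply simp
    apply (rule wp_exact[OF loop1])
     apply (force simp: fun_eq_iff)
    apply simp
    apply (rule wp_exact[OF loop2])
     apply (force simp: fun_eq_iff)
    apply (auto simp: v_def)
    done
  then show ?thesis unfolding v_def c_def .
qed

definition draw :: cmd where
  "draw = seq [collect, sizes, fresh_cells, draw_vertices, draw_edges]"

definition build :: "bool \<Rightarrow> cmd" where
  "build b = seq [draw, write_instance, weight_counts b, write_weights]"

definition draw_time :: "nat \<Rightarrow> nat \<Rightarrow> nat" where
  "draw_time n e = (let L = 2 * (e + 1); N = n * Suc L + 1 in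
     n * (n * 28 + 30) + (Suc L + N + N + L) * 3 + (n + 1) * 5 + N * N * 3
     + n * (2 * n * 11 + L * (L * 5 + 6) + 40) + e * (2 * n * 22 + 80) + 100)"

definition build_time :: "nat \<Rightarrow> nat \<Rightarrow> nat" where
  "build_time n e = (let N = n * Suc (2 * (e + 1)) + 1 in
     draw_time n e + N * N * 33 + (N * N + N * N + N * N + 1) * 5 + 40)"

definition drawing :: "nat \<Rightarrow> nat \<Rightarrow> point list \<Rightarrow> (point \<times> point) list \<Rightarrow> int set" where
  "drawing N L vs es = (let b = address (int N) (int (Suc L * N)) (int (Suc L)) (distinct_list (map fst vs)) (distinct_list (map snd vs))
     in (\<Union>v\<in>set vs. block_indices (int N) L (b v)) \<union> (\<lambda>(u, v). bridge_index (int N) (int (Suc L)) (b u) (b v)) ` set es)"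

lemma wp_draw:
  assumes "R 0 = 0" "A 100 = code k vs es" "A 2 = []" "A 3 = []" "A 4 = []"
  defines "n \<equiv> length vs" and "e \<equiv> length es"
  defines "L \<equiv> 2 * (e + 1)"
  defines "N \<equiv> n * Suc L + 1"
  shows "wp draw (\<lambda>t (R', A'). t \<le> draw_time n e \<and>
    R' 0 = 0 \<and> R' 2 = 1 \<and> R' 4 = int e \<and> R' 5 = int (e + 1) \<and> R' 8 = int N \<and> R' 10 = int (N * N) \<and>
    R' 12 = int (L * L * ((n + 1) div 2) + e) \<and> R' 31 = int k \<and> (\<forall>x\<ge>100. R' x = R x) \<and>
    A' 4 = marked (N * N) (int (e + 1)) (drawing N L vs es) \<and> (\<forall>x. x \<notin> {2, 3, 4} \<longrightarrow> A' x = A x)) (R, A)"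
proof -
  define xs ys where "xs = distinct_list (map fst vs)" and "ys = distinct_list (map snd vs)"
  have len: "length xs \<le> n" "length ys \<le> n"
    using distinct_list[of "map fst vs"] distinct_list[of "map snd vs"] by (simp_all add: xs_def ys_def n_def)
  define X s rr where "X = N * N" and "s = Suc L * N" and "rr = L * L * ((n + 1) div 2) + e"
  have drawing: "drawing N L vs es = (\<Union>v\<in>set vs. block_indices (int N) L (address (int N) (int s) (int (Suc L)) xs ys v)) \<union>
    (\<lambda>(u, v). bridge_index (int N) (int (Suc L)) (address (int N) (int s) (int (Suc L)) xs ys u)
      (address (int N) (int s) (int (Suc L)) xs ys v)) ` set es"
    by (simp only: drawing_def Let_def xs_def ys_def s_def)
  define TV TE where "TV = n * (2 * n * 11 + L * (L * 5 + 6) + 40)" and "TE = e * (2 * n * 22 + 80)"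
  have tv: "n * ((length xs + length ys) * 11 + L * (L * 5 + 6) + 40) \<le> TV"
    unfolding TV_def using len by (intro mult_le_mono2) simp
  have te: "e * ((length xs + length ys) * 22 + 80) \<le> TE"
    unfolding TE_def using len by (intro mult_le_mono2) simp
  define TC TS where "TC = n * (n * 28 + 30) + 13" and "TS = (Suc L + N + N + L) * 3 + (n + 1) * 5 + 40"
  have time: "TC + TS + (X * 3 + 2) + (TV + 14) + (TE + 20) + 1 \<le> draw_time n e"
    unfolding draw_time_def Let_def L_def[symmetric] N_def[symmetric] TC_def TS_def TV_def TE_def X_def
    by linarith
  show ?thesis
    unfolding draw_def wp_seq X_def[symmetric] rr_def[symmetric] drawing
    apply (rule call_collect[where vs = vs and es = es and k = k, folded n_def xs_def ys_def TC_def])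
    using assms(1-4) apply (simp_all)[4]
    apply (rule call_sizes[where vs = vs and es = es and k = k, folded n_def e_def, folded L_def, folded N_def, folded TS_def rr_def X_def s_def])
    using assms(1-4) apply (simp_all add: n_def)[5]
    apply (rule call_fresh_cells[where m = X and a = "int (e + 1)"])
    using assms(1-5) apply (simp_all)[4]
    apply (rule call_draw_vertices[where vs = vs and es = es and k = k and L = L and m = X, folded n_def])
    using assms(1-4) apply (simp_all add: n_def)[7]
    apply (rule call_draw_edges[where vs = vs and es = es and k = k and m = X, folded n_def e_def])
    using assms(1-4) apply (simp_all add: n_def e_def)[6]
    apply (simp only: wp_seq wp_basic prod.case)
    apply (intro conjI)
    subgoal premises prems for t1 t2 t3 t4 t5
      using time tv te prems(1-5) unfolding TC_def by simp
    using assms(1) apply simp_all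
    done
qed

lemma wp_build:
  fixes b :: bool
  assumes "R 0 = 0" "A 100 = code k vs es" "A 2 = []" "A 3 = []" "A 4 = []"
  defines "n \<equiv> length vs" and "e \<equiv> length es"
  defines "L \<equiv> 2 * (e + 1)"
  defines "N \<equiv> n * Suc L + 1"
  defines "U \<equiv> marked (N * N) (int (e + 1)) (drawing N L vs es)" and "r \<equiv> L * L * ((n + 1) div 2) + e"
  defines "p \<equiv> (if b then (N - 1) * N + N * (N - 1) else 1)" and "q \<equiv> (if b then N * N else 0)"
  shows "wp (build b) (\<lambda>t (R', A'). t \<le> build_time n e \<and>
    R' 0 = 0 \<and> R' 2 = 1 \<and> R' 4 = int e \<and> R' 5 = int (e + 1) \<and> R' 8 = int N \<and> R' 10 = int (N * N) \<and> R' 12 = int r \<and>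
    R' 31 = int k \<and> (\<forall>x\<ge>100. R' x = R x) \<and> A' 4 = U \<and> (\<forall>x. x \<notin> {2, 3, 4, 103} \<longrightarrow> A' x = A x) \<and>
    A' 103 = A 103 @ [int N, int N, 0, 1, int r] @ replicate (N * N) 0 @
      concat (map (\<lambda>i. [cost_at U (int N) (int i), 1]) [0..<N * N]) @ weight_code p q (e + 1)) (R, A)"
proof -
  have pN: "(N - 1) * N + N * (N - 1) \<le> N * N + N * N"
    by (intro add_mono mult_le_mono1 mult_le_mono2) auto
  have pq: "(p + q) * 5 \<le> (N * N + N * N + N * N + 1) * 5"
  proof -
    have "(x + x + y) * 5 \<le> (y + y + y + 1) * 5" if "x \<le> y" for x y :: nat
      using that by simp
    from this[of "N * (N - 1)" "N * N"] show ?thesis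
      by (cases b) (simp_all only: p_def q_def if_True if_False mult.commute[of "N - 1" N], simp_all)
  qed
  have p_int: "int N * int N - int N + (int N * int N - int N) = int ((N - 1) * N + N * (N - 1))"
  proof -
    obtain K where "N = Suc K" by (simp add: N_def)
    then show ?thesis by (simp add: algebra_simps)
  qed
  define X where "X = N * N"
  define counts where "counts = weight_counts b"
  have wc: "wp counts Q (R1, A1)"
    if "R1 10 = int X" "R1 8 = int N" "\<And>t. t \<le> 5 \<Longrightarrow> Q t (R1(23 := 0, 28 := int p, 29 := int q), A1)" "R1 0 = 0" for R1 A1 Q
  proof -
    have eq: "R1(28 := x, 29 := y, 23 := 0) = R1(23 := 0, 28 := x, 29 := y)"
      "R1(28 := w, 28 := x, 29 := y, 23 := 0) = R1(23 := 0, 28 := x, 29 := y)" for w x y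
      by (auto simp: fun_eq_iff)
    show ?thesis
      using that p_int by (cases b) (simp_all add: counts_def weight_counts_def p_def q_def eq X_def)
  qed
  have time: "draw_time n e + (X * 33 + 16) + 5 + ((p + q) * 5 + 5) + 1 \<le> build_time n e"
    using pq unfolding build_time_def Let_def L_def[symmetric] N_def[symmetric] X_def by linarith
  show ?thesis
    unfolding build_def counts_def[symmetric] wp_seq
    apply (rule wp_mono[OF wp_draw[where R = R and A = A and vs = vs and es = es and k = k, OF assms(1-5), folded n_def e_def, folded L_def, folded N_def, folded U_def r_def, folded X_def]])
    apply (clarify)
    apply (rule call_write_instance[where m = X]; (assumption | simp)?)
    apply (rule wc; (assumption | simp)?)
    apply (rule call_write_weights[where p = p and q = q]; (assumption | simp)?)
    using time apply (auto simp: X_def weight_code_def)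
    done
qed

section \<open>Correctness of the drawing and of the evaluation\<close>

definition row_major :: "nat \<Rightarrow> picture \<Rightarrow> int list" where
  "row_major N f = map (\<lambda>i. f (i div N) (i mod N)) [0..<N * N]"

lemma fetch_row_major:
  assumes "x < N" "z < N"
  shows "fetch (row_major N f) (int (x * N + z)) = f x z"
proof -
  have "x * N + z < Suc x * N" using assms by simp
  also have "\<dots> \<le> N * N" using assms by (intro mult_le_mono1) simp
  finally have "x * N + z < N * N" .
  moreover have "(x * N + z) div N = x" using assms by (intro div_nat_eqI) auto
  moreover have "(x * N + z) mod N = z" using assms by simp
  ultimately show ?thesis
    by (subst fetch_nth) (auto simp: row_major_def)
qed

abbreviation shaded :: "nat \<Rightarrow> int \<Rightarrow> cell set \<Rightarrow> int list" where
  "shaded N a T \<equiv> row_major N (\<lambda>x z. a * of_bool ((x, z) \<in> T))"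

lemma fetch_row_major_cells:
  assumes T: "T \<subseteq> interior N" and "N > 0"
  shows "fetch (shaded N a T) (int i) = a * of_bool ((i div N, i mod N) \<in> T)"
proof (cases "i < N * N")
  case True
  then show ?thesis by (subst fetch_nth) (auto simp: row_major_def)
next
  case False
  have "i div N \<ge> N" using False \<open>N > 0\<close> by (simp add: less_eq_div_iff_mult_less_eq)
  then have "(i div N, i mod N) \<notin> T" using subsetD[OF T, of "(i div N, i mod N)"] by auto
  then show ?thesis using False by (simp add: fetch_def row_major_def nth_default_def)
qed

lemma fetch_negative: "i < 0 \<Longrightarrow> fetch xs i = 0"
  by (simp add: fetch_def)

lemma cost_at_row_major:
  assumes T: "T \<subseteq> interior N" and xz: "x < N" "z < N" and "a > 0"
  shows "cost_at (shaded N a T) (int N) (int (x * N + z)) = field a T x z"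
proof -
  let ?U = "shaded N a T"
  have N: "N > 0" using xz by simp
  note F = fetch_row_major_cells[OF T N, of a]
  have dm: "(x' * N + z') div N = x'" "(x' * N + z') mod N = z'" if "z' < N" for x' z'
    using that by (auto intro!: div_nat_eqI)
  have here: "fetch ?U (int (x * N + z)) = a * of_bool ((x, z) \<in> T)"
    unfolding F using dm xz by simp
  have right: "fetch ?U (int (x * N + z) + 1) = a * of_bool ((x, Suc z) \<in> T)"
  proof (cases "Suc z < N")
    case True
    have "int (x * N + z) + 1 = int (x * N + Suc z)" by simp
    then show ?thesis by (simp only: F dm[OF True])
  next
    case False
    then have "Suc z = N" using xz by simp
    then have "int (x * N + z) + 1 = int (Suc x * N + 0)" by simp
    moreover have "(Suc x, 0) \<notin> T" "(x, Suc z) \<notin> T" using T \<open>Suc z = N\<close> by auto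
    ultimately show ?thesis by (simp only: F dm[OF N]; simp)
  qed
  have left: "fetch ?U (int (x * N + z) - 1) = a * of_bool ((x, z - 1) \<in> T)"
  proof (cases "z = 0")
    case False
    then have "int (x * N + z) - 1 = int (x * N + (z - 1))" by simp
    moreover have "z - 1 < N" using xz by simp
    ultimately show ?thesis by (simp only: F dm)
  next
    case True
    then have notin: "(x, z - 1) \<notin> T" using T by auto
    show ?thesis
    proof (cases x)
      case 0
      then show ?thesis using True notin by (simp add: fetch_negative)
    next
      case (Suc x')
      have "int (x * N + z) - 1 = int (x' * N + (N - 1))" using True Suc N by (simp add: of_nat_diff)
      moreover have "(x', N - 1) \<notin> T" using subsetD[OF T, of "(x', N - 1)"] by auto
      moreover have "N - 1 < N" using N by simp
      ultimately show ?thesis using notin by (simp only: F dm; simp)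
    qed
  qed
  have down: "fetch ?U (int (x * N + z) + int N) = a * of_bool ((Suc x, z) \<in> T)"
  proof -
    have "int (x * N + z) + int N = int (Suc x * N + z)" by simp
    then show ?thesis by (simp only: F dm[OF xz(2)])
  qed
  have up: "fetch ?U (int (x * N + z) - int N) = a * of_bool ((x - 1, z) \<in> T)"
  proof (cases x)
    case 0
    moreover have "(0, z) \<notin> T" using T by auto
    ultimately show ?thesis using xz by (simp add: fetch_negative)
  next
    case (Suc x')
    then have "int (x * N + z) - int N = int (x' * N + z)" by simp
    then show ?thesis using Suc by (simp only: F dm[OF xz(2)]; simp)
  qed
  show ?thesis
    unfolding cost_at_def field_def here right left down up using \<open>a > 0\<close> by (simp add: algebra_simps)
qed

lemma sum_row_major:
  fixes f :: "nat \<Rightarrow> int"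
  shows "(\<Sum>i<n * k. f i) = (\<Sum>x<n. \<Sum>z<k. f (x * k + z))"
proof -
  have "sum f {x * k..<x * k + k} = (\<Sum>z<k. f (x * k + z))" for x
    using sum.shift_bounds_nat_ivl[of f 0 "x * k" k] by (simp add: lessThan_atLeast0 add.commute)
  then show ?thesis using sum.nat_group[of f k n] by simp
qed

lemma sum_cell_cost:
  assumes T: "T \<subseteq> interior N" and y: "binary N y" and "a > 0"
  shows "(\<Sum>i<N * N. cell_cost a (shaded N a T) (int N) (row_major N y) (int i))
    = a * jumps N T y - mass N T y"
proof -
  let ?U = "shaded N a T" and ?y = "row_major N y"
  have cell: "cell_cost a ?U (int N) ?y (int (x * N + z)) =
    a * jump T y x z + a * jump (T\<inverse>) (flip y) z x - (if (x, z) \<in> T then y x z else 0)"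
    if xz: "x < N" "z < N" for x z
  proof (cases "(x, z) \<in> T")
    case True
    then have S: "Suc x < N" "Suc z < N" using subsetD[OF T, of "(x, z)"] by auto
    have i: "int (x * N + z) + 1 = int (x * N + Suc z)" "int (x * N + z) + int N = int (Suc x * N + z)" by simp_all
    have y01: "y x z \<in> {0, 1}" "y (Suc x) z \<in> {0, 1}" "y x (Suc z) \<in> {0, 1}"
      using y xz S by (auto simp: binary_def)
    show ?thesis
      unfolding cell_cost_def pair_cost_def i
      using xz S True y01 \<open>a > 0\<close> by (auto simp only: fetch_row_major) (auto simp: jump_def flip_def)
  next
    case False
    then show ?thesis
      unfolding cell_cost_def using xz by (simp only: fetch_row_major) (simp add: jump_def)
  qed
  have "(\<Sum>i<N * N. cell_cost a ?U (int N) ?y (int i)) =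
    (\<Sum>x<N. \<Sum>z<N. a * jump T y x z + a * jump (T\<inverse>) (flip y) z x - (if (x, z) \<in> T then y x z else 0))"
    unfolding sum_row_major using cell by (intro sum.cong refl) simp
  also have "\<dots> = a * vjumps N T y + a * (\<Sum>x<N. \<Sum>z<N. jump (T\<inverse>) (flip y) z x) - mass N T y"
    by (simp add: sum.distrib sum_subtractf vjumps_def mass_def sum_distrib_left)
  also have "(\<Sum>x<N. \<Sum>z<N. jump (T\<inverse>) (flip y) z x) = vjumps N (T\<inverse>) (flip y)"
    unfolding vjumps_def by (rule sum.swap)
  finally show ?thesis by (simp add: jumps_def distrib_left)
qed

lemma count_less_rank: "count_less (distinct_list xs) v = int (rank (set xs) v)"
proof -
  have "length (filter (\<lambda>u. u < v) (distinct_list xs)) = card (set (filter (\<lambda>u. u < v) (distinct_list xs)))"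
    using distinct_list[of xs] by (metis distinct_card distinct_filter)
  also have "set (filter (\<lambda>u. u < v) (distinct_list xs)) = {b \<in> set xs. b < v}"
    using distinct_list[of xs] by auto
  finally show ?thesis by (simp add: count_less_def rank_def)
qed

definition row_index :: "nat \<Rightarrow> cell \<Rightarrow> int" where
  "row_index N = (\<lambda>(x, z). int (x * N + z))"

abbreviation corner :: "nat \<Rightarrow> nat \<Rightarrow> nat \<Rightarrow> nat \<Rightarrow> int" where
  "corner N L i j \<equiv> row_index N (i * Suc L + 1, j * Suc L + 1)"

lemma block_indices_eq:
  "block_indices (int N) L (corner N L i j) = row_index N ` block L (i, j)"
proof (intro equalityI subsetI)
  fix c assume "c \<in> block_indices (int N) L (corner N L i j)"
  then obtain p where p: "p < L" "corner N L i j + int p * int N \<le> c"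
    "c < corner N L i j + int p * int N + int L"
    by (auto simp: block_indices_def)
  define q where "q = nat (c - (corner N L i j + int p * int N))"
  have q: "c = corner N L i j + int p * int N + int q" "q < L"
    using p by (auto simp: q_def)
  have "c = row_index N (i * Suc L + 1 + p, j * Suc L + 1 + q)"
    unfolding q(1) by (simp add: row_index_def algebra_simps)
  moreover have "(i * Suc L + 1 + p, j * Suc L + 1 + q) \<in> block L (i, j)"
    using p(1) q(2) by (simp add: block_def)
  ultimately show "c \<in> row_index N ` block L (i, j)" by blast
next
  fix c assume "c \<in> row_index N ` block L (i, j)"
  then obtain x z where xz: "c = row_index N (x, z)" "(x, z) \<in> block L (i, j)" by force
  define p q where "p = x - (i * Suc L + 1)" and "q = z - (j * Suc L + 1)"
  have pq: "x = i * Suc L + 1 + p" "z = j * Suc L + 1 + q" "p < L" "q < L"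
    using xz(2) by (auto simp: block_def p_def q_def)
  have "c = corner N L i j + int p * int N + int q"
    unfolding xz(1) pq by (simp add: row_index_def algebra_simps)
  then show "c \<in> block_indices (int N) L (corner N L i j)"
    using pq(3,4) by (auto simp: block_indices_def intro!: bexI[of _ p])
qed

lemma bridge_index_commute: "bridge_index N s b c = bridge_index N s c b"
  by (simp add: bridge_index_def max.commute abs_minus_commute)

lemma bridge_index_vertical:
  assumes "N > 1"
  shows "bridge_index (int N) (int (Suc L)) (corner N L i j)
    (row_index N (Suc i * Suc L + 1, j * Suc L + 1)) = row_index N (vbridge L (i, j))"
proof -
  have "row_index N (Suc i * Suc L + 1, j * Suc L + 1) = corner N L i j + int (Suc L) * int N"
    by (simp add: row_index_def algebra_simps)
  moreover have "int (Suc L) < int (Suc L) * int N" using assms by simp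
  moreover have "corner N L i j + int (Suc L) * int N - int N = row_index N (vbridge L (i, j))"
    by (simp add: row_index_def vbridge_def algebra_simps)
  ultimately show ?thesis by (simp add: bridge_index_def max_def)
qed

lemma bridge_index_horizontal:
  "bridge_index (int N) (int (Suc L)) (corner N L i j)
    (row_index N (i * Suc L + 1, Suc j * Suc L + 1)) = row_index N (hbridge L (i, j))"
proof -
  have "row_index N (i * Suc L + 1, Suc j * Suc L + 1) = corner N L i j + int (Suc L)"
    by (simp add: row_index_def algebra_simps)
  moreover have "corner N L i j + int (Suc L) - 1 = row_index N (hbridge L (i, j))"
    by (simp add: row_index_def hbridge_def algebra_simps)
  ultimately show ?thesis by (simp add: bridge_index_def max_def)
qed

lemma marked_row_index:
  assumes "T \<subseteq> {..<N} \<times> {..<N}"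
  shows "marked (N * N) a (row_index N ` T) = shaded N a T"
proof -
  have "int i \<in> row_index N ` T \<longleftrightarrow> (i div N, i mod N) \<in> T" if "i < N * N" for i
  proof
    assume "int i \<in> row_index N ` T"
    then obtain x z where xz: "(x, z) \<in> T" "i = x * N + z"
      by (auto simp: row_index_def simp del: of_nat_add of_nat_mult)
    then have "z < N" using assms by auto
    then have "i div N = x" "i mod N = z" unfolding xz(2) by (auto intro!: div_nat_eqI)
    then show "(i div N, i mod N) \<in> T" using xz by simp
  next
    assume "(i div N, i mod N) \<in> T"
    moreover have "int i = row_index N (i div N, i mod N)" by (simp add: row_index_def del: of_nat_add of_nat_mult)
    ultimately show "int i \<in> row_index N ` T" by (rule rev_image_eqI)
  qed
  then show ?thesis by (simp add: marked_def row_major_def)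
qed

lemma grid_code_row_major:
  assumes T: "T \<subseteq> interior N" and "a > 0"
  shows "[int N, int N, 0, 1, int r] @ replicate (N * N) 0 @
    concat (map (\<lambda>i. [cost_at (row_major N (\<lambda>x z. int a * of_bool ((x, z) \<in> T))) (int N) (int i), 1]) [0..<N * N]) =
    grid_code N r a T"
proof -
  have "cost_at (row_major N (\<lambda>x z. int a * of_bool ((x, z) \<in> T))) (int N) (int i) = field (int a) T (i div N) (i mod N)"
    if i: "i < N * N" for i
  proof -
    have "i div N < N" "i mod N < N"
      using i less_mult_imp_div_less[OF i] by (cases N; simp)+
    from cost_at_row_major[OF T this, of "int a"] show ?thesis using \<open>a > 0\<close> by simp
  qed
  then have "map (\<lambda>i. [cost_at (row_major N (\<lambda>x z. int a * of_bool ((x, z) \<in> T))) (int N) (int i), 1]) [0..<N * N] =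
    map (\<lambda>i. [field (int a) T (i div N) (i mod N), 1]) [0..<N * N]"
    by (intro map_cong refl) simp
  then show ?thesis by (simp only: grid_code_def)
qed

context subgrid
begin

lemma address_eq:
  assumes "set vs = V"
  shows "address (int N) (int (Suc L * N)) (int (Suc L)) (distinct_list (map fst vs)) (distinct_list (map snd vs)) v =
    row_index N (fst (pos V v) * Suc L + 1, snd (pos V v) * Suc L + 1)"
  by (simp add: address_def row_index_def count_less_rank assms pos_def algebra_simps)

lemma side_gt_1: "v \<in> V \<Longrightarrow> side > 1"
  using finite_V by (auto simp: side_def card_gt_0_iff)

lemma drawing_eq:
  assumes vs: "set vs = V" and es: "(\<lambda>(u, v). {u, v}) ` set es = E"
  shows "drawing side width vs es = row_index side ` cells"
proof -
  define b where "b = (\<lambda>v. row_index side (fst (pos V v) * Suc width + 1, snd (pos V v) * Suc width + 1))"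
  let ?br = "\<lambda>u v. bridge_index (int side) (int (Suc width)) (b u) (b v)"
  have blocks: "(\<Union>v\<in>set vs. block_indices (int side) width (b v)) = row_index side ` (\<Union>v\<in>pos V ` V. block width v)"
  proof -
    have "block_indices (int side) width (b v) = row_index side ` block width (pos V v)" for v
      using block_indices_eq[of side width "fst (pos V v)" "snd (pos V v)"] by (simp add: b_def)
    then show ?thesis unfolding vs by (simp add: image_UN)
  qed
  have vert: "?br v (below v) = row_index side (vbridge width (pos V v))" if "{v, below v} \<in> E" for v
    using bridge_index_vertical[of side width "fst (pos V v)" "snd (pos V v)"] that edge_ends[OF that]
      side_gt_1[of v] pos_below[OF finite_V, of v] by (simp add: b_def)
  have hor: "?br v (beside v) = row_index side (hbridge width (pos V v))" if "{v, beside v} \<in> E" for v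
    using bridge_index_horizontal[of side width "fst (pos V v)" "snd (pos V v)"] that edge_ends[OF that]
      pos_beside[OF finite_V, of v] by (simp add: b_def)
  have comm: "?br u v = ?br v u" for u v by (rule bridge_index_commute)
  have "(\<lambda>(u, v). ?br u v) ` set es = row_index side ` (vbridge width ` vedges (V, E) \<union> hbridge width ` hedges (V, E))"
  proof (intro equalityI subsetI)
    fix c assume "c \<in> (\<lambda>(u, v). ?br u v) ` set es"
    then obtain u v where uv: "(u, v) \<in> set es" "c = ?br u v" by auto
    then have E: "{u, v} \<in> E" "{v, u} \<in> E" using es by (auto simp: insert_commute)
    then have "grid_adjacent u v \<or> grid_adjacent v u" using E_sub by (fastforce simp: doubleton_eq_iff)
    then consider "v = below u" | "u = below v" | "v = beside u" | "u = beside v"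
      unfolding grid_adjacent_iff by blast
    then show "c \<in> row_index side ` (vbridge width ` vedges (V, E) \<union> hbridge width ` hedges (V, E))"
    proof cases
      case 1
      then show ?thesis using uv(2) vert[of u] E by (auto simp: vedges_def)
    next
      case 2
      then show ?thesis using uv(2) vert[of v] comm[of u v] E by (auto simp: vedges_def)
    next
      case 3
      then show ?thesis using uv(2) hor[of u] E by (auto simp: hedges_def)
    next
      case 4
      then show ?thesis using uv(2) hor[of v] comm[of u v] E by (auto simp: hedges_def)
    qed
  next
    fix c assume "c \<in> row_index side ` (vbridge width ` vedges (V, E) \<union> hbridge width ` hedges (V, E))"
    then have "(\<exists>v. {v, below v} \<in> E \<and> c = row_index side (vbridge width (pos V v))) \<or>
      (\<exists>v. {v, beside v} \<in> E \<and> c = row_index side (hbridge width (pos V v)))"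
      unfolding vedges_def hedges_def prod.case by blast
    then obtain u v where uv: "{u, v} \<in> E" "c = ?br u v"
      using vert hor by metis
    then obtain x y where "(x, y) \<in> set es" "{u, v} = {x, y}" using es by auto
    then show "c \<in> (\<lambda>(u, v). ?br u v) ` set es"
      using uv(2) comm[of u v] unfolding doubleton_eq_iff by force
  qed
  note bridges = this
  have "address (int side) (int (Suc width * side)) (int (Suc width)) (distinct_list (map fst vs))
    (distinct_list (map snd vs)) v = b v" for v
    by (simp only: address_eq[OF vs] b_def)
  then show ?thesis
    unfolding drawing_def Let_def by (simp only: blocks bridges cells_def gadget_def image_Un Un_assoc)
qed

lemma cells_bounds: "cells \<subseteq> {1..<side - 1} \<times> {1..<side - 1}"
  using gadget_bounds[OF grid_graph, of width] by (simp add: cells_def side_def width_def)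

lemma marked_drawing:
  assumes "set vs = V" "(\<lambda>(u, v). {u, v}) ` set es = E"
  shows "marked (side * side) a (drawing side width vs es) = row_major side (\<lambda>x z. a * of_bool ((x, z) \<in> cells))"
  unfolding drawing_eq[OF assms] using cells_bounds by (intro marked_row_index) fastforce

end


section \<open>Polynomial bounds\<close>

lemma poly_nat_mono: "x \<le> y \<Longrightarrow> poly p x \<le> poly p y" for p :: "nat poly"
  by (induction p) (auto intro!: add_mono mult_mono)

definition polynomially_bounded :: "(nat \<Rightarrow> nat) \<Rightarrow> bool" where
  "polynomially_bounded f \<longleftrightarrow> (\<exists>p. \<forall>x. f x \<le> poly p x)"

lemma polynomially_bounded_intros:
  "polynomially_bounded (\<lambda>_. c)"
  "polynomially_bounded (\<lambda>x. x)"
  "polynomially_bounded f \<Longrightarrow> polynomially_bounded g \<Longrightarrow> polynomially_bounded (\<lambda>x. f x + g x)"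
  "polynomially_bounded f \<Longrightarrow> polynomially_bounded g \<Longrightarrow> polynomially_bounded (\<lambda>x. f x * g x)"
  "polynomially_bounded f \<Longrightarrow> polynomially_bounded (\<lambda>x. Suc (f x))"
  "polynomially_bounded f \<Longrightarrow> polynomially_bounded (\<lambda>x. f x div 2)"
  "polynomially_bounded f \<Longrightarrow> polynomially_bounded (\<lambda>x. poly q (f x))"
proof -
  show "polynomially_bounded (\<lambda>_. c)"
    unfolding polynomially_bounded_def by (intro exI[of _ "[:c:]"]) simp
  show "polynomially_bounded (\<lambda>x. x)"
    unfolding polynomially_bounded_def by (intro exI[of _ "[:0, 1:]"]) simp
  show "polynomially_bounded (\<lambda>x. f x + g x)" "polynomially_bounded (\<lambda>x. f x * g x)"
    if f: "polynomially_bounded f" and g: "polynomially_bounded g"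
  proof -
    obtain p q where "\<And>x. f x \<le> poly p x" "\<And>x. g x \<le> poly q x"
      using f g unfolding polynomially_bounded_def by blast
    then have "\<And>x. f x + g x \<le> poly (p + q) x" "\<And>x. f x * g x \<le> poly (p * q) x"
      by (simp_all add: add_mono mult_le_mono)
    then show "polynomially_bounded (\<lambda>x. f x + g x)" "polynomially_bounded (\<lambda>x. f x * g x)"
      unfolding polynomially_bounded_def by blast+
  qed
  show "polynomially_bounded (\<lambda>x. Suc (f x))" "polynomially_bounded (\<lambda>x. f x div 2)"
    "polynomially_bounded (\<lambda>x. poly q (f x))" if f: "polynomially_bounded f"
  proof -
    obtain p where p: "\<And>x. f x \<le> poly p x" using f unfolding polynomially_bounded_def by blast
    have "\<And>x. Suc (f x) \<le> poly (p + 1) x" "\<And>x. f x div 2 \<le> poly p x"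
      using p by (auto intro: le_trans[OF div_le_dividend])
    moreover have "\<And>x. poly q (f x) \<le> poly (pcompose q p) x"
      using poly_nat_mono[OF p] by (simp add: poly_pcompose)
    ultimately show "polynomially_bounded (\<lambda>x. Suc (f x))" "polynomially_bounded (\<lambda>x. f x div 2)"
      "polynomially_bounded (\<lambda>x. poly q (f x))"
      unfolding polynomially_bounded_def by blast+
  qed
qed

section \<open>The reduction\<close>

definition grid_side :: "nat \<Rightarrow> nat \<Rightarrow> nat" where
  "grid_side n e = n * Suc (2 * (e + 1)) + 1"

definition grid_radius :: "nat \<Rightarrow> nat \<Rightarrow> nat" where
  "grid_radius n e = 2 * (e + 1) * (2 * (e + 1)) * ((n + 1) div 2) + e"

definition code_size :: "nat \<Rightarrow> nat \<Rightarrow> nat \<Rightarrow> nat" where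
  "code_size N r a = (7 + 9 * (N * N)) * (N + r + 4 * a + 3) + (N + r + 4 * a + 1)"

definition decide_time :: "nat \<Rightarrow> nat \<Rightarrow> nat" where
  "decide_time n e = grid_side n e * grid_side n e * 52 + (e + 1) * 3 + 20"

abbreviation weights :: "bool \<Rightarrow> nat \<Rightarrow> nat \<Rightarrow> int list" where
  "weights b N a \<equiv> weight_code (if b then (N - 1) * N + N * (N - 1) else 1) (if b then N * N else 0) a"

lemma monotone_bounds:
  assumes "n \<le> m" "e \<le> m"
  shows "build_time n e \<le> build_time m m" "decide_time n e \<le> decide_time m m"
    "code_size (grid_side n e) (grid_radius n e) (e + 1) \<le> code_size (grid_side m m) (grid_radius m m) (m + 1)"
proof -
  have side: "grid_side n e \<le> grid_side m m"
    unfolding grid_side_def using assms by (intro add_le_mono mult_le_mono Suc_le_mono[THEN iffD2] le_refl)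
  have radius: "grid_radius n e \<le> grid_radius m m"
    unfolding grid_radius_def using assms by (intro add_le_mono mult_le_mono div_le_mono le_refl)
  show "code_size (grid_side n e) (grid_radius n e) (e + 1) \<le> code_size (grid_side m m) (grid_radius m m) (m + 1)"
    unfolding code_size_def using assms side radius by (intro add_le_mono mult_le_mono le_refl)
  show "decide_time n e \<le> decide_time m m"
    unfolding decide_time_def using assms side by (intro add_le_mono mult_le_mono le_refl)
  show "build_time n e \<le> build_time m m"
    unfolding build_time_def draw_time_def Let_def
    using assms by (intro add_le_mono mult_le_mono Suc_le_mono[THEN iffD2] le_refl)
qed

lemma polynomially_bounded_times:
  assumes "polynomially_bounded f"
  shows "polynomially_bounded (\<lambda>x. build_time (f x) (f x))" "polynomially_bounded (\<lambda>x. decide_time (f x) (f x))"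
    "polynomially_bounded (\<lambda>x. code_size (grid_side (f x) (f x)) (grid_radius (f x) (f x)) (f x + 1))"
  unfolding build_time_def draw_time_def decide_time_def code_size_def grid_side_def grid_radius_def Let_def
  by (intro polynomially_bounded_intros assms)+

text \<open>Registers and arrays below 100 are left to the other parts of the program. The reduction keeps array 1, where the input
is; its output array 0 becomes array 100. Input and output of the solver become arrays 103 and 101.\<close>

definition reduction_regs :: "nat \<Rightarrow> nat" where
  "reduction_regs r = 2 * r + 100"

definition reduction_arrays :: "nat \<Rightarrow> nat" where
  "reduction_arrays a = (if a = 1 then 1 else 2 * a + 100)"

definition solver_names :: "nat \<Rightarrow> nat" where
  "solver_names r = 2 * r + 101"

definition decision_program :: "bool \<Rightarrow> cmd \<Rightarrow> cmd \<Rightarrow> cmd" where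
  "decision_program b M' M = Seq (rename reduction_regs reduction_arrays M')
     (Seq (build b) (Seq (rename solver_names solver_names M) decide))"

lemma inj_names: "inj reduction_regs" "inj reduction_arrays" "inj solver_names"
proof -
  show "inj reduction_regs" "inj solver_names"
    by (auto simp: inj_def reduction_regs_def solver_names_def)
  show "inj reduction_arrays"
    by (auto simp: inj_def reduction_arrays_def split: if_splits)
qed

lemma names_range:
  "r < 100 \<Longrightarrow> r \<notin> range reduction_regs" "odd r \<Longrightarrow> r \<notin> range reduction_regs"
  "a < 100 \<Longrightarrow> a \<noteq> 1 \<Longrightarrow> a \<notin> range reduction_arrays" "odd a \<Longrightarrow> a \<noteq> 1 \<Longrightarrow> a \<notin> range reduction_arrays"
  "r \<le> 100 \<Longrightarrow> r \<notin> range solver_names"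
  by (auto simp: reduction_regs_def reduction_arrays_def solver_names_def)

lemma init_single: "init [xs] = ((\<lambda>_. 0), (\<lambda>a. if a = 1 then xs else []))"
proof -
  have "nth_default [] [[], xs] a = (if a = 1 then xs else [])" for a
    by (auto simp: nth_default_Cons split: nat.splits)
  then show ?thesis by (simp add: init_def)
qed

text \<open>All times are bounded in terms of the time \<open>t1\<close> of the given reduction, which bounds the numbers of nodes and edges.\<close>

lemma run_decision_program:
  assumes M': "run M' [xs] t1 (int k # w)" and w: "w \<in> graph_codes (V, E)"
    and M: "\<And>N r a T. a > 0 \<Longrightarrow> \<exists>t zs y. run M [grid_code N r a T @
        weights b N a] t zs \<and>
      t \<le> F (code_size N r a) \<and> optimal N (int a) T r y \<and> zs = row_major N y"
    and F: "mono F"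
  shows "\<exists>t. run (decision_program b M' M) [xs] t [of_bool (\<exists>S. bisection (V, E) S \<and> cut_size (V, E) S \<le> k)] \<and>
    t \<le> t1 + build_time t1 t1 + F (code_size (grid_side t1 t1) (grid_radius t1 t1) (t1 + 1)) + decide_time t1 t1"
proof -
  obtain vs es where w_eq: "int k # w = code k vs es" and VE: "grid_subgraph (V, E)" "set vs = V" "distinct vs"
    "(\<lambda>(u, v). {u, v}) ` set es = E" "distinct (map (\<lambda>(u, v). {u, v}) es)"
    using w by (auto simp: graph_codes_def code_def)
  interpret subgrid V E using VE(1) by unfold_locales
  have n: "length vs = card V" using VE(2,3) distinct_card by metis
  have e: "length es = card E"
    using VE(4) distinct_card[OF VE(5)] by simp
  obtain R1 A1 where 1: "exec M' (init [xs]) t1 (R1, A1)" "A1 0 = code k vs es"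
    using M' w_eq by (auto simp: run_def)
  have "length (code k vs es) \<le> t1"
    using exec_length[OF 1(1), of 0] 1(2) by (simp add: init_single)
  moreover have "card V \<le> length (code k vs es)" "card E \<le> length (code k vs es)"
  proof -
    have "length (concat (map (\<lambda>(a, b). [a, b]) vs)) = length vs * 2" for vs :: "point list"
      by (rule length_concat_blocks) auto
    moreover have "length (concat (map (\<lambda>((a, b), (c, d)). [a, b, c, d]) es)) = length es * 4" for es :: "(point \<times> point) list"
      by (rule length_concat_blocks) auto
    ultimately show "card V \<le> length (code k vs es)" "card E \<le> length (code k vs es)"
      unfolding n[symmetric] e[symmetric] code_def by simp_all
  qed
  \<comment> \<open>The code of the graph is the output of a program that runs for \<open>t1\<close> steps.\<close>
  ultimately have le: "card V \<le> t1" "card E \<le> t1" by linarith+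
  define R A where "R = (\<lambda>_ :: nat. 0 :: int)" and "A = (\<lambda>a :: nat. if a = 1 then xs else [])"
  have init: "init [xs] = (R, A)" by (simp add: init_single R_def A_def)
  have "init [xs] = (R \<circ> reduction_regs, A \<circ> reduction_arrays)"
    by (auto simp: init_single R_def A_def reduction_arrays_def fun_eq_iff)
  from exec_rename[OF 1(1) inj_names(1,2) this] obtain R2 A2 where
    2: "exec (rename reduction_regs reduction_arrays M') (R, A) t1 (R2, A2)" "A1 = A2 \<circ> reduction_arrays"
      "\<forall>r. r \<notin> range reduction_regs \<longrightarrow> R2 r = R r" "\<forall>a. a \<notin> range reduction_arrays \<longrightarrow> A2 a = A a"
    by auto
  have A2: "A2 100 = code k vs es" "A2 0 = []" "A2 2 = []" "A2 3 = []" "A2 4 = []"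
    using 1(2) 2(2,4) names_range(3) by (auto simp: reduction_arrays_def A_def)
  have A2_solver: "A2 (solver_names a) = []" and R2_solver: "R2 (solver_names r) = 0" for a r
    using 2(3,4) names_range(2)[of "solver_names r"] names_range(4)[of "solver_names a"]
    by (auto simp: solver_names_def A_def R_def)
  have R2: "R2 0 = 0" using 2(3) names_range(1)[of 0] by (auto simp: R_def)
  let ?N = side and ?a = "card E + 1" and ?r = "quota + card E"
  have side: "?N = grid_side (card V) (card E)" and radius: "?r = grid_radius (card V) (card E)"
    by (simp_all only: side_def width_def quota_def grid_side_def grid_radius_def)
  define U where "U = row_major ?N (\<lambda>x z. int ?a * of_bool ((x, z) \<in> cells))"
  have U: "marked (?N * ?N) (int ?a) (drawing ?N width vs es) = U"
    unfolding U_def by (rule marked_drawing[OF VE(2,4)])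
  define enc where "enc = grid_code ?N ?r ?a cells @
    weights b ?N ?a"
  have enc: "[int ?N, int ?N, 0, 1, int ?r] @ replicate (?N * ?N) 0 @
      concat (map (\<lambda>i. [cost_at U (int ?N) (int i), 1]) [0..<?N * ?N]) @
      weights b ?N ?a = enc"
  proof -
    have "0 < ?a" by simp
    from grid_code_row_major[OF cells_bounds this, of ?r] show ?thesis
      unfolding enc_def U_def by (metis append_assoc)
  qed
  obtain t3 R3 A3 where 3: "exec (build b) (R2, A2) t3 (R3, A3)" "t3 \<le> build_time (card V) (card E)"
    "R3 0 = 0" "R3 2 = 1" "R3 4 = int (card E)" "R3 5 = int ?a" "R3 8 = int ?N" "R3 10 = int (?N * ?N)"
    "R3 12 = int ?r" "R3 31 = int k" "\<forall>x\<ge>100. R3 x = R2 x" "A3 4 = U"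
    "\<forall>x. x \<notin> {2, 3, 4, 103} \<longrightarrow> A3 x = A2 x" "A3 103 = enc"
    using wp_build[where b = b and R = R2 and A = A2, OF R2 A2(1,3-5)] A2_solver[of 1]
    unfolding n e width_def[symmetric] side_def[symmetric] quota_def[symmetric] U enc wp_def
    by (auto simp: solver_names_def)
  obtain t4 zs y where 4: "run M [enc] t4 zs" "t4 \<le> F (code_size ?N ?r ?a)" "optimal ?N (int ?a) cells ?r y"
    "zs = row_major ?N y"
    using M[of ?a ?N ?r cells] unfolding enc_def by auto
  obtain R4 A4 where 5: "exec M (init [enc]) t4 (R4, A4)" "A4 0 = zs" using 4(1) by (auto simp: run_def)
  have "init [enc] = (R3 \<circ> solver_names, A3 \<circ> solver_names)"
  proof -
    have "R3 (solver_names r) = 0" for r using 3(11) R2_solver by (simp add: solver_names_def)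
    moreover have "A3 (solver_names a) = (if a = 1 then enc else [])" for a
      using 3(13,14) A2_solver[of a] by (auto simp: solver_names_def)
    ultimately show ?thesis by (simp add: init_single fun_eq_iff)
  qed
  from exec_rename[OF 5(1) inj_names(3,3) this] obtain R5 A5 where
    6: "exec (rename solver_names solver_names M) (R3, A3) t4 (R5, A5)" "A4 = A5 \<circ> solver_names"
      "\<forall>r. r \<notin> range solver_names \<longrightarrow> R5 r = R3 r" "\<forall>a. a \<notin> range solver_names \<longrightarrow> A5 a = A3 a"
    by auto
  have R5: "R5 r = R3 r" if "r \<le> 100" for r using 6(3) names_range(5)[OF that] by blast
  have A5: "A5 r = A3 r" if "r \<le> 100" for r using 6(4) names_range(5)[OF that] by blast
  have zs: "A5 101 = zs" using 5(2) 6(2) by (simp add: solver_names_def)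
  have A5': "A5 0 = []" "A5 4 = U" using A5 3(12,13) A2(2) by auto
  obtain t6 R6 A6 where 7: "exec decide (R5, A5) t6 (R6, A6)" "t6 \<le> ?N * ?N * 52 + ?a * 3 + 20"
    "A6 0 = [of_bool ((\<Sum>i<?N * ?N. cell_cost (int ?a) U (int ?N) zs (int i)) \<le> int ?a * int k - (int ?r - int (card E)))]"
    using wp_decide[where R = R5 and A = A5 and m = "?N * ?N" and a = ?a] R5 A5' zs 3(3-10)
    unfolding wp_def by auto
  have "(\<Sum>i<?N * ?N. cell_cost (int ?a) U (int ?N) zs (int i)) = int ?a * jumps ?N cells y - mass ?N cells y"
    using sum_cell_cost[OF cells_bounds, of y "int ?a"] 4(3)
    unfolding U_def 4(4) by (simp add: optimal_def feasible_def)
  then have "A6 0 = [of_bool (\<exists>S. bisection (V, E) S \<and> cut_size (V, E) S \<le> k)]"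
    unfolding 7(3) optimum_decides[OF 4(3), of k] by simp
  moreover have "exec (decision_program b M' M) (R, A) (t1 + (t3 + (t4 + t6))) (R6, A6)"
    unfolding decision_program_def by (rule exec.Seq[OF 2(1) exec.Seq[OF 3(1) exec.Seq[OF 6(1) 7(1)]]])
  moreover have "t1 + (t3 + (t4 + t6)) \<le>
    t1 + build_time t1 t1 + F (code_size (grid_side t1 t1) (grid_radius t1 t1) (t1 + 1)) + decide_time t1 t1"
  proof -
    have "t3 \<le> build_time t1 t1" using 3(2) monotone_bounds(1)[OF le] by simp
    moreover have "t4 \<le> F (code_size (grid_side t1 t1) (grid_radius t1 t1) (t1 + 1))"
      using 4(2) monoD[OF F monotone_bounds(3)[OF le]] unfolding side radius by simp
    moreover have "t6 \<le> decide_time t1 t1"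
      using 7(2) monotone_bounds(2)[OF le] unfolding side decide_time_def by simp
    ultimately show ?thesis by simp
  qed
  ultimately show ?thesis unfolding run_def init by blast
qed

text \<open>Both problems enter only through a family of instances whose codes differ in the lists of weights.\<close>

lemma NP_subset_P_if_solvable:
  fixes \<Pi> :: "'i optimisation_problem" and inst :: "nat \<Rightarrow> nat \<Rightarrow> nat \<Rightarrow> cell set \<Rightarrow> 'i"
  assumes "MBFH_NP_hard" and M: "pseudo_polynomial_algorithm M \<Pi>"
    and inst: "\<And>N r a T. a > 0 \<Longrightarrow> inst N r a T \<in> instances \<Pi>"
    and enc: "\<And>N r a T. encode \<Pi> (inst N r a T) =
      grid_code N r a T @ weights b N a"
    and size: "\<And>N r a T. bitsize (encode \<Pi> (inst N r a T)) + magnitude \<Pi> (inst N r a T) \<le> code_size N r a"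
    and sol: "\<And>N r a T zs. zs \<in> solutions \<Pi> (inst N r a T) \<Longrightarrow> \<exists>y. optimal N (int a) T r y \<and> zs = row_major N y"
  shows "class_NP \<subseteq> class_P"
proof
  fix L assume "L \<in> class_NP"
  from bspec[OF assms(1)[unfolded MBFH_NP_hard_def NP_hard_minimisation_def] this]
  obtain M' and p :: "nat poly" where red: "\<forall>xs. \<exists>t i w k. run M' [xs] t (int k # w) \<and> t \<le> poly p (bitsize xs) \<and>
      w \<in> graph_codes i \<and> (xs \<in> L \<longleftrightarrow> (\<exists>S. bisection i S \<and> cut_size i S \<le> k))"
    by (elim exE) (rule that)
  obtain q where q: "\<And>i. i \<in> instances \<Pi> \<Longrightarrow> \<exists>t zs. run M [encode \<Pi> i] t zs \<and> zs \<in> solutions \<Pi> i \<and>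
      t \<le> poly q (bitsize (encode \<Pi> i) + magnitude \<Pi> i)"
    using M unfolding pseudo_polynomial_algorithm_def by blast
  have solve: "\<exists>t zs y. run M [grid_code N r a T @
        weights b N a] t zs \<and>
      t \<le> poly q (code_size N r a) \<and> optimal N (int a) T r y \<and> zs = row_major N y" if "a > 0" for N r a T
    using q[OF inst[OF that, of N r T]] sol[of _ N r a T] poly_nat_mono[OF size[of N r a T], of q]
    unfolding enc by (meson order.trans)
  let ?F = "\<lambda>m. m + build_time m m + poly q (code_size (grid_side m m) (grid_radius m m) (m + 1)) + decide_time m m"
  have "polynomially_bounded (\<lambda>x. ?F (poly p x))"
    by (intro polynomially_bounded_intros polynomially_bounded_times)
  then obtain B where B: "\<And>x. ?F (poly p x) \<le> poly B x" unfolding polynomially_bounded_def by blast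
  have mono: "?F m \<le> ?F m'" if "m \<le> m'" for m m'
    using that monotone_bounds[OF that that] by (intro add_le_mono poly_nat_mono)
  have "\<exists>t. run (decision_program b M' M) [xs] t [of_bool (xs \<in> L)] \<and> t \<le> poly B (bitsize xs)" for xs
  proof -
    obtain t1 i w k where r: "run M' [xs] t1 (int k # w)" "t1 \<le> poly p (bitsize xs)" "w \<in> graph_codes i"
      "xs \<in> L \<longleftrightarrow> (\<exists>S. bisection i S \<and> cut_size i S \<le> k)"
      using spec[OF red, of xs] by (elim exE conjE) (rule that)
    obtain V E where i: "i = (V, E)" by fastforce
    have "\<exists>t. run (decision_program b M' M) [xs] t [of_bool (\<exists>S. bisection (V, E) S \<and> cut_size (V, E) S \<le> k)] \<and> t \<le> ?F t1"
      using run_decision_program[OF r(1) r(3)[unfolded i] solve] poly_nat_mono by (simp add: mono_def)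
    then show ?thesis
      using mono[OF r(2)] B[of "bitsize xs"] unfolding r(4) i by (meson order.trans)
  qed
  then show "L \<in> class_P" unfolding class_P_def by blast
qed

text \<open>A program for \<open>L\<close> need not ignore the certificate in array 2, so its arrays from 2 on are moved out of the way.\<close>

lemma P_subset_NP: "class_P \<subseteq> class_NP"
proof
  fix L assume "L \<in> class_P"
  then obtain M p where M: "\<And>xs. \<exists>t. run M [xs] t [of_bool (xs \<in> L)] \<and> t \<le> poly p (bitsize xs)"
    unfolding class_P_def by blast
  let ?g = "\<lambda>a :: nat. if a < 2 then a else Suc a"
  have g: "inj ?g" by (auto simp: inj_def split: if_splits)
  have "\<exists>t. run (rename id ?g M) [xs, ys] t [of_bool (xs \<in> L)] \<and> t \<le> poly p (bitsize xs + bitsize ys)" for xs ys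
  proof -
    obtain t R A where t: "exec M (init [xs]) t (R, A)" "A 0 = [of_bool (xs \<in> L)]" "t \<le> poly p (bitsize xs)"
      using M[of xs] unfolding run_def by blast
    obtain R0 A0 where init: "init [xs, ys] = (R0, A0)" by fastforce
    have "init [xs] = (R0 \<circ> id, A0 \<circ> ?g)"
    proof -
      have "R0 = (\<lambda>_. 0)" "A0 = (\<lambda>a. nth_default [] [[], xs, ys] a)" using init by (simp_all add: init_def)
      then show ?thesis
        by (auto simp: init_single fun_eq_iff nth_default_Cons less_Suc_eq numeral_2_eq_2 split: nat.splits)
    qed
    from exec_rename[OF t(1) inj_on_id g this] obtain R' A' where
      "exec (rename id ?g M) (R0, A0) t (R', A')" "A = A' \<circ> ?g" by auto
    moreover have "A' 0 = [of_bool (xs \<in> L)]" using t(2) \<open>A = A' \<circ> ?g\<close> by simp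
    moreover have "t \<le> poly p (bitsize xs + bitsize ys)"
      using t(3) poly_nat_mono[of "bitsize xs" "bitsize xs + bitsize ys" p] by simp
    ultimately show ?thesis unfolding run_def init by blast
  qed
  then have "poly_time_relation (\<lambda>xs ys. xs \<in> L)" unfolding poly_time_relation_def by blast
  moreover have "xs \<in> L \<longleftrightarrow> (\<exists>ys. bitsize ys \<le> poly 0 (bitsize xs) \<and> xs \<in> L)" for xs
    by (auto intro!: exI[of _ "[]"] simp: bitsize_def)
  ultimately show "L \<in> class_NP" unfolding class_NP_def by blast
qed

lemma polynomial_imp_pseudo_polynomial: "polynomial_algorithm M \<Pi> \<Longrightarrow> pseudo_polynomial_algorithm M \<Pi>"
  unfolding polynomial_algorithm_def pseudo_polynomial_algorithm_def
  by (meson le_add1 order.trans poly_nat_mono)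

theorem corollary1:
  assumes "MBFH_NP_hard"
    and "class_NP \<noteq> class_P"
  shows "\<not> (\<exists>M. polynomial_algorithm M TR_IP) \<and>
         \<not> (\<exists>M. pseudo_polynomial_algorithm M TR_IP) \<and>
         \<not> (\<exists>M. polynomial_algorithm M wTR_IP_2D) \<and>
         \<not> (\<exists>M. pseudo_polynomial_algorithm M wTR_IP_2D)"
proof -
  have "\<not> class_NP \<subseteq> class_P" using assms(2) P_subset_NP by blast
  then have "\<not> pseudo_polynomial_algorithm M TR_IP" "\<not> pseudo_polynomial_algorithm M' wTR_IP_2D" for M M'
    using NP_subset_P_if_solvable[where b = False and inst = tr_ip_of, OF assms(1), of M TR_IP]
      NP_subset_P_if_solvable[where b = True and inst = wtr_ip_of, OF assms(1), of M' wTR_IP_2D]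
      TR_IP_instance wTR_IP_2D_instance encode_TR_IP encode_wTR_IP_2D TR_IP_size wTR_IP_2D_size
      TR_IP_solutions wTR_IP_2D_solutions
    unfolding code_size_def row_major_def by auto
  then show ?thesis
    using polynomial_imp_pseudo_polynomial[of _ TR_IP] polynomial_imp_pseudo_polynomial[of _ wTR_IP_2D] by blast
qed

end
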